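(* Let $q>p\ge 1$. There is a constant $c_{p,q}$ depending only on $(p,q)$ (and not on $d$) such that the following holds for every integer $d\ge 1$ and every integer $n\ge 2$. Let $\mathcal X=\mathbb R^d$ with Euclidean norm $\|\cdot\|$, let $\mu$ be a probability measure on $\mathbb R^d$ such that $\left(\mathbb E\|X\|^q\right)^{1/q}=M_q<\infty$ for $X\sim\mu$, and let $\hat\mu$ be the empirical measure of $n$ independent samples from $\mu$. Then $$\mathbb E\,W_p(\hat\mu,\mu)\le c_{p,q}\,M_q\, n^{-\left[\frac{1}{(2p)\vee d}\wedge\left(\frac1p-\frac1q\right)\right]}(\log n)^{\zeta_{p,q,d}/p},$$ where $$\zeta_{p,q,d}=\begin{cases}2 & \text{if } d=q=2p,\\ 1 & \text{if } \left(d\neq 2p \text{ and } q=\frac{dp}{d-p}\wedge 2p\right)\text{ or }\left(q>d=2p\right),\\ 0 & \text{otherwise.}\end{cases}$$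
   Context: $a\wedge b=\min(a,b)$, $a\vee b=\max(a,b)$. When $d\le p$, the quantity $\frac{dp}{d-p}$ is interpreted as $+\infty$. For probability measures $\mu,\nu$ on $\mathcal X$ and $p\in[1,\infty)$, $W_p(\mu,\nu)=\inf_{\xi\in\mathcal C(\mu,\nu)}\left[\mathbb E_{(X,Y)\sim\xi}\|X-Y\|^p\right]^{1/p}$, where $\mathcal C(\mu,\nu)$ is the set of all distributions on $\mathcal X^2$ with marginals $\mu$ and $\nu$. The empirical measure $\hat\mu$ puts mass $1/n$ at each of $n$ independent samples from $\mu$; the expectation is over these samples. *)

theory Defs
  imports "HOL-Probability.Probability"
begin

text \<open>
  Statements that quantify over the dimension \<open>d\<close> cannot use a type for \<open>\<real>\<^sup>d\<close>. Points are
  elements of \<open>{..<d} \<rightarrow>\<^sub>E UNIV\<close>, and the product sigma-algebra on this set is the Borel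
  sigma-algebra of \<open>\<real>\<^sup>d\<close>. \<open>Rd d\<close> serves only as a measurable space; its measure is irrelevant.
\<close>

abbreviation Rd :: "nat \<Rightarrow> (nat \<Rightarrow> real) measure" where
  "Rd d \<equiv> PiM {..<d} (\<lambda>_. borel)"

abbreviation enorm :: "nat \<Rightarrow> (nat \<Rightarrow> real) \<Rightarrow> real" where
  "enorm d x \<equiv> L2_set x {..<d}"

definition ennreal_powr :: "ennreal \<Rightarrow> real \<Rightarrow> ennreal" where
  "ennreal_powr x a = (if x = \<top> then \<top> else ennreal (enn2real x powr a))"

definition couplings :: "'a measure \<Rightarrow> 'a measure \<Rightarrow> ('a \<times> 'a) measure set" where
  "couplings \<mu> \<nu> =
     {\<xi>. prob_space \<xi> \<and> sets \<xi> = sets (\<mu> \<Otimes>\<^sub>M \<nu>) \<and> distr \<xi> \<mu> fst = \<mu> \<and> distr \<xi> \<nu> snd = \<nu>}"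

definition wasserstein ::
    "nat \<Rightarrow> real \<Rightarrow> (nat \<Rightarrow> real) measure \<Rightarrow> (nat \<Rightarrow> real) measure \<Rightarrow> ennreal" where
  "wasserstein d p \<mu> \<nu> =
     (INF \<xi>\<in>couplings \<mu> \<nu>.
        ennreal_powr (\<integral>\<^sup>+(x, y). ennreal (enorm d (\<lambda>i. x i - y i) powr p) \<partial>\<xi>) (1 / p))"

text \<open>The image of the uniform distribution on the indices: points occurring several times in the
  sample are counted with multiplicity.\<close>

definition empirical :: "nat \<Rightarrow> nat \<Rightarrow> (nat \<Rightarrow> nat \<Rightarrow> real) \<Rightarrow> (nat \<Rightarrow> real) measure" where
  "empirical d n X = distr (uniform_count_measure {..<n}) (Rd d) X"

text \<open>The quantity \<open>dp/(d-p)\<close>, read as infinite when \<open>d \<le> p\<close>.\<close>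

definition crit :: "real \<Rightarrow> nat \<Rightarrow> ereal" where
  "crit p d = (if real d \<le> p then \<infinity> else ereal (real d * p / (real d - p)))"

definition zeta :: "real \<Rightarrow> real \<Rightarrow> nat \<Rightarrow> real" where
  "zeta p q d =
     (if real d = q \<and> q = 2 * p then 2
      else if (real d \<noteq> 2 * p \<and> ereal q = min (crit p d) (ereal (2 * p)))
              \<or> (q > real d \<and> real d = 2 * p) then 1
      else 0)"

end

theory Submission
  imports Defs
begin

text \<open>
  Space is cut into dyadic shells of radii \<open>M 2^j\<close>, where \<open>M\<close> is the moment bound, and at level \<open>k\<close>
  shell \<open>j\<close> is cut into cubes of diameter \<open>M 2^(j - k)\<close>. Sample and law are coupled greedily from
  the finest level upwards: within each cell as much as possible of the remaining masses is matched,
  and the rest is left to the next coarser level. What remains in a cell \<open>F\<close> is the excess of one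
  mass over the other there, whatever happened at finer levels, so the transport cost is at most a
  constant times the sum over all cells of \<open>(M 2^(j - k))^p\<close> times the difference of the masses of
  \<open>F\<close>. That difference has expectation at most \<open>min (2 \<mu>(F)) (sqrt (\<mu>(F) / n))\<close>; shell \<open>j\<close> has mass
  \<open>O(2^(- q j))\<close> and meets at most \<open>(18 * 2^k)^d\<close> cubes. By Cauchy-Schwarz it remains to bound
  the double series of \<open>2^(p (j - k)) min (2^(- q j)) (sqrt ((18 * 2^k)^d 2^(- q j) / n))\<close>. The sum
  over \<open>k\<close> is decided by the sign of \<open>d - 2 p\<close> and the sum over \<open>j\<close> by the sign of \<open>p - q (1 - a)\<close> with
  \<open>a = p / max (2 p) d\<close>; a vanishing sign costs a logarithm.
\<close>

section \<open>Greedy matching on countably many cells\<close>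

text \<open>The constant may not depend on \<open>d\<close>, and this decides how cells are counted.
  A cube of diameter 1 has side 1 / sqrt d, and filling the box around the unit ball would take
  about (2 sqrt d)^d of them; only the small volume of the ball keeps the count at C^d. Such a
  factor is harmless: for d > 2 p the dominant level is the one whose cells hold about one sample
  point each, so the count enters through its d-th root and leaves C^p. Constants that blow up as d
  approaches a critical value concern finitely many dimensions, since p and q are fixed and d is an
  integer.

  Transport plans are kept as densities with respect to the product of the two measures. The
  unmatched parts have densities themselves, so a plan between them is reweighted into a density for
  the original measures, and the matches inside cells are simply added. Nothing has to be
  disintegrated or glued.

  With \<open>n\<close> levels, moving mass within the finest cells costs less than the rate that is
  claimed.\<close>

definition cell_mass :: "'a measure \<Rightarrow> ('a \<Rightarrow> 'l) \<Rightarrow> 'l \<Rightarrow> ennreal" where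
  "cell_mass A f l = emeasure A {x \<in> space A. f x = l}"

lemma nn_integral_label:
  fixes f :: "'a \<Rightarrow> 'l::countable"
  assumes [measurable]: "f \<in> A \<rightarrow>\<^sub>M count_space UNIV"
  shows "(\<integral>\<^sup>+x. F (f x) \<partial>A) = (\<integral>\<^sup>+l. F l * cell_mass A f l \<partial>count_space UNIV)"
proof -
  have "(\<integral>\<^sup>+x. F (f x) \<partial>A) = (\<integral>\<^sup>+x. (\<integral>\<^sup>+l. F l * indicator {x \<in> space A. f x = l} x \<partial>count_space UNIV) \<partial>A)"
  proof (rule nn_integral_cong)
    fix x assume "x \<in> space A"
    then have "(\<integral>\<^sup>+l. F l * indicator {x \<in> space A. f x = l} x \<partial>count_space UNIV)
        = (\<integral>\<^sup>+l. F l * indicator {f x} l \<partial>count_space UNIV)"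
      by (intro nn_integral_cong) (auto split: split_indicator)
    also have "\<dots> = F (f x)"
      by (subst nn_integral_indicator_singleton) (auto simp: one_ennreal_def[symmetric])
    finally show "F (f x) = (\<integral>\<^sup>+l. F l * indicator {x \<in> space A. f x = l} x \<partial>count_space UNIV)" by simp
  qed
  also have "\<dots> = (\<integral>\<^sup>+l. (\<integral>\<^sup>+x. F l * indicator {x \<in> space A. f x = l} x \<partial>A) \<partial>count_space UNIV)"
    by (intro nn_integral_count_space_nn_integral) auto
  also have "\<dots> = (\<integral>\<^sup>+l. F l * cell_mass A f l \<partial>count_space UNIV)"
    by (intro nn_integral_cong) (simp add: nn_integral_cmult_indicator cell_mass_def)
  finally show ?thesis .
qed

text \<open>There are only countably many cells, so those of mass zero together form a null set.
  Division by cell masses, as in \<open>residual\<close>, is therefore safe almost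
  everywhere.\<close>

lemma AE_cell_mass_nonzero:
  fixes f :: "'a \<Rightarrow> 'l::countable"
  assumes [measurable]: "f \<in> A \<rightarrow>\<^sub>M count_space UNIV"
  shows "AE x in A. cell_mass A f (f x) \<noteq> 0"
proof -
  let ?F = "\<lambda>l. if cell_mass A f l = 0 then 1 else 0 :: ennreal"
  have "(\<integral>\<^sup>+x. ?F (f x) \<partial>A) = 0"
    by (subst nn_integral_label) (auto simp: if_distrib intro!: nn_integral_zero' cong: if_cong)
  then have "AE x in A. ?F (f x) = 0"
    by (subst (asm) nn_integral_0_iff_AE) auto
  then show ?thesis by eventually_elim (auto split: if_splits)
qed

lemma divide_times_cancel_ennreal:
  fixes a c :: ennreal
  shows "a \<noteq> 0 \<Longrightarrow> a < \<top> \<Longrightarrow> c / a * a = c"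
  by (simp add: ennreal_divide_times)

text \<open>In a cell with masses \<open>a\<close> and \<open>b\<close>, a point of the first
  measure keeps the fraction \<open>(a - b) / a\<close> for coarser levels and spends
  \<open>b * inverse (max a b)\<close>, that is min a b / a, on the match. The factor
  \<open>inverse (max a b)\<close> is symmetric, so one density serves both marginals.\<close>

lemma min_over_max_ennreal:
  fixes a b :: ennreal
  assumes "a \<noteq> 0" "a < \<top>" "b < \<top>"
  shows "(a - b) / a + b * inverse (max a b) = 1"
proof -
  obtain r where r: "a = ennreal r" "r > 0" using assms(1,2) by (cases a) (auto simp: le_less)
  obtain s where s: "b = ennreal s" "s \<ge> 0" using assms(3) by (cases b) auto
  have mx: "max a b = ennreal (max r s)" using r s by (simp add: max_def)
  show "(a - b) / a + b * inverse (max a b) = 1"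
  proof (cases "r \<le> s")
    case True
    then have "a - b = 0" using r s by (simp add: ennreal_minus ennreal_eq_0_iff)
    moreover have "b * inverse (max a b) = 1" using r s True
      by (simp add: mx max_def inverse_ennreal ennreal_mult[symmetric])
    ultimately show ?thesis by simp
  next
    case False
    then show ?thesis using r s
      by (simp add: mx max_def inverse_ennreal ennreal_mult[symmetric] ennreal_minus divide_ennreal
           ennreal_plus[symmetric] field_simps del: ennreal_plus)
  qed
qed

lemma min_over_max_ennreal':
  fixes a b :: ennreal
  assumes "a < \<top>" "b < \<top>"
  shows "(a - b) + a * b * inverse (max a b) = a"
proof (cases "a = 0")
  case False
  have "a = a * ((a - b) / a + b * inverse (max a b))" 
    using min_over_max_ennreal[OF False assms] by simp
  also have "\<dots> = (a - b) / a * a + a * b * inverse (max a b)" 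
    by (simp add: distrib_left mult_ac)
  finally show ?thesis using divide_times_cancel_ennreal[OF False assms(1)] by simp
qed simp

text \<open>Subtraction on \<open>ennreal\<close> is truncated at 0, so the two differences add up
  to the absolute difference of the cell masses.\<close>

definition discrepancy :: "('l \<Rightarrow> ennreal) \<Rightarrow> ('a \<Rightarrow> 'l) \<Rightarrow> 'a measure \<Rightarrow> 'a measure \<Rightarrow> ennreal" where
  "discrepancy w f A B = (\<integral>\<^sup>+l. w l * ((cell_mass A f l - cell_mass B f l)
      + (cell_mass B f l - cell_mass A f l)) \<partial>count_space UNIV)"

text \<open>The part of \<open>A\<close> left over when in each cell of \<open>f\<close> as much as possible is matched with \<open>B\<close>.\<close>

definition residual :: "('a \<Rightarrow> 'l) \<Rightarrow> 'a measure \<Rightarrow> 'a measure \<Rightarrow> 'a measure" where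
  "residual f A B =
     density A (\<lambda>x. (cell_mass A f (f x) - cell_mass B f (f x)) / cell_mass A f (f x))"

lemma sets_residual[simp, measurable_cong]: "sets (residual f A B) = sets A"
  by (simp only: residual_def sets_density)

lemma space_residual[simp]: "space (residual f A B) = space A"
  by (simp only: residual_def space_density)

lemma emeasure_less_top: "finite_measure A \<Longrightarrow> emeasure A S < \<top>"
  by (metis finite_measure.emeasure_finite infinity_ennreal_def less_top)

lemma cell_mass_finite: "finite_measure A \<Longrightarrow> cell_mass A f l < \<top>"
  by (simp only: cell_mass_def emeasure_less_top)

lemma nn_integral_residual:
  assumes [measurable]: "f \<in> A \<rightarrow>\<^sub>M count_space UNIV" "h \<in> borel_measurable A"
  shows "(\<integral>\<^sup>+x. h x \<partial>residual f A B) =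
    (\<integral>\<^sup>+x. (cell_mass A f (f x) - cell_mass B f (f x)) / cell_mass A f (f x) * h x \<partial>A)"
  unfolding residual_def
  by (rule nn_integral_density[OF measurable_compose[OF assms(1)] assms(2)]) simp

lemma nn_integral_residual_label:
  fixes f :: "'a \<Rightarrow> 'l::countable"
  assumes [measurable]: "f \<in> A \<rightarrow>\<^sub>M count_space UNIV" and "finite_measure A"
  shows "(\<integral>\<^sup>+x. F (f x) \<partial>residual f A B)
    = (\<integral>\<^sup>+l. F l * (cell_mass A f l - cell_mass B f l) \<partial>count_space UNIV)"
proof -
  let ?a = "cell_mass A f" and ?b = "cell_mass B f"
  have "(\<integral>\<^sup>+x. F (f x) \<partial>residual f A B) = (\<integral>\<^sup>+x. (\<lambda>l. (?a l - ?b l) / ?a l * F l) (f x) \<partial>A)"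
    by (subst nn_integral_residual) auto
  also have "\<dots> = (\<integral>\<^sup>+l. (?a l - ?b l) / ?a l * F l * ?a l \<partial>count_space UNIV)"
    by (rule nn_integral_label) fact
  also have "\<dots> = (\<integral>\<^sup>+l. F l * (?a l - ?b l) \<partial>count_space UNIV)"
  proof (intro nn_integral_cong)
    fix l
    show "(?a l - ?b l) / ?a l * F l * ?a l = F l * (?a l - ?b l)"
    proof (cases "?a l = 0")
      case False
      have "(?a l - ?b l) / ?a l * F l * ?a l = F l * ((?a l - ?b l) / ?a l * ?a l)"
        by (simp only: mult_ac)
      then show ?thesis
        using divide_times_cancel_ennreal[OF False cell_mass_finite[OF assms(2)]] by simp
    qed simp
  qed
  finally show ?thesis .
qed

text \<open>The last integral is over the matched mass: a b / max a b is min a b, also when both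
  masses are 0. It is symmetric in \<open>A\<close> and \<open>B\<close>.\<close>

lemma nn_integral_label_split:
  fixes f :: "'a \<Rightarrow> 'l::countable"
  assumes [measurable]: "f \<in> A \<rightarrow>\<^sub>M count_space UNIV" and "finite_measure A" "finite_measure B"
  shows "(\<integral>\<^sup>+x. F (f x) \<partial>A) = (\<integral>\<^sup>+x. F (f x) \<partial>residual f A B)
    + (\<integral>\<^sup>+l. F l * (cell_mass A f l * cell_mass B f l * inverse (max (cell_mass A f l) (cell_mass B f l)))
        \<partial>count_space UNIV)"
proof -
  have "F l * cell_mass A f l = F l * (cell_mass A f l - cell_mass B f l)
      + F l * (cell_mass A f l * cell_mass B f l * inverse (max (cell_mass A f l) (cell_mass B f l)))" for l
    using min_over_max_ennreal'[OF cell_mass_finite[OF assms(2)] cell_mass_finite[OF assms(3)], of f l f l]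
    by (metis distrib_left)
  then show ?thesis
    unfolding nn_integral_residual_label[OF assms(1,2)] nn_integral_label[OF assms(1)]
    by (subst nn_integral_add[symmetric]) auto
qed

lemma finite_measure_residual:
  fixes f :: "'a \<Rightarrow> 'l::countable"
  assumes [measurable]: "f \<in> A \<rightarrow>\<^sub>M count_space UNIV" and "finite_measure A" "finite_measure B"
  shows "finite_measure (residual f A B)"
proof (rule finite_measureI)
  have "emeasure (residual f A B) (space A) \<le> emeasure A (space A)"
    using nn_integral_label_split[OF assms, of "\<lambda>_. 1"] by simp
  moreover have "emeasure A (space A) < \<top>"
    using assms(2) by (rule emeasure_less_top)
  ultimately show "emeasure (residual f A B) (space (residual f A B)) \<noteq> \<infinity>"
    by (auto simp: top_unique)
qed

text \<open>Both measures lose the same matched integral \<open>m\<close>, which cancels. Finiteness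
  of the integral over \<open>A\<close> forces \<open>m\<close> to be finite, as cancellation in
  \<open>ennreal\<close> requires.\<close>

lemma residual_label_diff:
  fixes f :: "'a \<Rightarrow> 'l::countable"
  assumes [measurable]: "f \<in> A \<rightarrow>\<^sub>M count_space UNIV" "f \<in> B \<rightarrow>\<^sub>M count_space UNIV"
    and "finite_measure A" "finite_measure B"
    and fin: "(\<integral>\<^sup>+x. F (f x) \<partial>A) < \<top>"
  shows "(\<integral>\<^sup>+x. F (f x) \<partial>residual f A B) - (\<integral>\<^sup>+x. F (f x) \<partial>residual f B A)
    = (\<integral>\<^sup>+x. F (f x) \<partial>A) - (\<integral>\<^sup>+x. F (f x) \<partial>B)"
proof -
  have *: "x + m < \<top> \<Longrightarrow> x - y = (x + m) - (y + m)" for x y m :: ennreal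
    by (cases x; cases y; cases m) (auto simp: ennreal_minus ennreal_plus[symmetric] simp del: ennreal_plus)
  have split: "(\<integral>\<^sup>+x. F (f x) \<partial>A) = (\<integral>\<^sup>+x. F (f x) \<partial>residual f A B) + m"
      "(\<integral>\<^sup>+x. F (f x) \<partial>B) = (\<integral>\<^sup>+x. F (f x) \<partial>residual f B A) + m"
    if "m = (\<integral>\<^sup>+l. F l * (cell_mass A f l * cell_mass B f l
      * inverse (max (cell_mass A f l) (cell_mass B f l))) \<partial>count_space UNIV)" for m
    unfolding that nn_integral_label_split[OF assms(1,3,4), of F]
      nn_integral_label_split[OF assms(2,4,3), of F]
    by (simp_all only: mult.commute[of "cell_mass B f _"] max.commute[of "cell_mass B f _"])
  show ?thesis
    using fin unfolding split[OF refl] by (rule *)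
qed

text \<open>This is why matching at a fine level leaves the excesses at coarser levels intact: a
  cell of \<open>g\<close> is the union of the cells of \<open>f\<close> with labels in
  \<open>S\<close>, and in each of these both measures have lost the same mass.\<close>

lemma cell_mass_residual_diff:
  fixes f :: "'a \<Rightarrow> 'l::countable" and g :: "'a \<Rightarrow> 'k"
  assumes [measurable]: "f \<in> A \<rightarrow>\<^sub>M count_space UNIV" "f \<in> B \<rightarrow>\<^sub>M count_space UNIV"
    and "finite_measure A" "finite_measure B" and "space A = space B"
    and refine: "\<And>x y. x \<in> space A \<Longrightarrow> y \<in> space A \<Longrightarrow> f x = f y \<Longrightarrow> g x = g y"
  shows "cell_mass (residual f A B) g l - cell_mass (residual f B A) g l
    = cell_mass A g l - cell_mass B g l"
proof -
  define S where "S = f ` {x \<in> space A. g x = l}"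
  have eq: "cell_mass C g l = (\<integral>\<^sup>+x. indicator S (f x) \<partial>C)"
    if [measurable]: "f \<in> C \<rightarrow>\<^sub>M count_space UNIV" and sp: "space C = space A" for C
  proof -
    have *: "{x \<in> space C. g x = l} = f -` S \<inter> space C"
      using refine sp by (auto simp: S_def)
    have "(\<integral>\<^sup>+x. indicator S (f x) \<partial>C) = (\<integral>\<^sup>+x. indicator (f -` S \<inter> space C) x \<partial>C)"
      by (intro nn_integral_cong) (auto split: split_indicator)
    also have "\<dots> = emeasure C (f -` S \<inter> space C)"
      by (intro nn_integral_indicator measurable_sets[OF that(1)]) simp
    finally show ?thesis by (simp add: cell_mass_def *)
  qed
  have m: "f \<in> residual f A B \<rightarrow>\<^sub>M count_space UNIV" "f \<in> residual f B A \<rightarrow>\<^sub>M count_space UNIV"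
    by measurable
  have "cell_mass A g l < \<top>" by (rule cell_mass_finite) fact
  then have "(\<integral>\<^sup>+x. indicator S (f x) \<partial>A) < \<top>" unfolding eq[OF assms(1) refl] .
  note residual_label_diff[OF assms(1-4) this]
  then show ?thesis
    unfolding eq[OF assms(1) refl] eq[OF assms(2) assms(5)[symmetric]]
      eq[OF m(1) space_residual] eq[OF m(2) trans[OF space_residual assms(5)[symmetric]]] .
qed

lemma discrepancy_residual:
  fixes f :: "'a \<Rightarrow> 'l::countable"
  assumes [measurable]: "f \<in> A \<rightarrow>\<^sub>M count_space UNIV" "f \<in> B \<rightarrow>\<^sub>M count_space UNIV"
    and "finite_measure A" "finite_measure B" and "space A = space B"
    and refine: "\<And>x y. x \<in> space A \<Longrightarrow> y \<in> space A \<Longrightarrow> f x = f y \<Longrightarrow> g x = g y"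
  shows "discrepancy w g (residual f A B) (residual f B A) = discrepancy w g A B"
proof -
  have "cell_mass (residual f B A) g l - cell_mass (residual f A B) g l
    = cell_mass B g l - cell_mass A g l" for l
    by (rule cell_mass_residual_diff[OF assms(2,1,4,3)]) (auto simp: assms(5) intro: refine)
  moreover have "cell_mass (residual f A B) g l - cell_mass (residual f B A) g l
    = cell_mass A g l - cell_mass B g l" for l
    by (rule cell_mass_residual_diff[OF assms])
  ultimately show ?thesis
    unfolding discrepancy_def by (simp only:)
qed

lemma emeasure_residual_space:
  fixes f :: "'a \<Rightarrow> 'l::countable"
  assumes [measurable]: "f \<in> A \<rightarrow>\<^sub>M count_space UNIV" "f \<in> B \<rightarrow>\<^sub>M count_space UNIV"
    and "finite_measure A" "finite_measure B"
    and mass: "emeasure A (space A) = emeasure B (space B)"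
  shows "emeasure (residual f A B) (space A) = emeasure (residual f B A) (space B)"
proof -
  have "emeasure A (space A) < \<top>"
    using assms(3) by (rule emeasure_less_top)
  then have "(\<integral>\<^sup>+x. (\<lambda>_. 1) (f x) \<partial>A) < \<top>" "(\<integral>\<^sup>+x. (\<lambda>_. 1) (f x) \<partial>B) < \<top>"
    using mass by auto
  from residual_label_diff[OF assms(1-4) this(1)] residual_label_diff[OF assms(2,1,4,3) this(2)]
  have "emeasure (residual f A B) (space A) - emeasure (residual f B A) (space B) = 0"
    "emeasure (residual f B A) (space B) - emeasure (residual f A B) (space A) = 0"
    using mass \<open>emeasure A (space A) < \<top>\<close> by simp_all
  then show ?thesis
    unfolding diff_eq_0_iff_ennreal by (intro antisym) simp_all
qed

lemma discrepancy_eq_residual: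
  fixes f :: "'a \<Rightarrow> 'l::countable"
  assumes [measurable]: "f \<in> A \<rightarrow>\<^sub>M count_space UNIV" "f \<in> B \<rightarrow>\<^sub>M count_space UNIV"
    and "finite_measure A" "finite_measure B"
  shows "discrepancy w f A B
    = (\<integral>\<^sup>+x. w (f x) \<partial>residual f A B) + (\<integral>\<^sup>+x. w (f x) \<partial>residual f B A)"
  unfolding nn_integral_residual_label[OF assms(1,3)] nn_integral_residual_label[OF assms(2,4)]
    discrepancy_def distrib_left
  by (rule nn_integral_add) simp_all

text \<open>Since \<open>w\<close> is determined by the label at level 0, the price of a cell splits
  into a weight and a factor of the level. The index of \<open>e\<close> is shifted:
  \<open>e (Suc k)\<close> is paid inside a cell of level \<open>k\<close>, so \<open>e k\<close> is
  the price of mass that stays unmatched at level \<open>k\<close> and is matched one level coarser.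
  For \<open>k = 0\<close> this is the price of arbitrary pairs.\<close>

locale multiscale =
  fixes N :: "'a measure" and lab :: "nat \<Rightarrow> 'a \<Rightarrow> 'l::countable"
    and w :: "'l \<Rightarrow> ennreal" and c :: "'a \<times> 'a \<Rightarrow> ennreal" and e :: "nat \<Rightarrow> ennreal"
  assumes lab_measurable[measurable]: "\<And>k. lab k \<in> N \<rightarrow>\<^sub>M count_space UNIV"
    and lab_nested: "\<And>k x y. x \<in> space N \<Longrightarrow> y \<in> space N \<Longrightarrow> lab (Suc k) x = lab (Suc k) y
      \<Longrightarrow> lab k x = lab k y"
    and weight: "\<And>k x. x \<in> space N \<Longrightarrow> w (lab k x) = w (lab 0 x)"
    and cost_measurable[measurable]: "c \<in> borel_measurable (N \<Otimes>\<^sub>M N)"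
    and cost_le: "\<And>x y. x \<in> space N \<Longrightarrow> y \<in> space N
      \<Longrightarrow> c (x, y) \<le> e 0 * (w (lab 0 x) + w (lab 0 y))"
    and cost_cell: "\<And>k x y. x \<in> space N \<Longrightarrow> y \<in> space N \<Longrightarrow> lab k x = lab k y
      \<Longrightarrow> c (x, y) \<le> e (Suc k) * w (lab k x)"
begin

lemma lab_nested_le:
  assumes "k \<le> m" "x \<in> space N" "y \<in> space N" "lab m x = lab m y"
  shows "lab k x = lab k y"
  using assms(1,4) by (induction rule: dec_induct) (auto dest: lab_nested[OF assms(2,3)])

text \<open>The density refers to the product of \<open>A\<close> and \<open>B\<close>. The marginal
  conditions are required almost everywhere only, because nothing is controlled in cells of mass
  zero.\<close>

definition density_coupling_le :: "'a measure \<Rightarrow> 'a measure \<Rightarrow> ennreal \<Rightarrow> bool" where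
  "density_coupling_le A B C \<longleftrightarrow> (\<exists>h\<in>borel_measurable (N \<Otimes>\<^sub>M N).
     (AE x in A. (\<integral>\<^sup>+y. h (x, y) \<partial>B) = 1) \<and> (AE y in B. (\<integral>\<^sup>+x. h (x, y) \<partial>A) = 1) \<and>
     (\<integral>\<^sup>+x. \<integral>\<^sup>+y. c (x, y) * h (x, y) \<partial>B \<partial>A) \<le> C)"

lemma density_coupling_le_mono: "density_coupling_le A B C \<Longrightarrow> C \<le> D \<Longrightarrow> density_coupling_le A B D"
  unfolding density_coupling_le_def by (meson order_trans)

text \<open>The normalised product measure, with density 1 / t for the common total mass t. Each of
  the two weights depends on one coordinate only, so integrating out the other one gives t and
  cancels the normalisation. For total mass 0 every almost-everywhere statement is vacuous.\<close>

lemma density_coupling_product: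
  assumes A: "finite_measure A" "sets A = sets N" and B: "finite_measure B" "sets B = sets N"
    and mass: "emeasure A (space N) = emeasure B (space N)"
  shows "density_coupling_le A B (e 0 * ((\<integral>\<^sup>+x. w (lab 0 x) \<partial>A) + (\<integral>\<^sup>+y. w (lab 0 y) \<partial>B)))"
proof (cases "emeasure A (space N) = 0")
  case True
  have sp: "space A = space N" "space B = space N" by (rule sets_eq_imp_space_eq[OF A(2)], rule sets_eq_imp_space_eq[OF B(2)])
  then have "AE x in A. P x" "AE x in B. P x" for P
    using True mass AE_iff_null_sets[of "space N" A] AE_iff_null_sets[of "space N" B] A B 
    by (auto intro!: AE_I'[of "space N"] simp: null_sets_def)
  then show ?thesis
    unfolding density_coupling_le_def
    by (intro bexI[of _ "\<lambda>_. 0"]) auto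
next
  case False
  note [measurable_cong] = A(2) B(2)
  define t where "t = emeasure A (space N)"
  have sp: "space A = space N" "space B = space N" by (rule sets_eq_imp_space_eq[OF A(2)], rule sets_eq_imp_space_eq[OF B(2)])
  have t: "t \<noteq> 0" "t < \<top>" "emeasure A (space A) = t" "emeasure B (space B) = t"
    using False emeasure_less_top[OF A(1), of "space N"] mass by (auto simp: t_def sp)
  have tt: "t * inverse t = 1" "inverse t * t = 1"
    using t by (metis divide_ennreal_def ennreal_divide_self mult.commute)+
  interpret B: finite_measure B by fact
  have "(\<integral>\<^sup>+x. \<integral>\<^sup>+y. c (x, y) * inverse t \<partial>B \<partial>A)
      \<le> (\<integral>\<^sup>+x. \<integral>\<^sup>+y. e 0 * (w (lab 0 x) + w (lab 0 y)) * inverse t \<partial>B \<partial>A)"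
    by (intro nn_integral_mono mult_right_mono cost_le) (auto simp: sp)
  also have "\<dots> = (\<integral>\<^sup>+x. e 0 * inverse t * (w (lab 0 x) * t + (\<integral>\<^sup>+y. w (lab 0 y) \<partial>B)) \<partial>A)"
  proof (intro nn_integral_cong)
    fix x
    have "(\<integral>\<^sup>+y. e 0 * (w (lab 0 x) + w (lab 0 y)) * inverse t \<partial>B)
        = (\<integral>\<^sup>+y. e 0 * inverse t * (w (lab 0 x) + w (lab 0 y)) \<partial>B)"
      by (simp only: mult_ac)
    also have "\<dots> = e 0 * inverse t * (\<integral>\<^sup>+y. w (lab 0 x) + w (lab 0 y) \<partial>B)"
      by (rule nn_integral_cmult) measurable
    also have "(\<integral>\<^sup>+y. w (lab 0 x) + w (lab 0 y) \<partial>B) = w (lab 0 x) * t + (\<integral>\<^sup>+y. w (lab 0 y) \<partial>B)"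
      by (subst nn_integral_add) (simp_all add: t)
    finally show "(\<integral>\<^sup>+y. e 0 * (w (lab 0 x) + w (lab 0 y)) * inverse t \<partial>B)
      = e 0 * inverse t * (w (lab 0 x) * t + (\<integral>\<^sup>+y. w (lab 0 y) \<partial>B))" .
  qed
  also have "\<dots> = e 0 * inverse t * ((\<integral>\<^sup>+x. w (lab 0 x) \<partial>A) * t + (\<integral>\<^sup>+y. w (lab 0 y) \<partial>B) * t)"
    by (subst nn_integral_cmult, measurable)
       (subst nn_integral_add, simp_all add: nn_integral_multc t)
  also have "\<dots> = e 0 * ((\<integral>\<^sup>+x. w (lab 0 x) \<partial>A) + (\<integral>\<^sup>+y. w (lab 0 y) \<partial>B)) * (inverse t * t)"
    by (simp only: distrib_left distrib_right mult_ac)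
  finally have "(\<integral>\<^sup>+x. \<integral>\<^sup>+y. c (x, y) * inverse t \<partial>B \<partial>A)
      \<le> e 0 * ((\<integral>\<^sup>+x. w (lab 0 x) \<partial>A) + (\<integral>\<^sup>+y. w (lab 0 y) \<partial>B))"
    by (simp only: tt mult_1_right)
  then show ?thesis
    unfolding density_coupling_le_def
    by (intro bexI[of _ "\<lambda>_. inverse t"]) (simp_all add: t tt)
qed

text \<open>The new plan is u v h' + k: the plan \<open>h'\<close> for the leftovers, turned by
  their densities \<open>u\<close> and \<open>v\<close> into a plan relative to \<open>A\<close> and
  \<open>B\<close>, plus the matches \<open>k\<close> inside cells. A point of \<open>A\<close>
  sends the fraction \<open>u\<close> through the first part and the rest through the second. The
  second part costs at most as much as moving all of \<open>A\<close> within its cells.\<close>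

lemma density_coupling_step:
  assumes A: "finite_measure A" "sets A = sets N" and B: "finite_measure B" "sets B = sets N"
    and IH: "density_coupling_le (residual (lab m) A B) (residual (lab m) B A) C"
  shows "density_coupling_le A B (C + e (Suc m) * (\<integral>\<^sup>+x. w (lab m x) \<partial>A))"
proof -
  note [measurable_cong] = A(2) B(2)
  have sp: "space A = space N" "space B = space N" by (rule sets_eq_imp_space_eq[OF A(2)], rule sets_eq_imp_space_eq[OF B(2)])
  define f where "f = lab m"
  have f[measurable]: "f \<in> N \<rightarrow>\<^sub>M count_space UNIV" by (simp add: f_def)
  have fA[measurable]: "f \<in> A \<rightarrow>\<^sub>M count_space UNIV" and fB[measurable]: "f \<in> B \<rightarrow>\<^sub>M count_space UNIV"
    by measurable
  define A' B' where "A' = residual f A B" and "B' = residual f B A"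
  have setsA'[measurable_cong]: "sets A' = sets N" and setsB'[measurable_cong]: "sets B' = sets N"
    by (simp_all add: A'_def B'_def A B)
  interpret A: finite_measure A by fact
  interpret B: finite_measure B by fact
  interpret A': finite_measure A' unfolding A'_def using A(1) B(1) by (intro finite_measure_residual) auto
  interpret B': finite_measure B' unfolding B'_def using A(1) B(1) by (intro finite_measure_residual) auto
  define a b where "a = cell_mass A f" and "b = cell_mass B f"
  have fin: "a l < \<top>" "b l < \<top>" for l
    unfolding a_def b_def using A B by (auto intro: cell_mass_finite)
  define u v where "u = (\<lambda>x. (a (f x) - b (f x)) / a (f x))"
    and "v = (\<lambda>y. (b (f y) - a (f y)) / b (f y))"
  define r where "r = (\<lambda>l. inverse (max (a l) (b l)))"
  have [measurable]: "u \<in> borel_measurable N" "v \<in> borel_measurable N"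
    "(\<lambda>x. r (f x)) \<in> borel_measurable N"
    unfolding u_def v_def by (rule measurable_compose[OF f]; simp)+
  from IH obtain h' where h'[measurable]: "h' \<in> borel_measurable (N \<Otimes>\<^sub>M N)"
    and 1: "AE x in A'. (\<integral>\<^sup>+y. h' (x, y) \<partial>B') = 1" and 2: "AE y in B'. (\<integral>\<^sup>+x. h' (x, y) \<partial>A') = 1"
    and 3: "(\<integral>\<^sup>+x. \<integral>\<^sup>+y. c (x, y) * h' (x, y) \<partial>B' \<partial>A') \<le> C"
    unfolding density_coupling_le_def A'_def B'_def f_def by auto
  \<comment> \<open>Inside a cell with masses \<open>a\<close> and \<open>b\<close>, the product measure scaled by \<open>1 / max a b\<close> matches
    exactly the mass \<open>min a b\<close> and does so in proportion on both sides.\<close>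
  define k where "k = (\<lambda>(x, y). r (f x) * indicator {y \<in> space N. f y = f x} y)"
  have [measurable]: "{z \<in> space (N \<Otimes>\<^sub>M N). f (snd z) = f (fst z)} \<in> sets (N \<Otimes>\<^sub>M N)"
    by measurable
  have "(\<lambda>z. r (f (fst z)) * indicator {z \<in> space (N \<Otimes>\<^sub>M N). f (snd z) = f (fst z)} z)
      \<in> borel_measurable (N \<Otimes>\<^sub>M N)" by measurable
  then have k[measurable]: "k \<in> borel_measurable (N \<Otimes>\<^sub>M N)"
    by (rule measurable_cong[THEN iffD1, rotated])
       (auto simp: k_def space_pair_measure split: split_indicator)
  define h where "h = (\<lambda>z. u (fst z) * (v (snd z) * h' z) + k z)"
  have h[measurable]: "h \<in> borel_measurable (N \<Otimes>\<^sub>M N)" unfolding h_def by measurable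
  have A': "(\<integral>\<^sup>+x. g x \<partial>A') = (\<integral>\<^sup>+x. u x * g x \<partial>A)" if "g \<in> borel_measurable N" for g
    unfolding A'_def u_def a_def b_def using that
    by (subst nn_integral_residual) (simp_all add: measurable_cong_sets[OF A(2) refl])
  have B': "(\<integral>\<^sup>+x. g x \<partial>B') = (\<integral>\<^sup>+x. v x * g x \<partial>B)" if "g \<in> borel_measurable N" for g
    unfolding B'_def v_def a_def b_def using that
    by (subst nn_integral_residual) (simp_all add: measurable_cong_sets[OF B(2) refl])
  have kB: "(\<integral>\<^sup>+y. k (x, y) \<partial>B) = b (f x) * r (f x)" if "x \<in> space N" for x
  proof -
    have "{y \<in> space N. f y = f x} \<in> sets B" by measurable
    then show ?thesis
      by (simp add: k_def nn_integral_cmult_indicator b_def cell_mass_def sp mult.commute)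
  qed
  have kA: "(\<integral>\<^sup>+x. k (x, y) \<partial>A) = a (f y) * r (f y)" if "y \<in> space N" for y
  proof -
    have "{x \<in> space N. f x = f y} \<in> sets A" by measurable
    moreover have "(\<integral>\<^sup>+x. k (x, y) \<partial>A) = (\<integral>\<^sup>+x. r (f y) * indicator {x \<in> space N. f x = f y} x \<partial>A)"
      using that by (intro nn_integral_cong) (auto simp: k_def sp split: split_indicator)
    ultimately show ?thesis
      by (simp add: nn_integral_cmult_indicator a_def cell_mass_def sp mult.commute)
  qed
  have "AE x in A. (\<integral>\<^sup>+y. h (x, y) \<partial>B) = 1"
  proof -
    \<comment> \<open>\<open>h'\<close> is normalised almost everywhere for \<open>A'\<close> only,
      that is, where \<open>u\<close> is positive. Where \<open>u\<close> vanishes it annihilates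
      the integral of \<open>h'\<close>, whatever its value.\<close>
    have "AE x in A. 0 < u x \<longrightarrow> (\<integral>\<^sup>+y. h' (x, y) \<partial>B') = 1"
      using 1 unfolding A'_def residual_def a_def[symmetric] b_def[symmetric] u_def[symmetric]
      by (subst (asm) AE_density) measurable
    moreover have "AE x in A. a (f x) \<noteq> 0"
      unfolding a_def by (rule AE_cell_mass_nonzero) fact
    ultimately show ?thesis using AE_space[of A]
    proof eventually_elim
      case (elim x)
      then have [measurable]: "x \<in> space N" by (simp add: sp)
      have "(\<integral>\<^sup>+y. h (x, y) \<partial>B) = u x * (\<integral>\<^sup>+y. v y * h' (x, y) \<partial>B) + b (f x) * r (f x)"
        unfolding h_def fst_conv snd_conv kB[OF \<open>x \<in> space N\<close>, symmetric]
        by (subst nn_integral_add; (subst nn_integral_cmult)?; measurable)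
      also have "(\<integral>\<^sup>+y. v y * h' (x, y) \<partial>B) = (\<integral>\<^sup>+y. h' (x, y) \<partial>B')"
        by (subst B') measurable
      also have "u x * \<dots> = u x" using elim by (cases "u x = 0") auto
      finally show ?case
        using min_over_max_ennreal[OF elim(2) fin] by (simp add: u_def r_def)
    qed
  qed
  moreover have "AE y in B. (\<integral>\<^sup>+x. h (x, y) \<partial>A) = 1"
  proof -
    have "AE x in B. 0 < v x \<longrightarrow> (\<integral>\<^sup>+y. h' (y, x) \<partial>A') = 1"
      using 2 unfolding B'_def residual_def a_def[symmetric] b_def[symmetric] v_def[symmetric]
      by (subst (asm) AE_density) measurable
    moreover have "AE x in B. b (f x) \<noteq> 0"
      unfolding b_def by (rule AE_cell_mass_nonzero) fact
    ultimately show ?thesis using AE_space[of B]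
    proof eventually_elim
      case (elim y)
      then have [measurable]: "y \<in> space N" by (simp add: sp)
      have "(\<integral>\<^sup>+x. h (x, y) \<partial>A) = (\<integral>\<^sup>+x. v y * (u x * h' (x, y)) + k (x, y) \<partial>A)"
        unfolding h_def by (simp add: mult_ac)
      also have "\<dots> = v y * (\<integral>\<^sup>+x. u x * h' (x, y) \<partial>A) + a (f y) * r (f y)"
        unfolding kA[OF \<open>y \<in> space N\<close>, symmetric]
        by (subst nn_integral_add; (subst nn_integral_cmult)?; measurable)
      also have "(\<integral>\<^sup>+x. u x * h' (x, y) \<partial>A) = (\<integral>\<^sup>+x. h' (x, y) \<partial>A')"
        by (subst A') measurable
      also have "v y * \<dots> = v y" using elim by (cases "v y = 0") auto
      finally show ?case
        using min_over_max_ennreal[OF elim(2) fin(2) fin(1)] by (simp add: v_def r_def max.commute)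
    qed
  qed
  moreover have "(\<integral>\<^sup>+x. \<integral>\<^sup>+y. c (x, y) * h (x, y) \<partial>B \<partial>A) \<le> C + e (Suc m) * (\<integral>\<^sup>+x. w (f x) \<partial>A)"
  proof -
    have "(\<integral>\<^sup>+x. \<integral>\<^sup>+y. c (x, y) * h (x, y) \<partial>B \<partial>A)
       = (\<integral>\<^sup>+x. u x * (\<integral>\<^sup>+y. v y * (c (x, y) * h' (x, y)) \<partial>B) + (\<integral>\<^sup>+y. c (x, y) * k (x, y) \<partial>B) \<partial>A)"
    proof (intro nn_integral_cong)
      fix x assume "x \<in> space A"
      then have [measurable]: "x \<in> space N" by (simp add: sp)
      have "(\<integral>\<^sup>+y. c (x, y) * h (x, y) \<partial>B)
          = (\<integral>\<^sup>+y. u x * (v y * (c (x, y) * h' (x, y))) + c (x, y) * k (x, y) \<partial>B)"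
        unfolding h_def by (simp add: distrib_left mult_ac)
      also have "\<dots> = u x * (\<integral>\<^sup>+y. v y * (c (x, y) * h' (x, y)) \<partial>B) + (\<integral>\<^sup>+y. c (x, y) * k (x, y) \<partial>B)"
        by (subst nn_integral_add; (subst nn_integral_cmult)?; measurable)
      finally show "(\<integral>\<^sup>+y. c (x, y) * h (x, y) \<partial>B) = \<dots>" .
    qed
    also have "\<dots> = (\<integral>\<^sup>+x. u x * (\<integral>\<^sup>+y. v y * (c (x, y) * h' (x, y)) \<partial>B) \<partial>A)
        + (\<integral>\<^sup>+x. \<integral>\<^sup>+y. c (x, y) * k (x, y) \<partial>B \<partial>A)"
      by (rule nn_integral_add) measurable
    also have "(\<integral>\<^sup>+x. u x * (\<integral>\<^sup>+y. v y * (c (x, y) * h' (x, y)) \<partial>B) \<partial>A)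
        = (\<integral>\<^sup>+x. u x * (\<integral>\<^sup>+y. c (x, y) * h' (x, y) \<partial>B') \<partial>A)"
    proof (intro nn_integral_cong)
      fix x assume "x \<in> space A"
      then have [measurable]: "x \<in> space N" by (simp add: sp)
      show "u x * (\<integral>\<^sup>+y. v y * (c (x, y) * h' (x, y)) \<partial>B) = u x * (\<integral>\<^sup>+y. c (x, y) * h' (x, y) \<partial>B')"
        by (subst B') measurable
    qed
    also have "\<dots> = (\<integral>\<^sup>+x. \<integral>\<^sup>+y. c (x, y) * h' (x, y) \<partial>B' \<partial>A')"
      by (subst A') measurable
    also have "\<dots> \<le> C" by (rule 3)
    also have "(\<integral>\<^sup>+x. \<integral>\<^sup>+y. c (x, y) * k (x, y) \<partial>B \<partial>A) \<le> (\<integral>\<^sup>+x. e (Suc m) * w (f x) \<partial>A)"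
    proof (intro nn_integral_mono)
      fix x assume "x \<in> space A"
      then have x[measurable]: "x \<in> space N" by (simp add: sp)
      have "(\<integral>\<^sup>+y. c (x, y) * k (x, y) \<partial>B) \<le> (\<integral>\<^sup>+y. e (Suc m) * w (f x) * k (x, y) \<partial>B)"
      proof (intro nn_integral_mono)
        fix y assume "y \<in> space B"
        then have "y \<in> space N" by (simp add: sp)
        then show "c (x, y) * k (x, y) \<le> e (Suc m) * w (f x) * k (x, y)"
          using cost_cell[OF x \<open>y \<in> space N\<close>, of m]
          by (cases "f x = f y") (auto simp: k_def f_def intro!: mult_right_mono)
      qed
      also have "\<dots> = e (Suc m) * w (f x) * (b (f x) * r (f x))"
        by (subst nn_integral_cmult) (simp_all add: kB[OF x])
      also have "b (f x) * r (f x) \<le> 1"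
        using min_over_max_ennreal[OF _ fin, of "f x" "f x"] fin[of "f x"]
        by (cases "a (f x) = 0"; cases "b (f x) = 0")
           (auto simp: r_def max_def divide_ennreal_def[symmetric] 
             intro: order_trans[OF add_increasing[OF zero_le order_refl] eq_refl])
      finally show "(\<integral>\<^sup>+y. c (x, y) * k (x, y) \<partial>B) \<le> e (Suc m) * w (f x)"
        by (simp add: mult_left_mono)
    qed
    also have "\<dots> = e (Suc m) * (\<integral>\<^sup>+x. w (f x) \<partial>A)"
      by (rule nn_integral_cmult) measurable
    finally show ?thesis by (simp add: add_mono)
  qed
  ultimately show ?thesis
    unfolding density_coupling_le_def f_def using h by blast
qed

text \<open>The induction hypothesis is applied to the leftovers of level \<open>m\<close>. Their
  weighted total mass is the discrepancy of level \<open>m\<close>, which turns the leading term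
  into the next summand, and their discrepancies at coarser levels are those of \<open>A\<close> and
  \<open>B\<close>. The match at level \<open>m\<close> pays \<open>e (Suc m)\<close> times the
  weighted mass of \<open>A\<close>, which becomes part of the new leading term.\<close>

theorem density_coupling:
  assumes A: "finite_measure A" "sets A = sets N" and B: "finite_measure B" "sets B = sets N"
    and mass: "emeasure A (space N) = emeasure B (space N)"
  shows "density_coupling_le A B (e m * ((\<integral>\<^sup>+x. w (lab 0 x) \<partial>A) + (\<integral>\<^sup>+x. w (lab 0 x) \<partial>B))
    + (\<Sum>k<m. e k * discrepancy w (lab k) A B))"
  using assms
proof (induction m arbitrary: A B)
  case 0
  then show ?case using density_coupling_product[of A B] by simp
next
  case (Suc m)
  note A = Suc.prems(1,2) and B = Suc.prems(3,4)
  note [measurable_cong] = A(2) B(2)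
  have sp: "space A = space N" "space B = space N" by (rule sets_eq_imp_space_eq[OF A(2)], rule sets_eq_imp_space_eq[OF B(2)])
  have l: "lab k \<in> A \<rightarrow>\<^sub>M count_space UNIV" "lab k \<in> B \<rightarrow>\<^sub>M count_space UNIV" for k
    by measurable
  let ?A = "residual (lab m) A B" and ?B = "residual (lab m) B A"
  have w: "(\<integral>\<^sup>+x. w (lab 0 x) \<partial>D) = (\<integral>\<^sup>+x. w (lab m x) \<partial>D)" if "space D = space N" for D
    using that by (intro nn_integral_cong) (simp add: weight[of _ m])
  have "density_coupling_le ?A ?B (e m * ((\<integral>\<^sup>+x. w (lab 0 x) \<partial>?A) + (\<integral>\<^sup>+x. w (lab 0 x) \<partial>?B))
    + (\<Sum>k<m. e k * discrepancy w (lab k) ?A ?B))"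
    using emeasure_residual_space[OF l A(1) B(1)] Suc.prems(5)
    by (intro Suc.IH finite_measure_residual l A B) (simp_all add: A B sp)
  also have "(\<integral>\<^sup>+x. w (lab 0 x) \<partial>?A) + (\<integral>\<^sup>+x. w (lab 0 x) \<partial>?B) = discrepancy w (lab m) A B"
    by (subst discrepancy_eq_residual[OF l A(1) B(1)]) (simp add: w sp)
  also have "(\<Sum>k<m. e k * discrepancy w (lab k) ?A ?B) = (\<Sum>k<m. e k * discrepancy w (lab k) A B)"
  proof (rule sum.cong[OF refl])
    fix k assume "k \<in> {..<m}"
    then have "discrepancy w (lab k) ?A ?B = discrepancy w (lab k) A B"
      by (intro discrepancy_residual l A B) (auto simp: sp intro: lab_nested_le[of k m])
    then show "e k * discrepancy w (lab k) ?A ?B = e k * discrepancy w (lab k) A B" by simp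
  qed
  finally have "density_coupling_le A B (e m * discrepancy w (lab m) A B + (\<Sum>k<m. e k * discrepancy w (lab k) A B)
      + e (Suc m) * (\<integral>\<^sup>+x. w (lab m x) \<partial>A))"
    by (rule density_coupling_step[OF A B])
  then show ?case
    by (rule density_coupling_le_mono) (auto simp: w sp distrib_left add_ac intro!: add_left_mono)
qed

end

section \<open>Couplings with a density, and empirical cell masses\<close>

lemma ennreal_powr_mono: "x \<le> y \<Longrightarrow> 0 \<le> a \<Longrightarrow> ennreal_powr x a \<le> ennreal_powr y a"
  by (auto simp: ennreal_powr_def top_unique enn2real_mono less_top intro!: ennreal_leI powr_mono2)

lemma distr_density_fst:
  assumes "sigma_finite_measure B" and [measurable]: "h \<in> borel_measurable (A \<Otimes>\<^sub>M B)"
    and marg: "AE x in A. (\<integral>\<^sup>+y. h (x, y) \<partial>B) = 1"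
  shows "distr (density (A \<Otimes>\<^sub>M B) h) A fst = A"
proof (rule measure_eqI)
  interpret B: sigma_finite_measure B by fact
  fix S assume "S \<in> sets (distr (density (A \<Otimes>\<^sub>M B) h) A fst)"
  then have S[measurable]: "S \<in> sets A" by simp
  have "emeasure (distr (density (A \<Otimes>\<^sub>M B) h) A fst) S
      = (\<integral>\<^sup>+z. h z * indicator (fst -` S \<inter> space (A \<Otimes>\<^sub>M B)) z \<partial>(A \<Otimes>\<^sub>M B))"
    by (subst emeasure_distr) (auto simp: emeasure_density)
  also have "\<dots> = (\<integral>\<^sup>+z. indicator S (fst z) * h z \<partial>(A \<Otimes>\<^sub>M B))"
    by (intro nn_integral_cong) (auto split: split_indicator)
  also have "\<dots> = (\<integral>\<^sup>+x. \<integral>\<^sup>+y. indicator S x * h (x, y) \<partial>B \<partial>A)"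
    by (subst B.nn_integral_fst[symmetric]) auto
  also have "\<dots> = (\<integral>\<^sup>+x. indicator S x * (\<integral>\<^sup>+y. h (x, y) \<partial>B) \<partial>A)"
    by (intro nn_integral_cong nn_integral_cmult) auto
  also have "\<dots> = (\<integral>\<^sup>+x. indicator S x \<partial>A)"
    using marg by (intro nn_integral_cong_AE) (auto elim!: eventually_mono)
  finally show "emeasure (distr (density (A \<Otimes>\<^sub>M B) h) A fst) S = emeasure A S" by simp
qed simp

lemma distr_density_snd:
  assumes "sigma_finite_measure A" "sigma_finite_measure B"
    and [measurable]: "h \<in> borel_measurable (A \<Otimes>\<^sub>M B)"
    and marg: "AE y in B. (\<integral>\<^sup>+x. h (x, y) \<partial>A) = 1"
  shows "distr (density (A \<Otimes>\<^sub>M B) h) B snd = B"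
proof (rule measure_eqI)
  interpret A: sigma_finite_measure A by fact
  interpret B: sigma_finite_measure B by fact
  interpret pair_sigma_finite A B ..
  fix S assume "S \<in> sets (distr (density (A \<Otimes>\<^sub>M B) h) B snd)"
  then have S[measurable]: "S \<in> sets B" by simp
  have "emeasure (distr (density (A \<Otimes>\<^sub>M B) h) B snd) S
      = (\<integral>\<^sup>+z. h z * indicator (snd -` S \<inter> space (A \<Otimes>\<^sub>M B)) z \<partial>(A \<Otimes>\<^sub>M B))"
    by (subst emeasure_distr) (auto simp: emeasure_density)
  also have "\<dots> = (\<integral>\<^sup>+z. indicator S (snd z) * h z \<partial>(A \<Otimes>\<^sub>M B))"
    by (intro nn_integral_cong) (auto split: split_indicator)
  also have "\<dots> = (\<integral>\<^sup>+y. \<integral>\<^sup>+x. indicator S y * h (x, y) \<partial>A \<partial>B)"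
    by (subst nn_integral_snd[symmetric]) auto
  also have "\<dots> = (\<integral>\<^sup>+y. indicator S y * (\<integral>\<^sup>+x. h (x, y) \<partial>A) \<partial>B)"
    by (intro nn_integral_cong nn_integral_cmult) auto
  also have "\<dots> = (\<integral>\<^sup>+y. indicator S y \<partial>B)"
    using marg by (intro nn_integral_cong_AE) (auto elim!: eventually_mono)
  finally show "emeasure (distr (density (A \<Otimes>\<^sub>M B) h) B snd) S = emeasure B S" by simp
qed simp

lemma wasserstein_le_density:
  assumes A: "prob_space A" "sets A = sets (Rd d)" and B: "prob_space B" "sets B = sets (Rd d)"
    and h: "h \<in> borel_measurable (A \<Otimes>\<^sub>M B)" and "0 \<le> p"
    and 1: "AE x in A. (\<integral>\<^sup>+y. h (x, y) \<partial>B) = 1" and 2: "AE y in B. (\<integral>\<^sup>+x. h (x, y) \<partial>A) = 1"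
    and cost: "(\<integral>\<^sup>+x. \<integral>\<^sup>+y. ennreal (enorm d (\<lambda>i. x i - y i) powr p) * h (x, y) \<partial>B \<partial>A) \<le> C"
  shows "wasserstein d p A B \<le> ennreal_powr C (1 / p)"
proof -
  note [measurable_cong] = A(2) B(2)
  note [measurable] = h
  interpret A: prob_space A by fact
  interpret B: prob_space B by fact
  have f: "distr (density (A \<Otimes>\<^sub>M B) h) A fst = A"
    by (rule distr_density_fst[OF B.sigma_finite_measure_axioms h 1])
  have g: "distr (density (A \<Otimes>\<^sub>M B) h) B snd = B"
    by (rule distr_density_snd[OF A.sigma_finite_measure_axioms B.sigma_finite_measure_axioms h 2])
  have "prob_space (density (A \<Otimes>\<^sub>M B) h)"
    using A.prob_space_axioms prob_space_distrD[of fst "density (A \<Otimes>\<^sub>M B) h" A] unfolding f by simp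
  with f g have "density (A \<Otimes>\<^sub>M B) h \<in> couplings A B" by (simp add: couplings_def)
  then have "wasserstein d p A B \<le> ennreal_powr
      (\<integral>\<^sup>+(x, y). ennreal (enorm d (\<lambda>i. x i - y i) powr p) \<partial>density (A \<Otimes>\<^sub>M B) h) (1 / p)"
    unfolding wasserstein_def by (rule INF_lower)
  also have "(\<integral>\<^sup>+(x, y). ennreal (enorm d (\<lambda>i. x i - y i) powr p) \<partial>density (A \<Otimes>\<^sub>M B) h)
     = (\<integral>\<^sup>+z. h z * ennreal (enorm d (\<lambda>i. fst z i - snd z i) powr p) \<partial>(A \<Otimes>\<^sub>M B))"
    unfolding case_prod_unfold L2_set_def by (rule nn_integral_density[OF h]) measurable
  also have "\<dots> = (\<integral>\<^sup>+x. \<integral>\<^sup>+y. h (x, y) * ennreal (enorm d (\<lambda>i. x i - y i) powr p) \<partial>B \<partial>A)"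
    unfolding L2_set_def by (subst B.nn_integral_fst[symmetric]) auto
  also have "\<dots> \<le> C" using cost by (simp only: mult.commute)
  then have "ennreal_powr (\<integral>\<^sup>+x. \<integral>\<^sup>+y. h (x, y) * ennreal (enorm d (\<lambda>i. x i - y i) powr p) \<partial>B \<partial>A) (1 / p)
      \<le> ennreal_powr C (1 / p)"
    using assms(6) by (intro ennreal_powr_mono) auto
  finally show ?thesis .
qed

section \<open>The empirical measure and its deviation on a single set\<close>

lemma prob_space_empirical:
  assumes "0 < n" "\<And>i. i < n \<Longrightarrow> X i \<in> space (Rd d)"
  shows "prob_space (empirical d n X)"
  unfolding empirical_def using assms
  by (intro prob_space.prob_space_distr prob_space_uniform_count_measure) 
     (auto simp: uniform_count_measure_def measurable_point_measure_eq1)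

lemma emeasure_empirical:
  assumes "0 < n" "\<And>i. i < n \<Longrightarrow> X i \<in> space (Rd d)" and S: "S \<in> sets (Rd d)"
  shows "emeasure (empirical d n X) S = ennreal ((\<Sum>i<n. indicator S (X i)) / n)"
proof -
  have "emeasure (empirical d n X) S = emeasure (uniform_count_measure {..<n}) (X -` S \<inter> {..<n})"
    unfolding empirical_def using assms(2)
    by (subst emeasure_distr[OF _ S])
       (auto simp: uniform_count_measure_def space_point_measure measurable_point_measure_eq1)
  also have "\<dots> = ennreal (card (X -` S \<inter> {..<n}) / n)"
    by (subst emeasure_uniform_count_measure) auto
  also have "real (card (X -` S \<inter> {..<n})) = (\<Sum>i<n. indicator S (X i))"
    by (simp add: indicator_def sum.If_cases Int_commute vimage_def Collect_conj_eq)
  finally show ?thesis .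
qed

text \<open>The variance of |Y| is nonnegative.\<close>

lemma (in prob_space) expectation_abs_le_sqrt:
  fixes Y :: "'a \<Rightarrow> real"
  assumes [measurable]: "Y \<in> borel_measurable M" and b: "\<And>x. x \<in> space M \<Longrightarrow> \<bar>Y x\<bar> \<le> B"
  shows "expectation (\<lambda>x. \<bar>Y x\<bar>) \<le> sqrt (expectation (\<lambda>x. (Y x)\<^sup>2))"
proof -
  have i1: "integrable M (\<lambda>x. \<bar>Y x\<bar>)"
    by (rule integrable_const_bound[where B=B]) (auto intro!: AE_I2 b)
  have "\<bar>Y x\<bar>\<^sup>2 \<le> B\<^sup>2" if "x \<in> space M" for x
    using power_mono[OF b[OF that], of 2] by simp
  then have i2: "integrable M (\<lambda>x. \<bar>Y x\<bar>\<^sup>2)"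
    by (intro integrable_const_bound[where B="B\<^sup>2"]) (auto intro!: AE_I2)
  have "0 \<le> variance (\<lambda>x. \<bar>Y x\<bar>)" by (rule variance_positive)
  also have "\<dots> = expectation (\<lambda>x. (Y x)\<^sup>2) - (expectation (\<lambda>x. \<bar>Y x\<bar>))\<^sup>2"
    using variance_eq[OF i1 i2] by simp
  finally show ?thesis by (intro real_le_rsqrt) simp
qed

text \<open>The root bounds the standard deviation: the cross terms of the centred indicators vanish
  by independence and each square has mean at most the mass. The linear bound is the triangle
  inequality; it is the smaller one for masses below 1 / (4 n), hence in far shells and fine
  cells.\<close>

lemma empirical_deviation:
  fixes \<mu> :: "'a measure" and n :: nat
  assumes "prob_space \<mu>" and S[measurable]: "S \<in> sets \<mu>" and n: "0 < n"
  shows "(\<integral>\<^sup>+X. ennreal \<bar>(\<Sum>i<n. indicator S (X i)) / n - measure \<mu> S\<bar> \<partial>PiM {..<n} (\<lambda>_. \<mu>))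
    \<le> ennreal (min (2 * measure \<mu> S) (sqrt (measure \<mu> S / n)))"
proof -
  interpret \<mu>: prob_space \<mu> by fact
  interpret P: product_prob_space "\<lambda>_::nat. \<mu>" "{..<n}" ..
  let ?P = "PiM {..<n} (\<lambda>_. \<mu>)"
  define m where "m = measure \<mu> S"
  have m: "0 \<le> m" "m \<le> 1" by (auto simp: m_def)
  have prod: "(\<integral>X. (\<Prod>i<n. f i (X i)) \<partial>?P) = (\<Prod>i<n. \<integral>x. f i x \<partial>\<mu>)"
    if "\<And>i. i < n \<Longrightarrow> integrable \<mu> (f i)" for f :: "nat \<Rightarrow> 'a \<Rightarrow> real"
    using that by (intro P.product_integral_prod) auto
  define g where "g x = indicator S x - m" for x
  have g[measurable]: "g \<in> borel_measurable \<mu>" unfolding g_def by measurable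
  have gb: "\<bar>g x\<bar> \<le> 1" for x using m by (auto simp: g_def split: split_indicator)
  have gi: "integrable \<mu> g" by (rule \<mu>.integrable_const_bound[where B=1]) (auto simp: gb)
  have g2b: "(g x)\<^sup>2 \<le> 1" for x using gb[of x] by (simp add: abs_square_le_1)
  have g2i: "integrable \<mu> (\<lambda>x. (g x)\<^sup>2)" by (rule \<mu>.integrable_const_bound[where B=1]) (auto simp: g2b)
  have g0: "(\<integral>x. g x \<partial>\<mu>) = 0"
    unfolding g_def by (subst Bochner_Integration.integral_diff) (auto simp: m_def \<mu>.prob_space \<mu>.emeasure_eq_measure)
  have "(g x)\<^sup>2 = indicator S x * (1 - 2 * m) + m\<^sup>2" for x
    by (auto simp: g_def power2_eq_square algebra_simps split: split_indicator)
  then have "(\<integral>x. (g x)\<^sup>2 \<partial>\<mu>) = (\<integral>x. indicator S x * (1 - 2 * m) + m\<^sup>2 \<partial>\<mu>)"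
    by (simp only:)
  also have "\<dots> = m * (1 - 2 * m) + m\<^sup>2"
    by (subst Bochner_Integration.integral_add) (auto simp: m_def \<mu>.prob_space \<mu>.emeasure_eq_measure)
  also have "\<dots> = m - m\<^sup>2" by (simp add: power2_eq_square algebra_simps)
  also have "\<dots> \<le> m" by simp
  finally have g2: "(\<integral>x. (g x)\<^sup>2 \<partial>\<mu>) \<le> m" .
  \<comment> \<open>Marginals and covariances are both read off the product formula by taking the
    factor 1 in the other coordinates.\<close>
  have one: "(\<integral>X. f (X i) \<partial>?P) = (\<integral>x. f x \<partial>\<mu>)" if "i < n" "integrable \<mu> f" for i and f :: "'a \<Rightarrow> real"
  proof -
    have "(\<integral>X. f (X i) \<partial>?P) = (\<integral>X. (\<Prod>k<n. (if k = i then f else (\<lambda>_. 1)) (X k)) \<partial>?P)"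
      using that(1) by (simp add: if_distribR prod.If_cases Int_def cong: if_cong)
    also have "\<dots> = (\<Prod>k<n. \<integral>x. (if k = i then f else (\<lambda>_. 1)) x \<partial>\<mu>)"
      using that(2) by (intro prod) auto
    also have "\<dots> = (\<Prod>k<n. if k = i then \<integral>x. f x \<partial>\<mu> else 1)"
      by (intro prod.cong) (auto simp: \<mu>.prob_space)
    finally show ?thesis using that(1) by simp
  qed
  have two: "(\<integral>X. g (X i) * g (X j) \<partial>?P) = 0" if "i < n" "j < n" "i \<noteq> j" for i j
  proof -
    have "(\<integral>X. g (X i) * g (X j) \<partial>?P) = (\<integral>X. (\<Prod>k<n. (if k = i \<or> k = j then g else (\<lambda>_. 1)) (X k)) \<partial>?P)"
    proof (intro Bochner_Integration.integral_cong refl)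
      fix X
      have "(\<Prod>k<n. (if k = i \<or> k = j then g else (\<lambda>_. 1)) (X k)) = (\<Prod>k\<in>{i, j}. g (X k))"
        using that by (intro prod.mono_neutral_cong_right) auto
      then show "g (X i) * g (X j) = (\<Prod>k<n. (if k = i \<or> k = j then g else (\<lambda>_. 1)) (X k))"
        using that by simp
    qed
    also have "\<dots> = (\<Prod>k<n. \<integral>x. (if k = i \<or> k = j then g else (\<lambda>_. 1)) x \<partial>\<mu>)"
      using gi by (intro prod) auto
    also have "\<dots> = 0" using that g0 by (intro prod_zero) (auto intro!: bexI[of _ i])
    finally show ?thesis .
  qed
  define Y where "Y X = (\<Sum>i<n. indicator S (X i)) / n - m" for X :: "nat \<Rightarrow> 'a"
  have Yg: "Y X = (\<Sum>i<n. g (X i)) / n" for X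
    using n by (simp add: Y_def g_def sum_subtractf field_simps)
  have Ym[measurable]: "Y \<in> borel_measurable ?P" unfolding Y_def by measurable
  have Yb: "\<bar>Y X\<bar> \<le> 1" for X
  proof -
    have "\<bar>\<Sum>i<n. g (X i)\<bar> \<le> (\<Sum>i<n. 1)" by (intro order_trans[OF sum_abs] sum_mono gb)
    then show ?thesis using n by (simp add: Yg abs_divide field_simps)
  qed
  have ggi: "integrable ?P (\<lambda>X. g (X i) * g (X j))" if "i < n" "j < n" for i j
  proof (rule P.integrable_const_bound[where B=1])
    show "(\<lambda>X. g (X i) * g (X j)) \<in> borel_measurable ?P"
      using that by (intro borel_measurable_times measurable_compose[OF _ g] measurable_component_singleton) auto
    show "AE x in ?P. norm (g (x i) * g (x j)) \<le> 1"
      using gb by (auto simp: abs_mult intro!: mult_le_one)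
  qed
  have "(\<integral>X. (Y X)\<^sup>2 \<partial>?P) = (\<integral>X. (\<Sum>i<n. \<Sum>j<n. g (X i) * g (X j)) / n\<^sup>2 \<partial>?P)"
    by (simp add: Yg power_divide power2_eq_square sum_product)
  also have "\<dots> = (\<Sum>i<n. \<Sum>j<n. (\<integral>X. g (X i) * g (X j) \<partial>?P)) / n\<^sup>2"
  proof -
    have "(\<integral>X. (\<Sum>i<n. \<Sum>j<n. g (X i) * g (X j)) \<partial>?P)
        = (\<Sum>i<n. \<integral>X. (\<Sum>j<n. g (X i) * g (X j)) \<partial>?P)"
      using ggi by (intro Bochner_Integration.integral_sum Bochner_Integration.integrable_sum) auto
    also have "\<dots> = (\<Sum>i<n. \<Sum>j<n. (\<integral>X. g (X i) * g (X j) \<partial>?P))"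
      using ggi by (intro sum.cong refl Bochner_Integration.integral_sum) auto
    finally show ?thesis by simp
  qed
  also have "(\<Sum>i<n. \<Sum>j<n. (\<integral>X. g (X i) * g (X j) \<partial>?P)) = (\<Sum>i<n. \<integral>x. (g x)\<^sup>2 \<partial>\<mu>)"
  proof (intro sum.cong refl)
    fix i assume i: "i \<in> {..<n}"
    have "(\<Sum>j<n. (\<integral>X. g (X i) * g (X j) \<partial>?P)) = (\<integral>X. g (X i) * g (X i) \<partial>?P)"
      using i two by (subst sum.remove[of _ i]) auto
    then show "(\<Sum>j<n. (\<integral>X. g (X i) * g (X j) \<partial>?P)) = (\<integral>x. (g x)\<^sup>2 \<partial>\<mu>)"
      using one[OF _ g2i, of i] i by (simp add: power2_eq_square)
  qed
  also have "(\<Sum>i<n. \<integral>x. (g x)\<^sup>2 \<partial>\<mu>) / n\<^sup>2 \<le> m / n"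
    using g2 n by (simp add: power2_eq_square field_simps)
  finally have "(\<integral>X. (Y X)\<^sup>2 \<partial>?P) \<le> m / n" .
  then have a: "(\<integral>X. \<bar>Y X\<bar> \<partial>?P) \<le> sqrt (m / n)"
    using P.expectation_abs_le_sqrt[OF Ym, of 1] Yb by (meson order_trans real_sqrt_le_mono)
  have Yi: "integrable ?P (\<lambda>X. \<bar>Y X\<bar>)"
    by (rule P.integrable_const_bound[where B=1]) (auto simp: Yb)
  have ind: "integrable ?P (\<lambda>X. indicator S (X i) :: real)" if "i < n" for i
    by (rule P.integrable_const_bound[where B=1]) (use that in auto)
  have "(\<integral>X. \<bar>Y X\<bar> \<partial>?P) \<le> (\<integral>X. (\<Sum>i<n. indicator S (X i)) / n + m \<partial>?P)"
  proof (rule integral_mono[OF Yi])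
    show "integrable ?P (\<lambda>X. (\<Sum>i<n. indicator S (X i)) / n + m)"
      by (intro Bochner_Integration.integrable_add integrable_divide Bochner_Integration.integrable_sum ind) auto
    fix X :: "nat \<Rightarrow> 'a"
    have "0 \<le> (\<Sum>i<n. indicator S (X i)) / real n" by (intro divide_nonneg_nonneg sum_nonneg) auto
    then show "\<bar>Y X\<bar> \<le> (\<Sum>i<n. indicator S (X i)) / n + m" using m unfolding Y_def by linarith
  qed
  also have "\<dots> = (\<Sum>i<n. \<integral>X. indicator S (X i) \<partial>?P) / n + m"
  proof -
    have i: "integrable ?P (\<lambda>X. (\<Sum>i<n. indicator S (X i)) / n :: real)"
      by (intro integrable_divide Bochner_Integration.integrable_sum ind) auto
    have "(\<integral>X. (\<Sum>i<n. indicator S (X i)) / n + m \<partial>?P) = (\<integral>X. (\<Sum>i<n. indicator S (X i)) \<partial>?P) / n + m"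
      by (subst Bochner_Integration.integral_add[OF i])
         (auto simp: prob_space.prob_space[OF prob_space_PiM] assms(1))
    also have "(\<integral>X. (\<Sum>i<n. indicator S (X i)) \<partial>?P) = (\<Sum>i<n. \<integral>X. (indicator S (X i) :: real) \<partial>?P)"
      by (intro Bochner_Integration.integral_sum ind) auto
    finally show ?thesis .
  qed
  also have "(\<Sum>i<n. \<integral>X. (indicator S (X i) :: real) \<partial>?P) = (\<Sum>i<n. m)"
    by (intro sum.cong refl) (subst one, auto simp: m_def \<mu>.emeasure_eq_measure)
  finally have "(\<integral>X. \<bar>Y X\<bar> \<partial>?P) \<le> 2 * m" using n by simp
  with a have "(\<integral>X. \<bar>Y X\<bar> \<partial>?P) \<le> min (2 * m) (sqrt (m / n))" by simp
  then have "(\<integral>\<^sup>+X. ennreal \<bar>Y X\<bar> \<partial>?P) \<le> ennreal (min (2 * m) (sqrt (m / n)))"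
    by (subst nn_integral_eq_integral[OF Yi]) (auto intro: ennreal_leI)
  then show ?thesis by (simp add: Y_def m_def)
qed

section \<open>Dyadic shells and cubes\<close>

text \<open>Expanding the power reduces a count in dimension \<open>d\<close> with multiplicative
  weights to a sum over one coordinate.\<close>

lemma sum_prod_list_lists:
  fixes g :: "'b \<Rightarrow> real"
  assumes "finite A"
  shows "(\<Sum>zs | set zs \<subseteq> A \<and> length zs = d. \<Prod>z\<leftarrow>zs. g z) = (\<Sum>z\<in>A. g z) ^ d"
proof (induction d)
  case 0
  have "{zs. set zs \<subseteq> A \<and> length zs = 0} = {[]}" by auto
  then show ?case by (simp del: length_0_conv)
next
  case (Suc d)
  have inj: "inj_on (\<lambda>(xs, n). n # xs) ({zs. set zs \<subseteq> A \<and> length zs = d} \<times> A)"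
    by (auto simp: inj_on_def)
  have "(\<Sum>zs | set zs \<subseteq> A \<and> length zs = Suc d. \<Prod>z\<leftarrow>zs. g z)
      = (\<Sum>(zs, z)\<in>{zs. set zs \<subseteq> A \<and> length zs = d} \<times> A. (\<Prod>z\<leftarrow>zs. g z) * g z)"
    unfolding lists_length_Suc_eq by (subst sum.reindex[OF inj]) (auto intro!: sum.cong)
  also have "\<dots> = (\<Sum>zs | set zs \<subseteq> A \<and> length zs = d. \<Prod>z\<leftarrow>zs. g z) * (\<Sum>z\<in>A. g z)"
    by (simp add: sum_product sum.cartesian_product)
  finally show ?case by (simp add: Suc.IH)
qed

text \<open>Two geometric series in x = exp (- 1 / R), one for each sign with 0 counted twice; 1 /
  (1 - x) is at most 1 + R because exp (1 / R) is at least 1 + 1 / R.\<close>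

lemma sum_exp_abs_le:
  assumes R: "R > (0::real)"
  shows "(\<Sum>z\<in>{-int L..int L}. exp (- \<bar>real_of_int z\<bar> / R)) \<le> 2 * (1 + R)"
proof -
  let ?g = "\<lambda>z::int. exp (- \<bar>real_of_int z\<bar> / R)"
  define x where "x = exp (- 1 / R)"
  have x: "0 < x" "x < 1" using R by (auto simp: x_def)
  have "1 + 1 / R \<le> exp (1 / R)" by (rule exp_ge_add_one_self)
  then have "x \<le> 1 / (1 + 1 / R)"
    using R by (simp add: x_def exp_minus field_simps add_pos_pos)
  then have "1 / (1 + R) \<le> 1 - x" using R by (simp add: field_simps)
  then have geo: "1 / (1 - x) \<le> 1 + R" using R x by (simp add: field_simps)
  have pow: "(\<Sum>m\<le>L. x ^ m) \<le> 1 / (1 - x)"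
  proof -
    have "(\<Sum>m\<le>L. x ^ m) = (1 - x ^ Suc L) / (1 - x)"
      using x by (simp add: sum_gp0)
    also have "\<dots> \<le> 1 / (1 - x)" using x by (intro divide_right_mono) auto
    finally show ?thesis .
  qed
  have gx: "?g (int m) = x ^ m" "?g (- int m) = x ^ m" for m
    by (simp_all add: x_def exp_of_nat_mult[symmetric])
  have "{-int L..int L} \<subseteq> int ` {..L} \<union> (\<lambda>m. - int m) ` {..L}"
  proof
    fix z assume z: "z \<in> {-int L..int L}"
    show "z \<in> int ` {..L} \<union> (\<lambda>m. - int m) ` {..L}"
    proof (cases "0 \<le> z")
      case True
      then have "z = int (nat z)" "nat z \<le> L" using z by auto
      then show ?thesis by blast
    next
      case False
      then have "z = - int (nat (- z))" "nat (- z) \<le> L" using z by auto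
      then show ?thesis by blast
    qed
  qed
  then have "(\<Sum>z\<in>{-int L..int L}. ?g z) \<le> (\<Sum>z\<in>int ` {..L} \<union> (\<lambda>m. - int m) ` {..L}. ?g z)"
    by (intro sum_mono2) auto
  also have "\<dots> \<le> (\<Sum>z\<in>int ` {..L}. ?g z) + (\<Sum>z\<in>(\<lambda>m. - int m) ` {..L}. ?g z)"
    by (subst sum_Un) (auto intro: sum_nonneg)
  also have "\<dots> = (\<Sum>m\<le>L. x ^ m) + (\<Sum>m\<le>L. x ^ m)"
    by (subst (1 2) sum.reindex) (simp_all only: inj_on_def comp_def gx of_nat_eq_iff neg_equal_iff_equal simp_thms ball_triv)
  also have "\<dots> \<le> 2 * (1 + R)"
    using add_mono[OF order_trans[OF pow geo] order_trans[OF pow geo]] by simp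
  finally show ?thesis .
qed

text \<open>Counting with the weights \<open>exp (1 - \<bar>z\<bar> / R)\<close>, whose product over a point of the
  \<open>\<ell>\<^sub>1\<close>-ball of radius \<open>d R\<close> is at least 1, gives a bound of the form \<open>C ^ d\<close>.\<close>

lemma card_int_lists_le:
  fixes R :: real and d :: nat
  assumes R: "R > 0"
  defines "Z \<equiv> {zs :: int list. length zs = d \<and> (\<Sum>z\<leftarrow>zs. \<bar>real_of_int z\<bar>) \<le> d * R}"
  shows "finite Z" "card Z \<le> (6 * (1 + R)) ^ d"
proof -
  \<comment> \<open>The box of side \<open>L\<close> only makes the sums finite; the bound for one
    coordinate does not depend on \<open>L\<close>.\<close>
  define L where "L = nat \<lceil>d * R\<rceil>"
  let ?B = "{zs. set zs \<subseteq> {-int L..int L} \<and> length zs = d}"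
  have sub: "Z \<subseteq> ?B"
  proof
    fix zs assume zs: "zs \<in> Z"
    have "z \<in> {-int L..int L}" if "z \<in> set zs" for z
    proof -
      have "\<bar>real_of_int z\<bar> \<le> (\<Sum>z\<leftarrow>zs. \<bar>real_of_int z\<bar>)"
        using that by (intro member_le_sum_list) auto
      also have "\<dots> \<le> d * R" using zs by (simp add: Z_def)
      finally have "\<bar>z\<bar> \<le> \<lceil>d * R\<rceil>" by linarith
      moreover have "0 \<le> \<lceil>d * R\<rceil>" using R by (simp add: less_le_trans[of "-1" 0])
      ultimately show ?thesis unfolding L_def by (simp add: abs_le_iff)
    qed
    then show "zs \<in> ?B" using zs by (auto simp: Z_def)
  qed
  have finB: "finite ?B" by (rule finite_lists_length_eq) simp
  show "finite Z" using sub finB by (rule finite_subset)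
  let ?g = "\<lambda>z::int. exp (1 - \<bar>real_of_int z\<bar> / R)"
  have prod: "(\<Prod>z\<leftarrow>zs. ?g z) = exp (length zs - (\<Sum>z\<leftarrow>zs. \<bar>real_of_int z\<bar>) / R)" for zs
    by (induction zs) (auto simp: exp_add[symmetric] add_divide_distrib)
  have "real (card Z) = (\<Sum>zs\<in>Z. 1)" by simp
  also have "\<dots> \<le> (\<Sum>zs\<in>Z. \<Prod>z\<leftarrow>zs. ?g z)"
  proof (rule sum_mono)
    fix zs assume "zs \<in> Z"
    then have "(\<Sum>z\<leftarrow>zs. \<bar>real_of_int z\<bar>) / R \<le> length zs"
      using R by (simp add: Z_def pos_divide_le_eq)
    then show "1 \<le> (\<Prod>z\<leftarrow>zs. ?g z)" unfolding prod by simp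
  qed
  also have "\<dots> \<le> (\<Sum>zs\<in>?B. \<Prod>z\<leftarrow>zs. ?g z)"
    using sub finB by (intro sum_mono2) (simp_all only: prod exp_ge_zero)
  also have "\<dots> = (\<Sum>z\<in>{-int L..int L}. ?g z) ^ d"
    by (rule sum_prod_list_lists) simp
  also have "(\<Sum>z\<in>{-int L..int L}. ?g z) = exp 1 * (\<Sum>z\<in>{-int L..int L}. exp (- \<bar>real_of_int z\<bar> / R))"
    by (simp add: sum_distrib_left exp_add[symmetric])
  \<comment> \<open>The factor 6 is 3 for exp 1 times 2 for the two geometric series.\<close>
  also have "\<dots> ^ d \<le> (3 * (2 * (1 + R))) ^ d"
    using sum_exp_abs_le[OF R, of L] exp_le by (intro power_mono mult_mono) (auto intro!: sum_nonneg mult_nonneg_nonneg)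
  finally show "card Z \<le> (6 * (1 + R)) ^ d" by simp
qed

section \<open>Shells, grids and the number of cells\<close>

definition shell :: "real \<Rightarrow> nat \<Rightarrow> (nat \<Rightarrow> real) \<Rightarrow> nat" where
  "shell M d x = (LEAST j. enorm d x \<le> M * 2 ^ j)"

text \<open>In shell \<open>j\<close> the side of a cube is M 2^j / (sqrt d 2^k), which makes its
  diameter M 2^(j - k). The label contains the shell because the scale depends on it, so cubes are
  cut along the boundaries of shells. Shell 0 is the whole ball of radius \<open>M\<close>.\<close>

definition grid :: "real \<Rightarrow> nat \<Rightarrow> nat \<Rightarrow> (nat \<Rightarrow> real) \<Rightarrow> nat \<times> int list" where
  "grid M d k x = (shell M d x,
     map (\<lambda>i. \<lfloor>x i * (sqrt d / (M * 2 ^ shell M d x)) * 2 ^ k\<rfloor>) [0..<d])"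

lemma fst_grid[simp]: "fst (grid M d k x) = shell M d x"
  by (simp add: grid_def)

lemma measurable_enorm[measurable]: "(\<lambda>x. enorm d x) \<in> borel_measurable (Rd d)"
  unfolding L2_set_def by measurable

lemma measurable_shell[measurable]: "shell M d \<in> Rd d \<rightarrow>\<^sub>M count_space UNIV"
  unfolding shell_def[abs_def]
proof (rule measurable_Least)
  fix j
  have "{x \<in> space (Rd d). enorm d x \<le> M * 2 ^ j} \<in> sets (Rd d)"
    by (rule borel_measurable_le[OF measurable_enorm]) (rule borel_measurable_const)
  then show "Measurable.pred (Rd d) (\<lambda>x. enorm d x \<le> M * 2 ^ j)"
    by (simp only: pred_def)
qed

lemma measurable_map_count_space:
  fixes f :: "'b \<Rightarrow> 'a \<Rightarrow> 'c::countable"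
  assumes "\<And>i. i \<in> set xs \<Longrightarrow> f i \<in> N \<rightarrow>\<^sub>M count_space UNIV"
  shows "(\<lambda>x. map (\<lambda>i. f i x) xs) \<in> N \<rightarrow>\<^sub>M count_space UNIV"
  using assms
proof (induction xs)
  case (Cons i xs)
  have tl: "(\<lambda>x. map (\<lambda>i. f i x) xs) \<in> N \<rightarrow>\<^sub>M count_space UNIV"
    and hd: "f i \<in> N \<rightarrow>\<^sub>M count_space UNIV"
    using Cons.prems by (auto intro: Cons.IH)
  have "(\<lambda>x. j # map (\<lambda>i. f i x) xs) \<in> N \<rightarrow>\<^sub>M count_space UNIV" for j
    by (rule measurable_compose[OF tl]) (rule measurable_count_space)
  from measurable_compose_countable[OF this hd] show ?case by (simp only: list.map)
qed (simp only: list.map measurable_const space_count_space UNIV_I)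

lemma measurable_grid[measurable]: "grid M d k \<in> Rd d \<rightarrow>\<^sub>M count_space UNIV"
proof -
  have "(\<lambda>x. map (\<lambda>i. \<lfloor>x i * (sqrt d / (M * 2 ^ j)) * 2 ^ k\<rfloor>) [0..<d]) \<in> Rd d \<rightarrow>\<^sub>M count_space UNIV" for j
  proof (rule measurable_map_count_space)
    fix i assume "i \<in> set [0..<d]"
    then have "(\<lambda>x. x i) \<in> borel_measurable (Rd d)"
      by (intro measurable_component_singleton) auto
    then have "(\<lambda>x. x i * (sqrt d / (M * 2 ^ j)) * 2 ^ k) \<in> borel_measurable (Rd d)"
      by (intro borel_measurable_times borel_measurable_const)
    then show "(\<lambda>x. \<lfloor>x i * (sqrt d / (M * 2 ^ j)) * 2 ^ k\<rfloor>) \<in> Rd d \<rightarrow>\<^sub>M count_space UNIV"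
      by (rule measurable_compose[OF _ measurable_real_floor])
  qed
  then have "(\<lambda>x. (j, map (\<lambda>i. \<lfloor>x i * (sqrt d / (M * 2 ^ j)) * 2 ^ k\<rfloor>) [0..<d])) \<in> Rd d \<rightarrow>\<^sub>M count_space UNIV"
    for j by (rule measurable_compose) (rule measurable_count_space)
  then show ?thesis
    unfolding grid_def[abs_def] by (rule measurable_compose_countable[OF _ measurable_shell])
qed

context
  fixes M :: real and d :: nat
  assumes M: "M > 0" and d: "d \<ge> 1"
begin

lemma enorm_le_shell: "enorm d x \<le> M * 2 ^ shell M d x"
proof -
  obtain j where "enorm d x / M < 2 ^ j"
    using real_arch_pow[of 2 "enorm d x / M"] by auto
  then have "enorm d x \<le> M * 2 ^ j" using M by (simp add: field_simps)
  then show ?thesis unfolding shell_def by (rule LeastI)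
qed

lemma enorm_gt_shell: "shell M d x = Suc j \<Longrightarrow> M * 2 ^ j < enorm d x"
  using not_less_Least[of j "\<lambda>j. enorm d x \<le> M * 2 ^ j"] unfolding shell_def by auto

lemma grid_nested:
  assumes "grid M d (Suc k) x = grid M d (Suc k) y"
  shows "grid M d k x = grid M d k y"
proof -
  have half: "\<lfloor>r * 2 ^ k\<rfloor> = \<lfloor>r * 2 ^ Suc k\<rfloor> div 2" for r :: real
    using floor_divide_real_eq_div[of 2 "r * 2 ^ Suc k"] by simp
  have s: "shell M d x = shell M d y" using assms by (metis fst_grid)
  have "\<lfloor>x i * (sqrt d / (M * 2 ^ shell M d y)) * 2 ^ Suc k\<rfloor> = \<lfloor>y i * (sqrt d / (M * 2 ^ shell M d y)) * 2 ^ Suc k\<rfloor>"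
    if "i < d" for i
    using assms that unfolding grid_def s by auto
  then show ?thesis unfolding grid_def s half by auto
qed

lemma L2_set_le_const: "(\<And>i. i < d \<Longrightarrow> \<bar>f i\<bar> \<le> r) \<Longrightarrow> L2_set f {..<d} \<le> sqrt d * r"
proof -
  assume f: "\<And>i. i < d \<Longrightarrow> \<bar>f i\<bar> \<le> r"
  have r: "0 \<le> r" using f[of 0] d by linarith
  have "(\<Sum>i<d. (f i)\<^sup>2) \<le> (\<Sum>i<d. r\<^sup>2)"
    using f by (intro sum_mono) (metis abs_ge_zero lessThan_iff power2_abs power_mono)
  then have "L2_set f {..<d} \<le> sqrt (d * r\<^sup>2)" by (simp add: L2_set_def)
  then show ?thesis using r by (simp add: real_sqrt_mult)
qed

lemma enorm_diff_le_grid: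
  assumes "grid M d k x = grid M d k y"
  shows "enorm d (\<lambda>i. x i - y i) \<le> M * 2 ^ shell M d x / 2 ^ k"
proof -
  have s: "shell M d y = shell M d x" using assms by (metis fst_grid)
  define a where "a = sqrt d / (M * 2 ^ shell M d x) * 2 ^ k"
  have a: "a > 0" using M d by (simp add: a_def)
  have "\<bar>x i - y i\<bar> \<le> 1 / a" if "i < d" for i
  proof -
    have "\<lfloor>x i * a\<rfloor> = \<lfloor>y i * a\<rfloor>"
      using assms that unfolding grid_def s by (auto simp: a_def mult.assoc)
    then have "\<bar>x i * a - y i * a\<bar> \<le> 1" by linarith
    then have "\<bar>x i - y i\<bar> * a \<le> 1"
      using a by (metis abs_mult abs_of_pos left_diff_distrib)
    then show ?thesis using a by (simp add: field_simps)
  qed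
  then have "enorm d (\<lambda>i. x i - y i) \<le> sqrt d * (1 / a)" by (rule L2_set_le_const)
  also have "\<dots> = M * 2 ^ shell M d x / 2 ^ k" using d M by (simp add: a_def)
  finally show ?thesis .
qed

lemma L1_le_L2: "(\<Sum>i<d. \<bar>x i\<bar>) \<le> sqrt d * L2_set x {..<d}"
  using L2_set_mult_ineq[of "\<lambda>_. 1" x "{..<d}"] by (simp add: L2_set_def)

text \<open>Measured in sides of cubes, the shell lies in the Euclidean ball of radius sqrt d 2^k,
  hence in the l1-ball of radius d 2^k. Rounding down changes each coordinate by at most 1, which
  adds \<open>d\<close> to the l1-norm and at most doubles the radius. With R = 2 * 2^k the factor 6
  (1 + R) is at most 18 * 2^k. The set may depend on \<open>j\<close> and \<open>k\<close>, the
  bound only on \<open>k\<close>.\<close>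

lemma grid_cells:
  "\<exists>Z. finite Z \<and> card Z \<le> (18 * 2 ^ k :: real) ^ d \<and> (\<forall>x zs. grid M d k x = (j, zs) \<longrightarrow> zs \<in> Z)"
proof -
  let ?R = "2 * 2 ^ k :: real"
  define Z where "Z = {zs :: int list. length zs = d \<and> (\<Sum>z\<leftarrow>zs. \<bar>real_of_int z\<bar>) \<le> d * ?R}"
  have R: "?R > 0" by simp
  have "real (card Z) \<le> (6 * (1 + ?R)) ^ d" unfolding Z_def by (rule card_int_lists_le[OF R])
  also have "\<dots> \<le> (18 * 2 ^ k) ^ d"
    using one_le_power[of "2::real" k] by (intro power_mono) auto
  finally have "card Z \<le> (18 * 2 ^ k :: real) ^ d" .
  moreover have "finite Z" unfolding Z_def by (rule card_int_lists_le[OF R])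
  moreover have "zs \<in> Z" if eq: "grid M d k x = (j, zs)" for x zs
  proof -
    define a where "a = sqrt d / (M * 2 ^ j) * 2 ^ k"
    have a: "a > 0" using M d by (simp add: a_def)
    have s: "shell M d x = j" using eq by (metis fst_conv fst_grid)
    have zs: "zs = map (\<lambda>i. \<lfloor>x i * a\<rfloor>) [0..<d]"
      using eq s by (simp add: grid_def a_def mult.assoc)
    have "(\<Sum>z\<leftarrow>zs. \<bar>real_of_int z\<bar>) = (\<Sum>i<d. \<bar>real_of_int \<lfloor>x i * a\<rfloor>\<bar>)"
      by (simp add: zs comp_def interv_sum_list_conv_sum_set_nat atLeast0LessThan)
    also have "\<dots> \<le> (\<Sum>i<d. \<bar>x i\<bar> * a + 1)"
    proof (rule sum_mono)
      fix i
      have "\<bar>real_of_int \<lfloor>x i * a\<rfloor>\<bar> \<le> \<bar>x i * a\<bar> + 1" by linarith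
      then show "\<bar>real_of_int \<lfloor>x i * a\<rfloor>\<bar> \<le> \<bar>x i\<bar> * a + 1" using a by (simp add: abs_mult)
    qed
    also have "\<dots> = (\<Sum>i<d. \<bar>x i\<bar>) * a + d" by (simp add: sum.distrib sum_distrib_right)
    also have "\<dots> \<le> sqrt d * (M * 2 ^ j) * a + d"
      using a enorm_le_shell[of x] L1_le_L2[of x] 
      by (intro add_right_mono mult_right_mono order_trans[OF L1_le_L2] mult_left_mono) (auto simp: s)
    also have "\<dots> = d * 2 ^ k + d" using M by (simp add: a_def field_simps)
    also have "\<dots> \<le> d * ?R" using one_le_power[of "2::real" k] mult_left_mono[of 1 "2^k" "real d"] by (simp add: algebra_simps)
    finally show ?thesis by (simp add: Z_def zs)
  qed
  ultimately show ?thesis by blast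
qed

lemma enorm_diff_le: "enorm d (\<lambda>i. x i - y i) \<le> enorm d x + enorm d y"
  using L2_set_triangle_ineq[of x "\<lambda>i. - y i" "{..<d}"] by (simp add: L2_set_def)

end

section \<open>From cell masses to the expected distance\<close>

text \<open>With the empirical measure for \<open>A\<close> this replaces a random moment by the
  moment of the law and a discrepancy.\<close>

lemma nn_integral_le_discrepancy:
  fixes f :: "'a \<Rightarrow> 'l::countable"
  assumes "f \<in> A \<rightarrow>\<^sub>M count_space UNIV" "f \<in> B \<rightarrow>\<^sub>M count_space UNIV"
  shows "(\<integral>\<^sup>+x. w (f x) \<partial>A) \<le> (\<integral>\<^sup>+x. w (f x) \<partial>B) + discrepancy w f A B"
proof -
  have *: "a \<le> b + (a - b)" for a b :: ennreal
    using ennreal_minus_le_iff[of a b "a - b"] by auto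
  have "cell_mass A f l \<le> cell_mass B f l + ((cell_mass A f l - cell_mass B f l)
      + (cell_mass B f l - cell_mass A f l))" for l
    by (rule order_trans[OF *[of _ "cell_mass B f l"]]) (intro add_left_mono, simp)
  then have "w l * cell_mass A f l \<le> w l * cell_mass B f l
      + w l * ((cell_mass A f l - cell_mass B f l) + (cell_mass B f l - cell_mass A f l))" for l
    by (metis distrib_left mult_left_mono zero_le)
  then show ?thesis
    unfolding discrepancy_def nn_integral_label[OF assms(1)] nn_integral_label[OF assms(2)]
    by (subst nn_integral_add[symmetric]) (auto intro: nn_integral_mono)
qed

lemma sum_min_sqrt_le:
  fixes m :: "'z \<Rightarrow> real"
  assumes "finite Z" "real (card Z) \<le> K" "\<And>z. z \<in> Z \<Longrightarrow> 0 \<le> m z" "(\<Sum>z\<in>Z. m z) \<le> s"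
  shows "(\<Sum>z\<in>Z. min (2 * m z) (sqrt (m z / real n))) \<le> min (2 * s) (sqrt (K * s / real n))"
proof (rule min.boundedI)
  have "(\<Sum>z\<in>Z. min (2 * m z) (sqrt (m z / real n))) \<le> (\<Sum>z\<in>Z. 2 * m z)" by (intro sum_mono) simp
  then show "(\<Sum>z\<in>Z. min (2 * m z) (sqrt (m z / real n))) \<le> 2 * s"
    using assms(4) by (simp flip: sum_distrib_left)
  have "0 \<le> (\<Sum>z\<in>Z. m z)" using assms(3) by (rule sum_nonneg)
  have "(\<Sum>z\<in>Z. min (2 * m z) (sqrt (m z / real n))) \<le> (\<Sum>z\<in>Z. 1 * sqrt (m z / real n))"
    by (intro sum_mono) simp
  also have "\<dots> \<le> sqrt (K * s / real n)"
  proof (rule real_le_rsqrt)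
    have "(\<Sum>z\<in>Z. 1 * sqrt (m z / real n))\<^sup>2 \<le> (\<Sum>z\<in>Z. 1\<^sup>2) * (\<Sum>z\<in>Z. (sqrt (m z / real n))\<^sup>2)"
      by (rule Cauchy_Schwarz_ineq_sum)
    also have "\<dots> = card Z * (\<Sum>z\<in>Z. m z) / n"
      using assms(3) by (simp flip: sum_divide_distrib)
    also have "\<dots> \<le> K * s / n"
      using assms \<open>0 \<le> (\<Sum>z\<in>Z. m z)\<close> by (intro divide_right_mono mult_mono) auto
    finally show "(\<Sum>z\<in>Z. 1 * sqrt (m z / real n))\<^sup>2 \<le> K * s / real n" .
  qed
  finally show "(\<Sum>z\<in>Z. min (2 * m z) (sqrt (m z / real n))) \<le> sqrt (K * s / real n)" .
qed

text \<open>Shell by shell, only the cells in the finite set \<open>Z j\<close> can carry mass, so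
  the expected deviations are summed over at most \<open>K\<close> cells whose masses add up to that
  of the shell. Measurability in the sample is part of the claim because the discrepancies of all
  levels are later added under the integral.\<close>

lemma expected_discrepancy:
  fixes f :: "(nat \<Rightarrow> real) \<Rightarrow> nat \<times> 'z::countable" and n :: nat and K :: real
  assumes \<mu>: "prob_space \<mu>" "sets \<mu> = sets (Rd d)" and n: "0 < n"
    and f: "f \<in> Rd d \<rightarrow>\<^sub>M count_space UNIV"
    and Z: "\<And>j. finite (Z j)" "\<And>j. card (Z j) \<le> K" "\<And>x j z. f x = (j, z) \<Longrightarrow> z \<in> Z j"
  shows "(\<lambda>X. discrepancy (\<lambda>l. w (fst l)) f (empirical d n X) \<mu>)
      \<in> borel_measurable (PiM {..<n} (\<lambda>_. \<mu>))" (is ?meas)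
    and "(\<integral>\<^sup>+X. discrepancy (\<lambda>l. w (fst l)) f (empirical d n X) \<mu> \<partial>PiM {..<n} (\<lambda>_. \<mu>))
    \<le> (\<Sum>j. w j * ennreal (min (2 * measure \<mu> {x \<in> space \<mu>. fst (f x) = j})
        (sqrt (K * measure \<mu> {x \<in> space \<mu>. fst (f x) = j} / n))))" (is ?bound)
proof -
  interpret \<mu>: prob_space \<mu> by fact
  note [measurable_cong] = \<mu>(2)
  let ?P = "PiM {..<n} (\<lambda>_. \<mu>)"
  have sp: "space \<mu> = space (Rd d)" by (rule sets_eq_imp_space_eq[OF \<mu>(2)])
  define S where "S l = {x \<in> space \<mu>. f x = l}" for l
  have "f -` {l} \<inter> space (Rd d) \<in> sets (Rd d)" for l
    by (rule measurable_sets[OF f]) simp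
  also have "f -` {l} \<inter> space (Rd d) = S l" for l by (auto simp: S_def sp)
  finally have SR: "S l \<in> sets (Rd d)" for l .
  then have S[measurable]: "S l \<in> sets \<mu>" for l using \<mu>(2) by simp
  define m where "m l = measure \<mu> (S l)" for l
  define D where "D l X = \<bar>(\<Sum>i<n. indicator (S l) (X i)) / n - m l\<bar>" for l and X :: "nat \<Rightarrow> nat \<Rightarrow> real"
  have [measurable]: "D l \<in> borel_measurable ?P" for l unfolding D_def by measurable
  have eq: "discrepancy (\<lambda>l. w (fst l)) f (empirical d n X) \<mu>
      = (\<integral>\<^sup>+l. w (fst l) * ennreal (D l X) \<partial>count_space UNIV)" if X: "X \<in> space ?P" for X
  proof -
    have Xi: "X i \<in> space (Rd d)" if "i < n" for i
      unfolding sp[symmetric] using X that PiE_mem[of X "{..<n}" "\<lambda>_. space \<mu>" i]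
      by (simp add: space_PiM[of "{..<n}" "\<lambda>_. \<mu>"])
    have "cell_mass (empirical d n X) f l = ennreal ((\<Sum>i<n. indicator (S l) (X i)) / n)" for l
    proof -
      have "cell_mass (empirical d n X) f l = emeasure (empirical d n X) (S l)"
        by (simp add: cell_mass_def S_def sp empirical_def)
      then show ?thesis using emeasure_empirical[OF n Xi SR] by simp
    qed
    moreover have "cell_mass \<mu> f l = ennreal (m l)" for l
      by (simp add: cell_mass_def m_def S_def \<mu>.emeasure_eq_measure)
    moreover have "(ennreal a - ennreal b) + (ennreal b - ennreal a) = ennreal \<bar>a - b\<bar>"
      if "0 \<le> a" "0 \<le> b" for a b
      using that by (simp add: ennreal_minus) (auto simp: ennreal_neg abs_if)
    moreover have "0 \<le> (\<Sum>i<n. indicator (S l) (X i)) / real n" "0 \<le> m l" for l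
      by (auto intro!: divide_nonneg_nonneg sum_nonneg simp: m_def)
    ultimately show ?thesis
      by (simp only: discrepancy_def D_def)
  qed
  interpret C: sigma_finite_measure "count_space (UNIV :: (nat \<times> 'z) set)"
    by (rule sigma_finite_measure_count_space_countable) simp
  \<comment> \<open>Labels form a countable discrete space, so joint measurability follows from
    measurability in the sample for each label.\<close>
  have "(\<lambda>(l, X). w (fst l) * ennreal (D l X)) \<in> borel_measurable (count_space UNIV \<Otimes>\<^sub>M ?P)"
    by (rule measurable_pair_measure_countable1) auto
  then have "(\<lambda>(X, l). w (fst l) * ennreal (D l X)) \<in> borel_measurable (?P \<Otimes>\<^sub>M count_space UNIV)"
    by (subst measurable_pair_swap_iff) (simp add: case_prod_unfold)
  then have "(\<lambda>X. \<integral>\<^sup>+l. w (fst l) * ennreal (D l X) \<partial>count_space UNIV) \<in> borel_measurable ?P"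
    by (rule C.borel_measurable_nn_integral)
  then show ?meas by (subst measurable_cong[OF eq])
  have "(\<integral>\<^sup>+X. discrepancy (\<lambda>l. w (fst l)) f (empirical d n X) \<mu> \<partial>?P)
      = (\<integral>\<^sup>+X. \<integral>\<^sup>+l. w (fst l) * ennreal (D l X) \<partial>count_space UNIV \<partial>?P)"
    by (rule nn_integral_cong) (rule eq)
  also have "\<dots> = (\<integral>\<^sup>+l. \<integral>\<^sup>+X. w (fst l) * ennreal (D l X) \<partial>?P \<partial>count_space UNIV)"
    by (rule nn_integral_count_space_nn_integral) auto
  also have "\<dots> = (\<integral>\<^sup>+l. w (fst l) * (\<integral>\<^sup>+X. ennreal (D l X) \<partial>?P) \<partial>count_space UNIV)"
    by (intro nn_integral_cong nn_integral_cmult) measurable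
  also have "\<dots> \<le> (\<integral>\<^sup>+l. w (fst l) * ennreal (min (2 * m l) (sqrt (m l / n))) \<partial>count_space UNIV)"
    unfolding D_def m_def by (intro nn_integral_mono mult_left_mono empirical_deviation \<mu> n S) simp
  also have "\<dots> = (\<integral>\<^sup>+j. \<integral>\<^sup>+z. w j * ennreal (min (2 * m (j, z)) (sqrt (m (j, z) / n)))
      \<partial>count_space UNIV \<partial>count_space UNIV)"
    by (subst nn_integral_fst_count_space[symmetric]) simp
  also have "\<dots> = (\<Sum>j. \<integral>\<^sup>+z. w j * ennreal (min (2 * m (j, z)) (sqrt (m (j, z) / n))) \<partial>count_space UNIV)"
    by (rule nn_integral_count_space_nat)
  also have "\<dots> \<le> (\<Sum>j. w j * ennreal (min (2 * measure \<mu> {x \<in> space \<mu>. fst (f x) = j})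
        (sqrt (K * measure \<mu> {x \<in> space \<mu>. fst (f x) = j} / n))))"
  proof (intro suminf_le summableI)
    fix j
    let ?s = "measure \<mu> {x \<in> space \<mu>. fst (f x) = j}"
    have m0: "0 \<le> m l" for l by (simp add: m_def)
    have "m (j, z) = 0" if "z \<notin> Z j" for z
    proof -
      have "S (j, z) = {}" using that Z(3) by (auto simp: S_def)
      then show ?thesis by (simp add: m_def)
    qed
    then have "(\<integral>\<^sup>+z. w j * ennreal (min (2 * m (j, z)) (sqrt (m (j, z) / n))) \<partial>count_space UNIV)
        = (\<Sum>z\<in>Z j. w j * ennreal (min (2 * m (j, z)) (sqrt (m (j, z) / n))))"
      using Z(1) by (intro nn_integral_count_space') auto
    also have "\<dots> = w j * ennreal (\<Sum>z\<in>Z j. min (2 * m (j, z)) (sqrt (m (j, z) / n)))"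
      using m0 by (simp add: sum_distrib_left[symmetric])
    also have "\<dots> \<le> w j * ennreal (min (2 * ?s) (sqrt (K * ?s / n)))"
    proof (intro mult_left_mono ennreal_leI sum_min_sqrt_le Z m0)
      have "(\<Sum>z\<in>Z j. m (j, z)) = measure \<mu> (\<Union>z\<in>Z j. S (j, z))"
        unfolding m_def using Z(1) S
        by (intro \<mu>.finite_measure_finite_Union[symmetric]) (force simp: disjoint_family_on_def S_def)+
      also have "(\<Union>z\<in>Z j. S (j, z)) = {x \<in> space \<mu>. fst (f x) = j}"
        using Z(3) by (auto simp: S_def prod_eq_iff)
      finally show "(\<Sum>z\<in>Z j. m (j, z)) \<le> ?s" by simp
    qed auto
    finally show "(\<integral>\<^sup>+z. w j * ennreal (min (2 * m (j, z)) (sqrt (m (j, z) / n))) \<partial>count_space UNIV)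
       \<le> w j * ennreal (min (2 * ?s) (sqrt (K * ?s / n)))" .
  qed
  finally show ?bound .
qed

text \<open>Markov's inequality. Shell \<open>j\<close> only guarantees a norm above M 2^(j - 1);
  the factor \<open>2 powr q\<close> pays for this shift and makes the case \<open>j = 0\<close>
  trivial.\<close>

lemma shell_mass_le:
  assumes \<mu>: "prob_space \<mu>" "sets \<mu> = sets (Rd d)" and "M > 0" "d \<ge> 1" "q > 0"
    and moment: "(\<integral>\<^sup>+x. ennreal (enorm d x powr q) \<partial>\<mu>) \<le> ennreal (M powr q)"
  shows "measure \<mu> {x \<in> space \<mu>. shell M d x = j} \<le> 2 powr q * 2 powr (- q * j)"
proof (cases j)
  case 0
  interpret prob_space \<mu> by fact
  have "measure \<mu> {x \<in> space \<mu>. shell M d x = j} \<le> 1" by simp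
  also have "1 \<le> 2 powr q * 2 powr (- q * real j)" using 0 \<open>q > 0\<close> by (simp add: ge_one_powr_ge_zero)
  finally show ?thesis .
next
  case (Suc i)
  interpret prob_space \<mu> by fact
  note [measurable_cong] = \<mu>(2)
  let ?S = "{x \<in> space \<mu>. shell M d x = j}"
  let ?a = "(M * 2 ^ i) powr q"
  have [measurable]: "shell M d \<in> \<mu> \<rightarrow>\<^sub>M count_space UNIV" by measurable
  have S: "?S \<in> sets \<mu>" by measurable
  have "ennreal ?a * emeasure \<mu> ?S = (\<integral>\<^sup>+x. ennreal ?a * indicator ?S x \<partial>\<mu>)"
    using S by (simp add: nn_integral_cmult_indicator)
  also have "\<dots> \<le> (\<integral>\<^sup>+x. ennreal (enorm d x powr q) \<partial>\<mu>)"
  proof (intro nn_integral_mono)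
    fix x
    show "ennreal ?a * indicator ?S x \<le> ennreal (enorm d x powr q)"
      using enorm_gt_shell[OF assms(3,4), of x i] assms Suc
      by (auto split: split_indicator intro!: ennreal_leI powr_mono2)
  qed
  also have "\<dots> \<le> ennreal (M powr q)" by fact
  finally have "ennreal (?a * measure \<mu> ?S) \<le> ennreal (M powr q)"
    by (simp add: emeasure_eq_measure ennreal_mult)
  then have "?a * measure \<mu> ?S \<le> M powr q" by simp
  then have "M powr q * (2 powr (i * q) * measure \<mu> ?S) \<le> M powr q * 1"
    using \<open>M > 0\<close> by (simp add: powr_mult powr_realpow[symmetric] powr_powr mult_ac)
  then have "2 powr (i * q) * measure \<mu> ?S \<le> 1" using \<open>M > 0\<close> by simp
  then have "measure \<mu> ?S \<le> 2 powr (- (i * q))"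
    by (simp add: powr_minus field_simps)
  also have "- (i * q) = q + - q * j" using Suc by (simp add: algebra_simps)
  finally show ?thesis unfolding powr_add .
qed

text \<open>This plays the part of Jensen's inequality: if the mean of \<open>z\<close> is at most
  \<open>B\<close>, integration bounds the mean of the power by 2 B^s. Being affine in
  \<open>z\<close>, the majorant can be integrated at once, and it covers the value \<top>.\<close>

lemma ennreal_powr_le_tangent:
  assumes "0 < B" "0 \<le> s" "s \<le> 1"
  shows "ennreal_powr z s \<le> ennreal (B powr s) * (1 + z / ennreal B)"
proof (cases z)
  case (real r)
  have "r powr s \<le> B powr s * (1 + r / B)"
  proof (cases "r \<le> B")
    case True
    then have "r powr s \<le> B powr s" using real assms by (intro powr_mono2) auto
    also have "\<dots> \<le> B powr s * (1 + r / B)" using real assms by (simp add: mult_le_cancel_left1)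
    finally show ?thesis .
  next
    case False
    have "r powr s = B powr s * (r / B) powr s" using real assms by (simp add: powr_divide)
    also have "(r / B) powr s \<le> (r / B) powr 1" using False assms by (intro powr_mono) auto
    also have "\<dots> \<le> 1 + r / B" using real assms by simp
    finally show ?thesis using assms by (simp add: mult_left_mono)
  qed
  then have "ennreal (r powr s) \<le> ennreal (B powr s * (1 + r / B))" by (rule ennreal_leI)
  also have "\<dots> = ennreal (B powr s) * (1 + ennreal r / ennreal B)"
    using real assms by (simp add: ennreal_mult divide_ennreal)
  finally show ?thesis using real by (simp add: ennreal_powr_def)
next
  case top
  then show ?thesis using assms by (simp add: ennreal_top_divide ennreal_mult_top)
qed

text \<open>The cost of all cells of level \<open>k\<close> in shell \<open>j\<close>, in units of
  M^p and without the factors that depend on \<open>p\<close> and \<open>q\<close> only.\<close>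

definition level_term :: "real \<Rightarrow> real \<Rightarrow> nat \<Rightarrow> nat \<Rightarrow> nat \<Rightarrow> nat \<Rightarrow> real" where
  "level_term p q d n k j = 2 powr (p * (real j - real k)) *
     min (2 powr (- q * j)) (sqrt ((18 * 2 ^ k) ^ d * 2 powr (- q * j) / n))"

lemma level_term_nonneg: "0 \<le> level_term p q d n k j"
  by (simp add: level_term_def)

context
  fixes d :: nat and p M :: real
  assumes d: "d \<ge> 1" and p: "p \<ge> 1" and M: "M > 0"
begin

definition "shell_weight l = ennreal ((M * 2 ^ fst l) powr p)" for l :: "nat \<times> int list"
definition "cost_fun z = ennreal (enorm d (\<lambda>i. fst z i - snd z i) powr p)"
text \<open>The factor \<open>2 powr p\<close> does two things. At index 0 it allows for points of
  different shells, whose distance is at most twice the larger radius; at \<open>Suc k\<close> it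
  undoes the index shift and leaves 2^(- p k), the p-th power of the relative diameter at level
  \<open>k\<close>.\<close>

definition "level_cost k = ennreal (2 powr p * 2 powr (- p * real k))" for k :: nat

lemma multiscale_grid: "multiscale (Rd d) (grid M d) shell_weight cost_fun level_cost"
proof
  show "grid M d k \<in> Rd d \<rightarrow>\<^sub>M count_space UNIV" for k by (rule measurable_grid)
  show "grid M d k x = grid M d k y" if "grid M d (Suc k) x = grid M d (Suc k) y" for k x y
    using that by (rule grid_nested[OF M d])
  show "shell_weight (grid M d k x) = shell_weight (grid M d 0 x)" for k x
    by (simp add: shell_weight_def)
  show "cost_fun \<in> borel_measurable (Rd d \<Otimes>\<^sub>M Rd d)"
    unfolding cost_fun_def L2_set_def by measurable
  fix x y
  let ?a = "M * 2 ^ shell M d x" and ?b = "M * 2 ^ shell M d y"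
  have ab: "?a > 0" "?b > 0" using M by auto
  have "enorm d (\<lambda>i. x i - y i) \<le> ?a + ?b"
    using enorm_diff_le[OF M d, of x y] enorm_le_shell[OF M d, of x] enorm_le_shell[OF M d, of y] by linarith
  also have "\<dots> \<le> 2 * max ?a ?b" by simp
  finally have "enorm d (\<lambda>i. x i - y i) powr p \<le> (2 * max ?a ?b) powr p"
    using p by (intro powr_mono2) auto
  also have "\<dots> = 2 powr p * max ?a ?b powr p" using ab by (simp add: powr_mult)
  also have "max ?a ?b powr p \<le> ?a powr p + ?b powr p" by (simp add: max_def)
  finally have "enorm d (\<lambda>i. x i - y i) powr p \<le> 2 powr p * (?a powr p + ?b powr p)" by simp
  then show "cost_fun (x, y) \<le> level_cost 0 * (shell_weight (grid M d 0 x) + shell_weight (grid M d 0 y))"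
    by (auto simp: cost_fun_def level_cost_def shell_weight_def ennreal_mult[symmetric]
        ennreal_plus[symmetric] simp del: ennreal_plus intro!: ennreal_leI)
  show "cost_fun (x, y) \<le> level_cost (Suc k) * shell_weight (grid M d k x)"
    if "grid M d k x = grid M d k y" for k
  proof -
    have "enorm d (\<lambda>i. x i - y i) powr p \<le> (?a / 2 ^ k) powr p"
      using enorm_diff_le_grid[OF M d that] p by (intro powr_mono2) auto
    also have "\<dots> = 2 powr (- p * k) * ?a powr p"
      using ab by (simp add: powr_divide powr_realpow[symmetric] powr_powr powr_minus field_simps)
    also have "2 powr (- p * k) = 2 powr p * 2 powr (- p * Suc k)"
      by (simp add: powr_add[symmetric] algebra_simps)
    finally show ?thesis
      by (auto simp: cost_fun_def level_cost_def shell_weight_def ennreal_mult[symmetric] intro!: ennreal_leI)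
  qed
qed

lemma level_cost_mono: "k \<le> m \<Longrightarrow> level_cost m \<le> level_cost k"
proof -
  assume "k \<le> m"
  then have "- p * real m \<le> - p * real k" using p by simp
  then show ?thesis unfolding level_cost_def by (intro ennreal_leI mult_left_mono[OF powr_mono]) auto
qed

lemma wasserstein_empirical_le:
  assumes \<mu>: "prob_space \<mu>" "sets \<mu> = sets (Rd d)" and n: "n > 0" and m: "m \<ge> 1"
    and X: "X \<in> space (PiM {..<n} (\<lambda>_. \<mu>))"
  shows "wasserstein d p (empirical d n X) \<mu> \<le> ennreal_powr
     (2 * (level_cost m * (\<integral>\<^sup>+x. shell_weight (grid M d 0 x) \<partial>\<mu>)
       + (\<Sum>k<m. level_cost k * discrepancy shell_weight (grid M d k) (empirical d n X) \<mu>))) (1 / p)"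
proof -
  interpret multiscale "Rd d" "grid M d" shell_weight cost_fun level_cost by (rule multiscale_grid)
  let ?E = "empirical d n X"
  have sp: "space \<mu> = space (Rd d)" by (rule sets_eq_imp_space_eq[OF \<mu>(2)])
  have Xi: "X i \<in> space (Rd d)" if "i < n" for i
    unfolding sp[symmetric] using X that PiE_mem[of X "{..<n}" "\<lambda>_. space \<mu>" i]
    by (simp add: space_PiM[of "{..<n}" "\<lambda>_. \<mu>"])
  have E: "prob_space ?E" "sets ?E = sets (Rd d)"
    using prob_space_empirical[of n X d] n Xi by (auto simp: empirical_def)
  have spE: "space ?E = space (Rd d)" by (rule sets_eq_imp_space_eq[OF E(2)])
  have fin: "finite_measure ?E" "finite_measure \<mu>"
    using E(1) \<mu>(1) by (auto simp: prob_space_def)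
  have mass: "emeasure ?E (space (Rd d)) = emeasure \<mu> (space (Rd d))"
    using prob_space.emeasure_space_1[OF E(1)] prob_space.emeasure_space_1[OF \<mu>(1)] by (simp add: sp spE)
  let ?T = "\<integral>\<^sup>+x. shell_weight (grid M d 0 x) \<partial>\<mu>" and ?TE = "\<integral>\<^sup>+x. shell_weight (grid M d 0 x) \<partial>?E"
  let ?D = "\<lambda>k. discrepancy shell_weight (grid M d k) ?E \<mu>"
  let ?C = "level_cost m * (?TE + ?T) + (\<Sum>k<m. level_cost k * ?D k)"
  from density_coupling[OF fin(1) E(2) fin(2) \<mu>(2) mass, of m]
  obtain h where h: "h \<in> borel_measurable (Rd d \<Otimes>\<^sub>M Rd d)"
    and 1: "AE x in ?E. (\<integral>\<^sup>+y. h (x, y) \<partial>\<mu>) = 1" and 2: "AE y in \<mu>. (\<integral>\<^sup>+x. h (x, y) \<partial>?E) = 1"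
    and 3: "(\<integral>\<^sup>+x. \<integral>\<^sup>+y. cost_fun (x, y) * h (x, y) \<partial>\<mu> \<partial>?E) \<le> ?C"
    unfolding density_coupling_le_def by blast
  have h': "h \<in> borel_measurable (?E \<Otimes>\<^sub>M \<mu>)"
    using h by (simp add: measurable_cong_sets[OF sets_pair_measure_cong[OF E(2) \<mu>(2)] refl])
  have "wasserstein d p ?E \<mu> \<le> ennreal_powr ?C (1 / p)"
    using wasserstein_le_density[OF E \<mu> h' _ 1 2 3[unfolded cost_fun_def fst_conv snd_conv]] p by simp
  also have "\<dots> \<le> ennreal_powr (2 * (level_cost m * ?T + (\<Sum>k<m. level_cost k * ?D k))) (1 / p)"
  proof (rule ennreal_powr_mono)
    have lab: "grid M d 0 \<in> ?E \<rightarrow>\<^sub>M count_space UNIV" "grid M d 0 \<in> \<mu> \<rightarrow>\<^sub>M count_space UNIV"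
      using measurable_grid by (simp_all add: measurable_cong_sets[OF E(2) refl] measurable_cong_sets[OF \<mu>(2) refl])
    \<comment> \<open>The weighted mass of the sample is traded for that of the law and the
      discrepancy at level 0. As \<open>m\<close> is at least 1, the latter already occurs in the
      sum, so both parts at most double.\<close>
    have "level_cost m * ?TE \<le> level_cost m * (?T + ?D 0)"
      by (intro mult_left_mono nn_integral_le_discrepancy lab) simp
    also have "\<dots> \<le> level_cost m * ?T + level_cost 0 * ?D 0"
      unfolding distrib_left by (intro add_left_mono mult_right_mono level_cost_mono) auto
    also have "level_cost 0 * ?D 0 \<le> (\<Sum>k<m. level_cost k * ?D k)"
      using m by (intro member_le_sum) auto
    finally have "level_cost m * ?TE \<le> level_cost m * ?T + (\<Sum>k<m. level_cost k * ?D k)" by simp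
    then have "?C \<le> (level_cost m * ?T + (\<Sum>k<m. level_cost k * ?D k)) 
        + level_cost m * ?T + (\<Sum>k<m. level_cost k * ?D k)"
      unfolding distrib_left by (intro add_right_mono)
    then show "?C \<le> 2 * (level_cost m * ?T + (\<Sum>k<m. level_cost k * ?D k))"
      by (simp only: mult_2 add.assoc)
  qed (use p in auto)
  finally show ?thesis .
qed

text \<open>The summand without \<open>level_term\<close> accounts for transport inside the finest
  cells: a mass of order 2^(- q j) in shell \<open>j\<close> moves by a distance of order M 2^(j -
  m).\<close>

lemma expected_wasserstein_le:
  assumes \<mu>: "prob_space \<mu>" "sets \<mu> = sets (Rd d)" and n: "n > 0" and m: "m \<ge> 1" and q: "p < q"
    and moment: "(\<integral>\<^sup>+x. ennreal (enorm d x powr q) \<partial>\<mu>) \<le> ennreal (M powr q)"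
    and B: "0 < B" and sum: "(\<Sum>j. ennreal (2 powr (- p * m) * 2 powr ((p - q) * j)
        + (\<Sum>k<m. level_term p q d n k j))) \<le> ennreal B"
  shows "(\<integral>\<^sup>+X. wasserstein d p (empirical d n X) \<mu> \<partial>PiM {..<n} (\<lambda>_. \<mu>))
    \<le> ennreal (2 * (2 powr (p + q + 2) * M powr p * B) powr (1 / p))"
proof -
  interpret \<mu>: prob_space \<mu> by fact
  note [measurable_cong] = \<mu>(2)
  have sp: "space \<mu> = space (Rd d)" by (rule sets_eq_imp_space_eq[OF \<mu>(2)])
  let ?P = "PiM {..<n} (\<lambda>_. \<mu>)"
  interpret P: prob_space ?P by (intro prob_space_PiM \<mu>)
  let ?T = "\<integral>\<^sup>+x. shell_weight (grid M d 0 x) \<partial>\<mu>"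
  let ?D = "\<lambda>k X. discrepancy shell_weight (grid M d k) (empirical d n X) \<mu>"
  define mm where "mm j = measure \<mu> {x \<in> space \<mu>. shell M d x = j}" for j
  have mm: "0 \<le> mm j" "mm j \<le> 2 powr q * 2 powr (- q * j)" for j
    using shell_mass_le[OF \<mu> M d _ moment, of j] p q by (auto simp: mm_def)
  define ww where "ww j = (M * 2 ^ j) powr p" for j :: nat
  have wweq: "ww j = M powr p * 2 powr (p * j)" for j
    using M by (simp add: ww_def powr_mult powr_realpow[symmetric] powr_powr mult.commute)
  have w: "shell_weight = (\<lambda>l. ennreal (ww (fst l)))" by (simp add: shell_weight_def ww_def fun_eq_iff)
  have Dmeas: "?D k \<in> borel_measurable ?P" (is ?g1)
    and Dle: "(\<integral>\<^sup>+X. ?D k X \<partial>?P) \<le> (\<Sum>j. ennreal (ww j) * ennreal (min (2 * mm j)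
        (sqrt ((18 * 2 ^ k) ^ d * mm j / n))))" (is ?g2) for k
  proof -
    obtain Z where Z: "finite (Z j)" "card (Z j) \<le> (18 * 2 ^ k :: real) ^ d"
       "grid M d k x = (j, z) \<Longrightarrow> z \<in> Z j" for j x z
      using grid_cells[OF M d, of k] by metis
    show ?g1 ?g2
      using expected_discrepancy[OF \<mu> n measurable_grid Z(1,2,3), where w = "\<lambda>j. ennreal (ww j)"]
      unfolding w fst_grid mm_def by auto
  qed
  have T: "?T \<le> (\<Sum>j. ennreal (ww j) * ennreal (mm j))"
  proof -
    have "?T = (\<integral>\<^sup>+x. (\<lambda>j. ennreal (ww j)) (shell M d x) \<partial>\<mu>)" by (simp add: w)
    also have "\<dots> = (\<integral>\<^sup>+j. ennreal (ww j) * cell_mass \<mu> (shell M d) j \<partial>count_space UNIV)"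
      by (rule nn_integral_label) measurable
    also have "\<dots> = (\<Sum>j. ennreal (ww j) * ennreal (mm j))"
      by (simp add: nn_integral_count_space_nat cell_mass_def mm_def \<mu>.emeasure_eq_measure)
    finally show ?thesis by simp
  qed
  \<comment> \<open>The distance need not be measurable in the sample and \<open>nn_integral\<close> is then only a lower integral,
    so the distance is dominated by a function of the measurable \<open>G\<close> before integrating.\<close>
  define G where "G X = 2 * (level_cost m * ?T + (\<Sum>k<m. level_cost k * ?D k X))" for X
  define B' where "B' = 2 powr (p + q + 2) * M powr p * B"
  have B': "B' > 0" using B M by (simp add: B'_def)
  have Gm[measurable]: "G \<in> borel_measurable ?P" unfolding G_def using Dmeas by measurable
  have "(\<integral>\<^sup>+X. G X \<partial>?P) = 2 * (level_cost m * ?T + (\<Sum>k<m. level_cost k * (\<integral>\<^sup>+X. ?D k X \<partial>?P)))"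
    unfolding G_def using Dmeas
    by (simp add: nn_integral_cmult nn_integral_add nn_integral_sum P.emeasure_space_1)
  also have "\<dots> \<le> 2 * (level_cost m * (\<Sum>j. ennreal (ww j) * ennreal (mm j))
      + (\<Sum>k<m. level_cost k * (\<Sum>j. ennreal (ww j) * ennreal (min (2 * mm j)
        (sqrt ((18 * 2 ^ k) ^ d * mm j / n))))))"
    by (intro mult_left_mono add_mono sum_mono T Dle) auto
  also have "\<dots> = (\<Sum>j. 2 * (level_cost m * (ennreal (ww j) * ennreal (mm j))
      + (\<Sum>k<m. level_cost k * (ennreal (ww j) * ennreal (min (2 * mm j)
        (sqrt ((18 * 2 ^ k) ^ d * mm j / n)))))))"
    by (simp add: suminf_add[symmetric] suminf_sum summableI)
  also have "\<dots> \<le> (\<Sum>j. ennreal (2 powr (p + q + 2) * M powr p) * ennreal (2 powr (- p * m) * 2 powr ((p - q) * j)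
        + (\<Sum>k<m. level_term p q d n k j)))"
  proof (intro suminf_le summableI)
    fix j
    let ?F = "\<lambda>k. min (2 * mm j) (sqrt ((18 * 2 ^ k) ^ d * mm j / n))"
    have F0: "0 \<le> ?F k" for k using mm by auto
    \<comment> \<open>Under the root the constant of the shell mass is only sqrt (2^q). It is
      enlarged to the factor in front of the linear term so that it can be pulled out of the
      minimum.\<close>
    have Fle: "?F k \<le> 2 * 2 powr q * min (2 powr (- q * j)) (sqrt ((18 * 2 ^ k) ^ d * 2 powr (- q * j) / n))" for k
    proof -
      have "sqrt ((18 * 2 ^ k) ^ d * mm j / n) \<le> sqrt ((18 * 2 ^ k) ^ d * (2 powr q * 2 powr (- q * j)) / n)"
        using mm by (intro real_sqrt_le_mono divide_right_mono mult_left_mono) auto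
      also have "\<dots> = sqrt (2 powr q) * sqrt ((18 * 2 ^ k) ^ d * 2 powr (- q * j) / n)"
        by (simp add: real_sqrt_mult[symmetric] mult_ac)
      also have "sqrt (2 powr q) \<le> 2 * 2 powr q"
      proof -
        have "sqrt (2 powr q) \<le> sqrt ((2 powr q)\<^sup>2)"
          using p q self_le_power[of "2 powr q" 2] ge_one_powr_ge_zero[of 2 q] by (intro real_sqrt_le_mono) auto
        then have "sqrt (2 powr q) \<le> 2 powr q" by simp
        also have "\<dots> \<le> 2 * 2 powr q" using powr_ge_zero[of 2 q] by linarith
        finally show ?thesis .
      qed
      finally have "sqrt ((18 * 2 ^ k) ^ d * mm j / n)
         \<le> 2 * 2 powr q * sqrt ((18 * 2 ^ k) ^ d * 2 powr (- q * j) / n)"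
        by (simp add: mult_right_mono)
      then show ?thesis using mm(2)[of j] by (auto simp: min_mult_distrib_left)
    qed
    have "2 * (level_cost m * (ennreal (ww j) * ennreal (mm j))
        + (\<Sum>k<m. level_cost k * (ennreal (ww j) * ennreal (?F k))))
      = ennreal (2 * (2 powr p * 2 powr (- p * m) * (ww j * mm j)
        + (\<Sum>k<m. 2 powr p * 2 powr (- p * k) * (ww j * ?F k))))"
      using F0 mm by (simp add: level_cost_def ennreal_mult[symmetric] ww_def sum_nonneg
          ennreal_plus[symmetric] numeral_mult_ennreal del: ennreal_plus)
    also have "\<dots> \<le> ennreal (2 powr (p + q + 2) * M powr p * (2 powr (- p * m) * 2 powr ((p - q) * j)
        + (\<Sum>k<m. level_term p q d n k j)))"
    proof (rule ennreal_leI)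
      \<comment> \<open>Of the factor 4, one 2 comes from \<open>G\<close> and one from the linear
        deviation bound; \<open>2 powr p\<close> comes from \<open>level_cost\<close> and
        \<open>2 powr q\<close> from the shell masses.\<close>
      have q2: "2 powr (p + q + 2) = 4 * 2 powr p * (2 powr q :: real)" by (simp add: powr_add)
      have "2 powr p * 2 powr (- p * m) * (ww j * mm j)
          \<le> 2 powr p * 2 powr (- p * m) * (ww j * (2 powr q * 2 powr (- q * j)))"
        using mm by (intro mult_left_mono) (auto simp: ww_def)
      also have "\<dots> = (2 powr p * 2 powr q * M powr p) * (2 powr (- p * m) * (2 powr (p * j) * 2 powr (- q * j)))"
        by (simp add: wweq mult_ac)
      also have "2 powr (p * j) * 2 powr (- q * j) = 2 powr ((p - q) * real j)"
        by (simp add: powr_add[symmetric] algebra_simps)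
      finally have 1: "2 powr p * 2 powr (- p * m) * (ww j * mm j)
          \<le> (2 powr p * 2 powr q * M powr p) * (2 powr (- p * m) * 2 powr ((p - q) * j))" .
      also have "\<dots> \<le> 2 * \<dots>" by simp
      finally have 1: "2 powr p * 2 powr (- p * m) * (ww j * mm j)
          \<le> 2 * ((2 powr p * 2 powr q * M powr p) * (2 powr (- p * m) * 2 powr ((p - q) * j)))" .
      have 2: "2 powr p * 2 powr (- p * k) * (ww j * ?F k)
          \<le> 2 * ((2 powr p * 2 powr q * M powr p) * level_term p q d n k j)" for k
      proof -
        have "2 powr p * 2 powr (- p * k) * (ww j * ?F k) \<le> 2 powr p * 2 powr (- p * k) * (ww j *
            (2 * 2 powr q * min (2 powr (- q * j)) (sqrt ((18 * 2 ^ k) ^ d * 2 powr (- q * j) / n))))"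
          using Fle by (intro mult_left_mono) (auto simp: ww_def)
        also have "\<dots> = 2 * ((2 powr p * 2 powr q * M powr p) * ((2 powr (- p * k) * 2 powr (p * j))
            * min (2 powr (- q * j)) (sqrt ((18 * 2 ^ k) ^ d * 2 powr (- q * j) / n))))"
          by (simp only: wweq mult_ac)
        also have "2 powr (- p * k) * 2 powr (p * j) = 2 powr (p * (real j - real k))"
          by (simp add: powr_add[symmetric] algebra_simps)
        finally show ?thesis unfolding level_term_def .
      qed
      have "2 * (2 powr p * 2 powr (- p * m) * (ww j * mm j)
        + (\<Sum>k<m. 2 powr p * 2 powr (- p * k) * (ww j * ?F k)))
        \<le> 2 * (2 * ((2 powr p * 2 powr q * M powr p) * (2 powr (- p * m) * 2 powr ((p - q) * j)))
        + (\<Sum>k<m. 2 * ((2 powr p * 2 powr q * M powr p) * level_term p q d n k j)))"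
        by (intro mult_left_mono add_mono sum_mono 1 2) simp
      also have "\<dots> = 2 powr (p + q + 2) * M powr p * (2 powr (- p * m) * 2 powr ((p - q) * j)
        + (\<Sum>k<m. level_term p q d n k j))"
        unfolding q2 by (simp only: sum_distrib_left[symmetric]) algebra
      finally show "2 * (2 powr p * 2 powr (- p * m) * (ww j * mm j)
        + (\<Sum>k<m. 2 powr p * 2 powr (- p * k) * (ww j * ?F k))) \<le> \<dots>" .
    qed
    also have "\<dots> = ennreal (2 powr (p + q + 2) * M powr p) * ennreal (2 powr (- p * m) * 2 powr ((p - q) * j)
        + (\<Sum>k<m. level_term p q d n k j))"
      by (rule ennreal_mult') simp
    finally show "2 * (level_cost m * (ennreal (ww j) * ennreal (mm j))
        + (\<Sum>k<m. level_cost k * (ennreal (ww j) * ennreal (?F k)))) \<le> \<dots>" .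
  qed
  also have "\<dots> = ennreal (2 powr (p + q + 2) * M powr p) * (\<Sum>j. ennreal (2 powr (- p * m) * 2 powr ((p - q) * j)
        + (\<Sum>k<m. level_term p q d n k j)))"
    by (rule ennreal_suminf_cmult)
  also have "\<dots> \<le> ennreal (2 powr (p + q + 2) * M powr p) * ennreal B"
    using sum by (intro mult_left_mono) auto
  also have "\<dots> = ennreal B'" using B by (simp add: B'_def ennreal_mult)
  finally have G: "(\<integral>\<^sup>+X. G X \<partial>?P) \<le> ennreal B'" .
  have "(\<integral>\<^sup>+X. wasserstein d p (empirical d n X) \<mu> \<partial>?P) \<le> (\<integral>\<^sup>+X. ennreal_powr (G X) (1 / p) \<partial>?P)"
    unfolding G_def by (intro nn_integral_mono wasserstein_empirical_le \<mu> n m)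
  also have "\<dots> \<le> (\<integral>\<^sup>+X. ennreal (B' powr (1 / p)) * (1 + G X / ennreal B') \<partial>?P)"
    using B' p by (intro nn_integral_mono ennreal_powr_le_tangent) auto
  also have "\<dots> = ennreal (B' powr (1 / p)) * (1 + (\<integral>\<^sup>+X. G X \<partial>?P) / ennreal B')"
    by (simp add: nn_integral_cmult nn_integral_add nn_integral_divide P.emeasure_space_1)
  also have "\<dots> \<le> ennreal (B' powr (1 / p)) * (1 + ennreal B' / ennreal B')"
    by (intro mult_left_mono add_left_mono divide_right_mono_ennreal G) auto
  also have "\<dots> = ennreal (2 * B' powr (1 / p))"
    using B' by (simp add: divide_ennreal ennreal_mult mult.commute)
  finally show ?thesis by (simp only: B'_def)
qed

end

section \<open>The series over levels and shells\<close>

lemma sum_geometric_le: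
  fixes c :: real
  assumes "c > 0"
  shows "(\<Sum>k<N. 2 powr (- c * real k)) \<le> 1 / (1 - 2 powr (- c))"
proof -
  define x where "x = 2 powr (- c)"
  have x: "0 < x" "x < 1" using assms powr_less_mono[of "- c" 0 2] by (auto simp: x_def)
  have "2 powr (- c * real k) = x ^ k" for k
    by (simp add: x_def powr_powr powr_realpow[symmetric])
  then have "(\<Sum>k<N. 2 powr (- c * real k)) = (\<Sum>k<N. x ^ k)" by simp
  also have "\<dots> = (1 - x ^ N) / (1 - x)" using x by (simp add: sum_gp_strict)
  also have "\<dots> \<le> 1 / (1 - x)" using x by (intro divide_right_mono) auto
  finally show ?thesis by (simp add: x_def)
qed

lemma geometric_const_pos: "c > 0 \<Longrightarrow> 0 < 1 / (1 - 2 powr (- c :: real))"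
  using powr_less_mono[of "- c" 0 2] by simp

text \<open>An increasing geometric sum is governed by its last term, here at most 1. Reversing the
  order from the last index \<open>K\<close> gives a bound free of \<open>x\<close> and
  \<open>N\<close>.\<close>

lemma sum_below_le:
  fixes s x :: real
  assumes s: "s > 0" and x: "x > 0"
  shows "(\<Sum>k | k < N \<and> 2 ^ k \<le> x. (2 ^ k / x) powr s) \<le> 1 / (1 - 2 powr (- s))"
proof (cases "{k. k < N \<and> 2 ^ k \<le> x} = {}")
  case True
  then show ?thesis unfolding True using geometric_const_pos[OF s] by simp
next
  case False
  define K where "K = Max {k. k < N \<and> 2 ^ k \<le> x}"
  have fin: "finite {k. k < N \<and> 2 ^ k \<le> x}" by simp
  have "K \<in> {k. k < N \<and> 2 ^ k \<le> x}" unfolding K_def using fin False by (rule Max_in)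
  then have K: "2 ^ K \<le> x" by simp
  have sub: "{k. k < N \<and> 2 ^ k \<le> x} \<subseteq> {..K}" using Max_ge[OF fin] by (auto simp: K_def)
  have "(\<Sum>k | k < N \<and> 2 ^ k \<le> x. (2 ^ k / x) powr s) \<le> (\<Sum>k\<le>K. (2 ^ k / x) powr s)"
    using sub by (intro sum_mono2) auto
  also have "\<dots> \<le> (\<Sum>k\<le>K. 2 powr (- s * real (K - k)))"
  proof (rule sum_mono)
    fix k assume k: "k \<in> {..K}"
    have "2 ^ k / x \<le> 2 ^ k / 2 ^ K" using K x by (intro divide_left_mono) auto
    also have "\<dots> = 2 powr (- real (K - k))"
      using k by (simp add: powr_realpow[symmetric] powr_diff[symmetric] of_nat_diff)
    finally have "(2 ^ k / x) powr s \<le> (2 powr (- real (K - k))) powr s"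
      using s x by (intro powr_mono2) auto
    then show "(2 ^ k / x) powr s \<le> 2 powr (- s * real (K - k))" by (simp add: powr_powr mult.commute)
  qed
  also have "\<dots> = (\<Sum>k<Suc K. 2 powr (- s * real k))"
    unfolding lessThan_Suc_atMost
    by (rule sum.reindex_bij_witness[of _ "\<lambda>k. K - k" "\<lambda>k. K - k"]) auto
  also have "\<dots> \<le> 1 / (1 - 2 powr (- s))" by (rule sum_geometric_le[OF s])
  finally show ?thesis .
qed

lemma sum_above_le:
  fixes c x :: real
  assumes c: "c > 0" and x: "x > 0"
  shows "(\<Sum>k | k < N \<and> x < 2 ^ k. (2 ^ k / x) powr (- c)) \<le> 1 / (1 - 2 powr (- c))"
proof (cases "{k. k < N \<and> x < 2 ^ k} = {}")
  case True
  then show ?thesis unfolding True using geometric_const_pos[OF c] by simp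
next
  case False
  define K where "K = Min {k. k < N \<and> x < 2 ^ k}"
  have fin: "finite {k. k < N \<and> x < 2 ^ k}" by simp
  have "K \<in> {k. k < N \<and> x < 2 ^ k}" unfolding K_def using fin False by (rule Min_in)
  then have K: "x < 2 ^ K" by simp
  \<comment> \<open>The interval is chosen with \<open>N\<close> elements so that shifting by
    \<open>K\<close> maps it onto the range of the geometric sum.\<close>
  have sub: "{k. k < N \<and> x < 2 ^ k} \<subseteq> {K..<K + N}" using Min_le[OF fin] by (force simp: K_def)
  have "(\<Sum>k | k < N \<and> x < 2 ^ k. (2 ^ k / x) powr (- c)) \<le> (\<Sum>k\<in>{K..<K + N}. (2 ^ k / x) powr (- c))"
    using sub by (intro sum_mono2) auto
  also have "\<dots> \<le> (\<Sum>k\<in>{K..<K + N}. 2 powr (- c * real (k - K)))"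
  proof (rule sum_mono)
    fix k assume k: "k \<in> {K..<K + N}"
    have "2 powr real (k - K) = (2 ^ k / 2 ^ K :: real)"
      using k by (simp add: powr_realpow[symmetric] powr_diff[symmetric] of_nat_diff)
    also have "\<dots> \<le> 2 ^ k / x" using K x by (intro divide_left_mono) auto
    finally have "(2 ^ k / x) powr (- c) \<le> (2 powr real (k - K)) powr (- c)"
      using c by (intro powr_mono2') auto
    then show "(2 ^ k / x) powr (- c) \<le> 2 powr (- c * real (k - K))" by (simp add: powr_powr mult.commute)
  qed
  also have "\<dots> = (\<Sum>k<N. 2 powr (- c * real k))"
    by (rule sum.reindex_bij_witness[of _ "\<lambda>k. k + K" "\<lambda>k. k - K"]) auto
  also have "\<dots> \<le> 1 / (1 - 2 powr (- c))" by (rule sum_geometric_le[OF c])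
  finally show ?thesis .
qed

lemma sum_split_le:
  fixes x :: real and f g h :: "nat \<Rightarrow> real"
  assumes "\<And>k. f k \<le> g k" "\<And>k. f k \<le> h k"
  shows "(\<Sum>k<N. f k) \<le> (\<Sum>k | k < N \<and> 2 ^ k \<le> x. g k) + (\<Sum>k | k < N \<and> x < 2 ^ k. h k)"
proof -
  have eq: "{..<N} = {k. k < N \<and> 2 ^ k \<le> x} \<union> {k. k < N \<and> x < 2 ^ k}" by auto
  have "(\<Sum>k<N. f k) = (\<Sum>k | k < N \<and> 2 ^ k \<le> x. f k) + (\<Sum>k | k < N \<and> x < 2 ^ k. f k)"
    by (subst eq, rule sum.union_disjoint) auto
  also have "\<dots> \<le> (\<Sum>k | k < N \<and> 2 ^ k \<le> x. g k) + (\<Sum>k | k < N \<and> x < 2 ^ k. h k)"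
    by (intro add_mono sum_mono assms)
  finally show ?thesis .
qed

text \<open>The terms peak where 2^k is about \<open>x\<close> and decay geometrically on both
  sides, so the sum is comparable to one term.\<close>

lemma sum_two_sided_le:
  fixes s c x :: real
  assumes "s > 0" "c > 0" "x > 0"
  shows "(\<Sum>k<N. min ((2 ^ k / x) powr s) ((2 ^ k / x) powr (- c)))
    \<le> 1 / (1 - 2 powr (- s)) + 1 / (1 - 2 powr (- c))"
  by (rule order_trans[OF sum_split_le[where x=x and g="\<lambda>k. (2 ^ k / x) powr s" and h="\<lambda>k. (2 ^ k / x) powr (- c)"]])
     (auto intro!: add_mono sum_below_le sum_above_le assms)

text \<open>Every logarithm in the rate arises here: the terms stay at 1 until 2^k reaches
  \<open>n\<close>, about log2 n times, and decay afterwards. Applied to the levels and again to the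
  shells it produces the squared logarithm.\<close>

lemma sum_cutoff_le:
  fixes c :: real and n N :: nat
  assumes "c > 0" "n \<ge> 2"
  shows "(\<Sum>k<N. min 1 ((2 ^ k / real n) powr (- c))) \<le> (4 + 2 / (1 - 2 powr (- c))) * ln (real n)"
proof -
  \<comment> \<open>From n \<ge> 2 one gets ln n \<ge> 1/2, which lets additive constants be
    absorbed into multiples of ln n.\<close>
  have ln2: "1 / 2 \<le> ln (2::real)" using ln_le_minus_one[of "1 / 2 :: real"] by (simp add: ln_div)
  have ln: "ln 2 \<le> ln (real n)" using assms by simp
  have sub: "{k. k < N \<and> 2 ^ k \<le> real n} \<subseteq> {..nat \<lfloor>log 2 n\<rfloor>}"
  proof
    fix k assume "k \<in> {k. k < N \<and> 2 ^ k \<le> real n}"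
    then have "2 ^ k \<le> real n" by simp
    then have "real k \<le> log 2 n" using assms by (simp add: le_log_iff powr_realpow)
    then show "k \<in> {..nat \<lfloor>log 2 n\<rfloor>}" by (simp add: le_nat_floor)
  qed
  have "(\<Sum>k | k < N \<and> 2 ^ k \<le> real n. 1) \<le> (\<Sum>k\<le>nat \<lfloor>log 2 n\<rfloor>. 1::real)"
    using sub by (intro sum_mono2) auto
  also have "\<dots> \<le> log 2 n + 1" using assms by simp
  also have "\<dots> = ln n / ln 2 + 1" by (simp add: log_def)
  also have "ln n / ln 2 \<le> ln n / (1 / 2)" using ln ln2 by (intro divide_left_mono) auto
  also have "ln n / (1 / 2) + 1 \<le> 4 * ln n" using ln ln2 by simp
  finally have 1: "(\<Sum>k | k < N \<and> 2 ^ k \<le> real n. 1) \<le> 4 * ln n" by simp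
  have "1 / (1 - 2 powr (- c)) * 1 \<le> 1 / (1 - 2 powr (- c)) * (2 * ln n)"
    using ln ln2 geometric_const_pos[OF assms(1)] by (intro mult_left_mono) auto
  then have "1 / (1 - 2 powr (- c)) \<le> 2 / (1 - 2 powr (- c)) * ln n" by simp
  then have 2: "(\<Sum>k | k < N \<and> real n < 2 ^ k. (2 ^ k / real n) powr (- c)) \<le> 2 / (1 - 2 powr (- c)) * ln n"
    using sum_above_le[OF assms(1), of "real n" N] assms by simp
  have "(\<Sum>k<N. min 1 ((2 ^ k / real n) powr (- c))) \<le> (\<Sum>k | k < N \<and> 2 ^ k \<le> real n. 1)
      + (\<Sum>k | k < N \<and> real n < 2 ^ k. (2 ^ k / real n) powr (- c))"
    by (rule sum_split_le) auto
  also have "\<dots> \<le> 4 * ln n + 2 / (1 - 2 powr (- c)) * ln n" using 1 2 by (rule add_mono)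
  finally show ?thesis by (simp only: distrib_right)
qed

section \<open>The sum over the levels of one shell\<close>

text \<open>With \<open>t\<close> the expected number of sample points in a shell, this bounds the contribution of
  the shell relative to its mass.\<close>

definition shell_sum :: "real \<Rightarrow> nat \<Rightarrow> nat \<Rightarrow> real \<Rightarrow> real" where
  "shell_sum p d N t = (\<Sum>k<N. 2 powr (- p * k) * min 1 (sqrt ((18 * 2 ^ k) ^ d / t)))"

text \<open>Uniform in \<open>t\<close>. This takes over in far shells, where less than one sample
  point is expected.\<close>

lemma shell_sum_le_2:
  assumes "p \<ge> 1"
  shows "shell_sum p d N t \<le> 2"
proof -
  have "shell_sum p d N t \<le> (\<Sum>k<N. 2 powr (- p * k) * 1)"
    unfolding shell_sum_def by (intro sum_mono mult_left_mono) auto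
  also have "\<dots> \<le> (\<Sum>k<N. 2 powr (- 1 * real k))"
  proof (rule sum_mono)
    fix k
    have "1 * real k \<le> p * real k" using assms by (rule mult_right_mono) simp
    then have "- p * real k \<le> - 1 * real k" by linarith
    then have "2 powr (- p * real k) \<le> 2 powr (- 1 * real k)" by (rule powr_mono) simp
    then show "2 powr (- p * real k) * 1 \<le> 2 powr (- 1 * real k)" by (simp only: mult_1_right)
  qed
  also have "\<dots> \<le> 2" using sum_geometric_le[of 1 N] by (simp add: powr_minus)
  finally show ?thesis .
qed

lemma sqrt_ratio_eq:
  assumes "t > 0"
  shows "sqrt ((18 * 2 ^ k) ^ d / t) = (18 * 2 ^ k) powr (d / 2) * t powr (- (1 / 2))"
proof -
  let ?b = "18 * 2 ^ k :: real"
  have "?b > 0" by simp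
  have "sqrt (?b ^ d / t) = (?b ^ d / t) powr (1 / 2)"
    by (rule powr_half_sqrt[symmetric]) (use assms in simp)
  also have "\<dots> = (?b ^ d) powr (1 / 2) / t powr (1 / 2)"
    by (rule powr_divide)
  also have "\<dots> = (?b ^ d) powr (1 / 2) * t powr (- (1 / 2))"
    by (simp only: powr_minus divide_inverse)
  also have "(?b ^ d) powr (1 / 2) = ?b powr (d / 2)"
    unfolding powr_realpow[OF \<open>?b > 0\<close>, symmetric] powr_powr by (simp only: times_divide_eq_right mult_1_right)
  finally show ?thesis .
qed

text \<open>The minimum of 1 and sqrt y is at most y^a for every \<open>a\<close> between 0 and 1/2,
  and d a < p makes the levels a geometric series. For d < 2 p the value 1/2 itself is allowed;
  smaller values avoid the logarithm when d = 2 p.\<close>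

lemma shell_sum_le_interpolate:
  assumes "0 \<le> a" "a \<le> 1 / 2" "d * a < p" "t > 0"
  shows "shell_sum p d N t \<le> (18 powr (d * a) / (1 - 2 powr (- (p - d * a)))) * t powr (- a)"
proof -
  have "shell_sum p d N t \<le> (\<Sum>k<N. 2 powr (- p * k) * (18 powr (d * a) * 2 powr (k * (d * a)) * t powr (- a)))"
    unfolding shell_sum_def
  proof (intro sum_mono mult_left_mono)
    fix k
    define y where "y = (18 * 2 ^ k) ^ d / t"
    have y: "y > 0" using assms by (simp add: y_def)
    have "min 1 (sqrt y) \<le> y powr a"
    proof (cases "y \<le> 1")
      case True
      have "sqrt y = y powr (1 / 2)" using y by (simp add: powr_half_sqrt)
      also have "\<dots> \<le> y powr a" using True y assms by (intro powr_mono') auto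
      finally show ?thesis by simp
    next
      case False
      then have "1 \<le> y powr a" using assms by (intro ge_one_powr_ge_zero) auto
      then show ?thesis by simp
    qed
    also have "y powr a = ((18 * 2 ^ k) powr d) powr a / t powr a"
      using assms by (simp add: y_def powr_divide powr_realpow)
    also have "\<dots> = (18 * 2 ^ k) powr (d * a) * t powr (- a)"
      by (simp add: powr_powr powr_minus divide_inverse)
    also have "(18 * 2 ^ k :: real) powr (d * a) = 18 powr (d * a) * 2 powr (k * (d * a))"
      by (simp add: powr_mult powr_realpow[symmetric] powr_powr)
    finally show "min 1 (sqrt ((18 * 2 ^ k) ^ d / t)) \<le> 18 powr (d * a) * 2 powr (k * (d * a)) * t powr (- a)"
      by (simp add: y_def)
  qed simp
  also have "\<dots> = (\<Sum>k<N. (18 powr (d * a) * t powr (- a)) * 2 powr (- (p - d * a) * real k))"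
  proof (rule sum.cong[OF refl])
    fix k
    have "2 powr (- p * k) * 2 powr (k * (d * a)) = 2 powr (- (p - d * a) * real k)"
      by (simp add: powr_add[symmetric] algebra_simps)
    then show "2 powr (- p * k) * (18 powr (d * a) * 2 powr (k * (d * a)) * t powr (- a))
       = (18 powr (d * a) * t powr (- a)) * 2 powr (- (p - d * a) * real k)"
      by (metis mult.assoc mult.commute)
  qed
  also have "\<dots> = (18 powr (d * a) * t powr (- a)) * (\<Sum>k<N. 2 powr (- (p - d * a) * real k))"
    by (rule sum_distrib_left[symmetric])
  also have "\<dots> \<le> (18 powr (d * a) * t powr (- a)) * (1 / (1 - 2 powr (- (p - d * a))))"
    using assms by (intro mult_left_mono sum_geometric_le) auto
  finally show ?thesis by (simp add: mult_ac)
qed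

text \<open>The terms peak at the level with 2^k about \<open>x\<close>, where (18 x)^d = t: there
  the number of cells matches the number of points. The exponent d / 2 is lowered to p + \<sigma>
  and the count 18^d enters through \<open>x\<close> as 18^p, so the factor in front of the power of
  \<open>t\<close> involves \<open>p\<close> and \<sigma> but not \<open>d\<close>.\<close>

lemma shell_sum_le_high_dim:
  assumes "p \<ge> 1" "\<sigma> > 0" "p + \<sigma> \<le> d / 2" "t > 0"
  shows "shell_sum p d N t \<le> (18 powr p * (1 / (1 - 2 powr (- \<sigma>)) + 1 / (1 - 2 powr (- p)))) * t powr (- (p / d))"
proof -
  have d: "d > 0" using assms by (cases "d = 0") auto
  define x where "x = t powr (1 / d) / 18"
  have x: "x > 0" using assms by (simp add: x_def)
  have "shell_sum p d N t \<le> (\<Sum>k<N. x powr (- p) * min ((2 ^ k / x) powr \<sigma>) ((2 ^ k / x) powr (- p)))"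
    unfolding shell_sum_def
  proof (intro sum_mono)
    fix k
    define y where "y = 2 ^ k / x"
    have y: "y > 0" using x by (simp add: y_def)
    have pk: "2 powr (- p * k) = x powr (- p) * y powr (- p)"
      using x by (simp add: y_def powr_divide powr_realpow[symmetric] powr_powr powr_minus field_simps)
    have "t = (18 * x) ^ d" using assms d by (simp add: x_def powr_realpow[symmetric] powr_powr)
    then have "(18 * 2 ^ k) ^ d / t = y ^ d"
      using x by (simp add: y_def power_divide power_mult_distrib)
    then have "sqrt ((18 * 2 ^ k) ^ d / t) = y powr (d / 2)"
      using y by (simp add: powr_half_sqrt[symmetric] powr_realpow[symmetric] powr_powr)
    moreover have "min 1 (y powr (d / 2)) \<le> min 1 (y powr (p + \<sigma>))"
    proof (cases "y \<le> 1")
      case True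
      then have "y powr (d / 2) \<le> y powr (p + \<sigma>)" using y assms by (intro powr_mono') auto
      then show ?thesis by auto
    next
      case False
      then have "1 \<le> y powr (p + \<sigma>)" using assms by (intro ge_one_powr_ge_zero) auto
      then show ?thesis by auto
    qed
    ultimately have "2 powr (- p * k) * min 1 (sqrt ((18 * 2 ^ k) ^ d / t))
        \<le> x powr (- p) * (y powr (- p) * min 1 (y powr (p + \<sigma>)))"
      unfolding pk by (simp add: mult_left_mono mult.assoc)
    also have "y powr (- p) * min 1 (y powr (p + \<sigma>)) = min (y powr (- p)) (y powr (- p) * y powr (p + \<sigma>))"
      by (simp add: min_mult_distrib_left)
    also have "y powr (- p) * y powr (p + \<sigma>) = y powr \<sigma>" by (simp add: powr_add[symmetric])
    finally show "2 powr (- p * k) * min 1 (sqrt ((18 * 2 ^ k) ^ d / t))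
        \<le> x powr (- p) * min ((2 ^ k / x) powr \<sigma>) ((2 ^ k / x) powr (- p))"
      by (simp add: y_def min.commute)
  qed
  also have "\<dots> = x powr (- p) * (\<Sum>k<N. min ((2 ^ k / x) powr \<sigma>) ((2 ^ k / x) powr (- p)))"
    by (rule sum_distrib_left[symmetric])
  also have "\<dots> \<le> x powr (- p) * (1 / (1 - 2 powr (- \<sigma>)) + 1 / (1 - 2 powr (- p)))"
    using assms x by (intro mult_left_mono sum_two_sided_le) auto
  also have "x powr (- p) = 18 powr p * t powr (- (p / d))"
    using assms by (simp add: x_def powr_divide powr_powr powr_minus field_simps)
  finally show ?thesis by (simp only: mult_ac)
qed

text \<open>Up to the level where the number of cells reaches \<open>t\<close>, the bounds for all
  levels are equal. The cutoff is put at 2^k = n instead, the same for every shell; since t \<le> n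
  and p \<ge> 1/2 the decay of 2^(- p k) suffices beyond it, and only the constant before the
  logarithm suffers.\<close>

lemma shell_sum_le_critical:
  fixes n :: nat
  assumes "p \<ge> 1" "real d = 2 * p" "n \<ge> 2" "0 < t" "t \<le> real n"
  shows "shell_sum p d N t \<le> (18 powr p * (4 + 2 / (1 - 2 powr (- p))) * ln n) * t powr (- (1 / 2))"
proof -
  have "shell_sum p d N t \<le> (\<Sum>k<N. (18 powr p * t powr (- (1 / 2))) * min 1 ((2 ^ k / real n) powr (- p)))"
    unfolding shell_sum_def
  proof (intro sum_mono)
    fix k
    have "2 powr (- p * k) * sqrt ((18 * 2 ^ k) ^ d / t) = 2 powr (- p * k) * ((18 * 2 ^ k) powr p * t powr (- (1 / 2)))"
      unfolding sqrt_ratio_eq[OF assms(4)] assms(2) by simp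
    also have "(18 * 2 ^ k :: real) powr p = 18 powr p * 2 powr (p * k)"
      by (simp add: powr_mult powr_realpow[symmetric] powr_powr mult.commute)
    also have "2 powr (- p * k) * (18 powr p * 2 powr (p * k) * t powr (- (1 / 2)))
        = (2 powr (- p * k) * 2 powr (p * k)) * (18 powr p * t powr (- (1 / 2)))"
      by (simp only: mult_ac)
    also have "2 powr (- p * k) * 2 powr (p * k) = (1::real)" by (simp add: powr_add[symmetric])
    finally have 1: "2 powr (- p * k) * min 1 (sqrt ((18 * 2 ^ k) ^ d / t)) \<le> 18 powr p * t powr (- (1 / 2))"
      by (metis min.cobounded2 mult_left_mono powr_ge_zero mult_1_left)
    have "1 \<le> 18 powr p * (t powr (- (1 / 2)) * n powr p)"
    proof -
      have "real n powr (- (1 / 2)) \<le> t powr (- (1 / 2))" using assms by (intro powr_mono2') auto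
      then have "real n powr (- (1 / 2)) * n powr p \<le> t powr (- (1 / 2)) * n powr p" by (rule mult_right_mono) simp
      moreover have "1 \<le> real n powr (- (1 / 2)) * n powr p"
        using assms by (simp add: powr_add[symmetric] ge_one_powr_ge_zero)
      ultimately have "1 \<le> t powr (- (1 / 2)) * n powr p" by linarith
      moreover have "1 \<le> 18 powr p" using assms by (intro ge_one_powr_ge_zero) auto
      ultimately show ?thesis using mult_mono[of 1 "18 powr p" 1 "t powr (- (1 / 2)) * n powr p"] by simp
    qed
    then have "2 powr (- p * k) * 1 \<le> 2 powr (- p * k) * (18 powr p * (t powr (- (1 / 2)) * n powr p))"
      by (intro mult_left_mono) auto
    also have "\<dots> = 18 powr p * t powr (- (1 / 2)) * (2 ^ k / real n) powr (- p)"
      using assms by (simp add: powr_divide powr_realpow[symmetric] powr_powr powr_minus field_simps)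
    finally have 2: "2 powr (- p * k) * min 1 (sqrt ((18 * 2 ^ k) ^ d / t))
        \<le> 18 powr p * t powr (- (1 / 2)) * (2 ^ k / real n) powr (- p)"
      by (meson min.cobounded1 mult_left_mono order_trans powr_ge_zero)
    show "2 powr (- p * k) * min 1 (sqrt ((18 * 2 ^ k) ^ d / t))
        \<le> 18 powr p * t powr (- (1 / 2)) * min 1 ((2 ^ k / real n) powr (- p))"
      using 1 2 by (auto simp: min_def)
  qed
  also have "\<dots> = (18 powr p * t powr (- (1 / 2))) * (\<Sum>k<N. min 1 ((2 ^ k / real n) powr (- p)))"
    by (rule sum_distrib_left[symmetric])
  also have "\<dots> \<le> (18 powr p * t powr (- (1 / 2))) * ((4 + 2 / (1 - 2 powr (- p))) * ln n)"
    using assms by (intro mult_left_mono sum_cutoff_le) auto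
  finally show ?thesis by (simp only: mult_ac)
qed

lemma sum_level_term:
  fixes n :: nat
  assumes "n \<ge> 1"
  shows "(\<Sum>k<N. level_term p q d n k j)
    = 2 powr ((p - q) * j) * shell_sum p d N (n * 2 powr (- q * j))"
proof -
  define s where "s = 2 powr (- q * real j)"
  have s: "s > 0" by (simp add: s_def)
  have "level_term p q d n k j
      = 2 powr ((p - q) * j) * (2 powr (- p * k) * min 1 (sqrt ((18 * 2 ^ k) ^ d / (n * s))))" for k
  proof -
    define A where "A = (18 * 2 ^ k :: real) ^ d"
    have "A * s / n = s\<^sup>2 * (A / (n * s))" using s assms by (simp add: power2_eq_square)
    then have "sqrt (A * s / n) = s * sqrt (A / (n * s))"
      using s by (simp only: real_sqrt_mult real_sqrt_abs abs_of_pos)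
    then have "min s (sqrt (A * s / n)) = s * min 1 (sqrt (A / (n * s)))"
      using s by (simp add: min_mult_distrib_left)
    then have "level_term p q d n k j = 2 powr (p * (real j - real k)) * (s * min 1 (sqrt (A / (n * s))))"
      by (simp only: level_term_def s_def A_def)
    also have "2 powr (p * (real j - real k)) = 2 powr ((p - q) * j) * 2 powr (q * j) * 2 powr (- p * k)"
      unfolding powr_add[symmetric] by (rule arg_cong[where f="(powr) 2"]) algebra
    also have "\<dots> * (s * min 1 (sqrt (A / (n * s))))
        = 2 powr ((p - q) * j) * (2 powr (- p * k) * min 1 (sqrt (A / (n * s)))) * (2 powr (q * j) * s)"
      by (simp only: mult_ac)
    also have "2 powr (q * j) * s = 1" unfolding s_def powr_add[symmetric] by simp
    finally show ?thesis by (simp only: A_def mult_1_right)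
  qed
  then show ?thesis unfolding shell_sum_def s_def sum_distrib_left by simp
qed

section \<open>The sum over the shells\<close>

lemma shell_weighted_powr:
  fixes n :: nat
  assumes "n \<ge> 1"
  shows "2 powr ((p - q) * j) * (n * 2 powr (- q * j)) powr (- a) = n powr (- a) * 2 powr ((p - q + q * a) * real j)"
proof -
  have "(n * 2 powr (- q * j)) powr (- a) = n powr (- a) * 2 powr (q * a * j)"
    by (simp add: powr_mult powr_powr mult_ac)
  then show ?thesis by (simp add: powr_add[symmetric] algebra_simps)
qed

text \<open>The innermost shell dominates. Only a lower bound \<open>b\<close> for the gap is used,
  so that one constant can serve many dimensions.\<close>

lemma shells_subcritical:
  fixes n :: nat and I :: "nat \<Rightarrow> real"
  assumes n: "n \<ge> 1" and K: "K \<ge> 0" and I: "\<And>j. I j \<le> K * (n * 2 powr (- q * j)) powr (- a)"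
    and b: "p - q + q * a \<le> - b" "b > 0"
  shows "(\<Sum>j<J. 2 powr ((p - q) * j) * I j) \<le> K * (1 / (1 - 2 powr (- b))) * n powr (- a)"
proof -
  have "(\<Sum>j<J. 2 powr ((p - q) * j) * I j) \<le> (\<Sum>j<J. (K * n powr (- a)) * 2 powr (- b * real j))"
  proof (rule sum_mono)
    fix j
    have "2 powr ((p - q) * j) * I j \<le> 2 powr ((p - q) * j) * (K * (n * 2 powr (- q * j)) powr (- a))"
      using I by (rule mult_left_mono) simp
    also have "\<dots> = K * (2 powr ((p - q) * j) * (n * 2 powr (- q * j)) powr (- a))" by (simp only: mult_ac)
    also have "\<dots> = (K * n powr (- a)) * 2 powr ((p - q + q * a) * real j)"
      unfolding shell_weighted_powr[OF n] by (simp only: mult_ac)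
    also have "\<dots> \<le> (K * n powr (- a)) * 2 powr (- b * real j)"
      using b K by (intro mult_left_mono powr_mono mult_right_mono) auto
    finally show "2 powr ((p - q) * j) * I j \<le> \<dots>" .
  qed
  also have "\<dots> = (K * n powr (- a)) * (\<Sum>j<J. 2 powr (- b * real j))"
    by (rule sum_distrib_left[symmetric])
  also have "\<dots> \<le> (K * n powr (- a)) * (1 / (1 - 2 powr (- b)))"
    using K b by (intro mult_left_mono sum_geometric_le) auto
  finally show ?thesis by (simp only: mult_ac)
qed

text \<open>All shells may contribute equally until the bound 2 for \<open>I\<close> takes over. The
  cutoff at 2^j = n is later than the natural one at n^(1 / q), which changes the logarithm by a
  constant factor only. The constant \<open>K\<close> may itself contain a logarithm.\<close>

lemma shells_critical:
  fixes n :: nat and I :: "nat \<Rightarrow> real"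
  assumes n: "n \<ge> 2" and K: "K \<ge> 0" and I: "\<And>j. I j \<le> K * (n * 2 powr (- q * j)) powr (- a)" "\<And>j. I j \<le> 2"
    and pq: "1 \<le> p" "p < q" and a: "p - q + q * a = 0"
  shows "(\<Sum>j<J. 2 powr ((p - q) * j) * I j)
    \<le> (K + 2) * (4 + 2 / (1 - 2 powr (- (q - p)))) * ln n * n powr (- a)"
proof -
  have a0: "0 \<le> a" using a pq mult_nonneg_nonpos[of q a] by (cases "0 \<le> a") auto
  have "(\<Sum>j<J. 2 powr ((p - q) * j) * I j)
      \<le> (\<Sum>j<J. ((K + 2) * n powr (- a)) * min 1 ((2 ^ j / real n) powr (- (q - p))))"
  proof (rule sum_mono)
    fix j
    have "2 powr ((p - q) * j) * I j \<le> 2 powr ((p - q) * j) * (K * (n * 2 powr (- q * j)) powr (- a))"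
      using I(1) by (rule mult_left_mono) simp
    also have "\<dots> = K * (2 powr ((p - q) * j) * (n * 2 powr (- q * j)) powr (- a))" by (simp only: mult_ac)
    also have "\<dots> = K * n powr (- a)"
      using n by (subst shell_weighted_powr) (simp_all add: a)
    also have "\<dots> \<le> (K + 2) * n powr (- a)" by (intro mult_right_mono) auto
    finally have 1: "2 powr ((p - q) * j) * I j \<le> (K + 2) * n powr (- a)" .
    have "2 powr ((p - q) * j) * I j \<le> 2 powr ((p - q) * j) * 2"
      using I(2) by (rule mult_left_mono) simp
    also have "2 powr ((p - q) * j) * 2 = n powr (p - q) * (2 ^ j / real n) powr (- (q - p)) * 2"
      using n by (simp add: powr_divide powr_realpow[symmetric] powr_powr mult.commute)
    also have "\<dots> \<le> n powr (- a) * (2 ^ j / real n) powr (- (q - p)) * (K + 2)"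
    proof (intro mult_mono mult_right_mono)
      \<comment> \<open>Criticality means q - p = q a, so this compares the two powers of
        \<open>n\<close>.\<close>
      have "a \<le> q * a" using a0 pq by (simp add: mult_le_cancel_right1)
      then show "n powr (p - q) \<le> n powr (- a)" using n a by (intro powr_mono) auto
    qed (use K in auto)
    finally have 2: "2 powr ((p - q) * j) * I j \<le> ((K + 2) * n powr (- a)) * (2 ^ j / real n) powr (- (q - p))"
      by (simp only: mult_ac)
    show "2 powr ((p - q) * j) * I j \<le> ((K + 2) * n powr (- a)) * min 1 ((2 ^ j / real n) powr (- (q - p)))"
      using 1 2 by (auto simp: min_def)
  qed
  also have "\<dots> = ((K + 2) * n powr (- a)) * (\<Sum>j<J. min 1 ((2 ^ j / real n) powr (- (q - p))))"
    by (rule sum_distrib_left[symmetric])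
  also have "\<dots> \<le> ((K + 2) * n powr (- a)) * ((4 + 2 / (1 - 2 powr (- (q - p)))) * ln n)"
    using n K pq by (intro mult_left_mono sum_cutoff_le) auto
  finally show ?thesis by (simp only: mult_ac)
qed

text \<open>The dominant shell is the one of relative radius x = n^(1 / q), where about one sample
  point is expected. Its contribution x^(p - q) does not depend on \<open>a\<close>, so any
  \<open>a\<close> with p - q (1 - a) > 0 yields the same rate.\<close>

lemma shells_supercritical:
  fixes n :: nat and I :: "nat \<Rightarrow> real"
  assumes n: "n \<ge> 1" and K: "K \<ge> 0" and I: "\<And>j. I j \<le> K * (n * 2 powr (- q * j)) powr (- a)" "\<And>j. I j \<le> 2"
    and pq: "1 \<le> p" "p < q" and b: "p - q + q * a = b" "b > 0"
  shows "(\<Sum>j<J. 2 powr ((p - q) * j) * I j)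
    \<le> (K + 2) * (1 / (1 - 2 powr (- b)) + 1 / (1 - 2 powr (- (q - p)))) * n powr (- (1 - p / q))"
proof -
  define x where "x = n powr (1 / q)"
  have x: "x > 0" using n by (simp add: x_def)
  have q: "q > 0" using pq by simp
  have xpq: "x powr (p - q) = n powr (- (1 - p / q))"
    using q by (simp add: x_def powr_powr diff_divide_distrib)
  have "(\<Sum>j<J. 2 powr ((p - q) * j) * I j)
      \<le> (\<Sum>j<J. ((K + 2) * x powr (p - q)) * min ((2 ^ j / x) powr b) ((2 ^ j / x) powr (- (q - p))))"
  proof (rule sum_mono)
    fix j
    have "2 powr ((p - q) * j) * I j \<le> 2 powr ((p - q) * j) * (K * (n * 2 powr (- q * j)) powr (- a))"
      using I(1) by (rule mult_left_mono) simp
    also have "\<dots> = K * (2 powr ((p - q) * j) * (n * 2 powr (- q * j)) powr (- a))" by (simp only: mult_ac)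
    also have "\<dots> = K * (n powr (- a) * 2 powr (b * real j))"
      unfolding shell_weighted_powr[OF n] b(1) ..
    also have "n powr (- a) = x powr (p - q) * x powr (- b)"
      using q by (simp add: x_def powr_powr powr_add[symmetric] b(1)[symmetric] field_simps)
    also have "K * (x powr (p - q) * x powr (- b) * 2 powr (b * real j)) = K * (x powr (p - q) * (2 ^ j / x) powr b)"
      by (simp add: powr_divide powr_realpow[symmetric] powr_powr powr_minus_divide mult_ac)
    also have "\<dots> \<le> (K + 2) * (x powr (p - q) * (2 ^ j / x) powr b)" by (intro mult_right_mono) auto
    finally have 1: "2 powr ((p - q) * j) * I j \<le> ((K + 2) * x powr (p - q)) * (2 ^ j / x) powr b"
      by (simp only: mult_ac)
    have "2 powr ((p - q) * j) * I j \<le> 2 powr ((p - q) * j) * 2"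
      using I(2) by (rule mult_left_mono) simp
    also have "2 powr ((p - q) * j) * 2 = x powr (p - q) * (2 ^ j / x) powr (- (q - p)) * 2"
      using x by (simp add: powr_divide powr_realpow[symmetric] powr_powr mult.commute)
    also have "\<dots> \<le> x powr (p - q) * (2 ^ j / x) powr (- (q - p)) * (K + 2)"
      using K by (intro mult_left_mono) auto
    finally have 2: "2 powr ((p - q) * j) * I j \<le> ((K + 2) * x powr (p - q)) * (2 ^ j / x) powr (- (q - p))"
      by (simp only: mult_ac)
    show "2 powr ((p - q) * j) * I j
        \<le> ((K + 2) * x powr (p - q)) * min ((2 ^ j / x) powr b) ((2 ^ j / x) powr (- (q - p)))"
      using 1 2 by (auto simp: min_def)
  qed
  also have "\<dots> = ((K + 2) * x powr (p - q)) * (\<Sum>j<J. min ((2 ^ j / x) powr b) ((2 ^ j / x) powr (- (q - p))))"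
    by (rule sum_distrib_left[symmetric])
  also have "\<dots> \<le> ((K + 2) * x powr (p - q)) * (1 / (1 - 2 powr (- b)) + 1 / (1 - 2 powr (- (q - p))))"
    using x K pq b by (intro mult_left_mono sum_two_sided_le) auto
  finally show ?thesis unfolding xpq by (simp only: mult_ac)
qed

section \<open>Rates, uniformly in the dimension\<close>

text \<open>The bound is for the p-th power of the distance, hence \<open>p\<close> in the exponent
  and the full \<open>zeta\<close>. The number of levels is tied to \<open>n\<close>, while the
  number \<open>J\<close> of shells is arbitrary so that the series can be reached by a
  limit.\<close>

definition rate_bound :: "real \<Rightarrow> real \<Rightarrow> nat \<Rightarrow> real \<Rightarrow> bool" where
  "rate_bound p q d C \<longleftrightarrow> (\<forall>n\<ge>2. \<forall>J::nat. (\<Sum>j<J. 2 powr ((p - q) * real j) * shell_sum p d n (n * 2 powr (- q * real j)))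
     \<le> C * (real n powr (- (p * min (1 / max (2 * p) (real d)) (1 / p - 1 / q))) * ln (real n) powr zeta p q d))"

lemma zeta_range: "0 \<le> zeta p q d" "zeta p q d \<le> 2"
  by (simp_all add: zeta_def)

text \<open>For n = 2 the logarithm is below 1, and raising its exponent makes it smaller. As ln n
  \<ge> 1/2 and the exponent is at most 2, the loss is at most a factor 4.\<close>

lemma one_le_log_powr:
  fixes n :: nat
  assumes "n \<ge> 2" "0 \<le> z" "z \<le> 2"
  shows "1 \<le> 4 * ln (real n) powr z"
proof -
  have "1 / 2 \<le> ln (2::real)" using ln_le_minus_one[of "1 / 2 :: real"] by (simp add: ln_div)
  also have "ln 2 \<le> ln (real n)" using assms by simp
  finally have ln: "1 / 2 \<le> ln (real n)" .
  show ?thesis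
  proof (cases "1 \<le> ln (real n)")
    case True
    then have "1 \<le> ln (real n) powr z" using assms by (intro ge_one_powr_ge_zero)
    then show ?thesis by simp
  next
    case False
    have "1 / 4 = (1 / 2 :: real) powr 2" by (simp add: power2_eq_square)
    also have "\<dots> \<le> ln (real n) powr 2" using ln by (intro powr_mono2) auto
    also have "\<dots> \<le> ln (real n) powr z" using ln False assms by (intro powr_mono') auto
    finally show ?thesis by simp
  qed
qed

lemma rate_exponent:
  assumes "1 \<le> p" "p < q"
  shows "p * min (1 / max (2 * p) (real d)) (1 / p - 1 / q) = min (p / max (2 * p) (real d)) (1 - p / q)"
  using assms by (simp add: min_mult_distrib_left right_diff_distrib)

text \<open>At the price of the factor 4, a bound without logarithm suffices whatever the value of
  \<open>zeta\<close>. So \<open>zeta\<close> is computed only where a logarithm really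
  appears.\<close>

lemma rate_boundI:
  assumes "C \<ge> 0" "1 \<le> p" "p < q" and e: "min (p / max (2 * p) (real d)) (1 - p / q) = e" and z: "z = 0 \<or> z = zeta p q d"
    and le: "\<And>n J. n \<ge> 2 \<Longrightarrow> (\<Sum>j<J. 2 powr ((p - q) * real j) * shell_sum p d n (n * 2 powr (- q * real j)))
      \<le> C * (real n powr (- e) * ln (real n) powr z)"
  shows "rate_bound p q d (4 * C)"
  unfolding rate_bound_def rate_exponent[OF assms(2,3)] e
proof (intro allI impI)
  fix n J :: nat assume n: "2 \<le> n"
  have "(\<Sum>j<J. 2 powr ((p - q) * real j) * shell_sum p d n (n * 2 powr (- q * real j)))
      \<le> C * (real n powr (- e) * ln (real n) powr z)" using n by (rule le)
  also have "\<dots> \<le> C * (real n powr (- e) * (4 * ln (real n) powr zeta p q d))"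
    using z
  proof (intro mult_left_mono, elim disjE)
    assume "z = 0"
    then show "ln (real n) powr z \<le> 4 * ln (real n) powr zeta p q d"
      using one_le_log_powr[OF n zeta_range, of p q d] n by simp
  next
    assume "z = zeta p q d"
    then show "ln (real n) powr z \<le> 4 * ln (real n) powr zeta p q d" by simp
  qed (use \<open>C \<ge> 0\<close> in auto)
  finally show "(\<Sum>j<J. 2 powr ((p - q) * real j) * shell_sum p d n (n * 2 powr (- q * real j)))
      \<le> 4 * C * (real n powr (- e) * ln (real n) powr zeta p q d)"
    by (simp only: mult_ac)
qed

text \<open>The vanishing exponent is solved for \<open>q\<close>: it gives 2 p for d < 2 p and d p
  / (d - p) for d > 2 p. In each case this is the smaller of the two critical values.\<close>

lemma zeta_eq_1:
  assumes "1 \<le> p" and "p - q + q * (p / max (2 * p) (real d)) = 0" and "real d \<noteq> 2 * p"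
  shows "zeta p q d = 1"
proof (cases "real d < 2 * p")
  case True
  then have q: "q = 2 * p" using assms by (simp add: max_def)
  have "ereal (2 * p) \<le> crit p d"
  proof (cases "real d \<le> p")
    case False
    have "d * p \<le> 2 * p * p" using True assms(1) by (intro mult_right_mono) auto
    then have "2 * p * (d - p) \<le> d * p" by (simp add: algebra_simps)
    then have "2 * p \<le> d * p / (d - p)" using False by (simp add: pos_le_divide_eq)
    then show ?thesis using False by (simp add: crit_def)
  qed (simp add: crit_def)
  then show ?thesis using assms(3) q by (auto simp: zeta_def min_def)
next
  case False
  then have d: "real d > 2 * p" using assms by simp
  then have "q * (d - p) = d * p" using assms by (simp add: max_def field_simps)
  then have q: "q = d * p / (d - p)" using d assms by (simp add: eq_divide_eq)
  have "2 * p * p \<le> d * p" using d assms(1) by (intro mult_right_mono) auto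
  then have "d * p \<le> 2 * p * (d - p)" by (simp add: algebra_simps)
  then have "d * p / (d - p) \<le> 2 * p" using d assms(1) by (simp add: pos_divide_le_eq)
  then show ?thesis using assms d q by (auto simp: zeta_def crit_def min_def)
qed

lemma rate_bound_generic:
  assumes pq: "1 \<le> p" "p < q" and K: "K \<ge> 0" and d: "real d \<noteq> 2 * p"
    and I: "\<And>N t. t > 0 \<Longrightarrow> shell_sum p d N t \<le> K * t powr (- (p / max (2 * p) (real d)))"
  shows "\<exists>C\<ge>0. rate_bound p q d C"
proof -
  define a where "a = p / max (2 * p) (real d)"
  define b where "b = p - q + q * a"
  let ?e = "min a (1 - p / q)"
  \<comment> \<open>The sign that decides the sum over shells also decides which argument of the
    minimum in the rate is the smaller one.\<close>
  have ab: "a - (1 - p / q) = b / q" using pq by (simp add: b_def field_simps)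
  have I1: "shell_sum p d N (n * 2 powr (- q * real j)) \<le> K * (n * 2 powr (- q * real j)) powr (- a)"
    if "n \<ge> 2" for N n j :: nat using that by (intro I[folded a_def]) auto
  have I2: "shell_sum p d N t \<le> 2" for N t by (rule shell_sum_le_2[OF pq(1)])
  consider "b < 0" | "b = 0" | "b > 0" by linarith
  then show ?thesis
  proof cases
    case 1
    then have "a - (1 - p / q) < 0" using ab pq by (simp add: divide_neg_pos)
    then have e: "?e = a" by simp
    let ?C = "K * (1 / (1 - 2 powr (- (- b))))"
    have "?C \<ge> 0" using K geometric_const_pos[of "- b"] 1 by (intro mult_nonneg_nonneg) auto
    moreover have "rate_bound p q d (4 * ?C)"
    proof (rule rate_boundI[OF \<open>?C \<ge> 0\<close> pq e[unfolded a_def], where z=0])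
      fix n J :: nat assume n: "2 \<le> n"
      have "(\<Sum>j<J. 2 powr ((p - q) * real j) * shell_sum p d n (n * 2 powr (- q * real j))) \<le> ?C * n powr (- a)"
        using n 1 by (intro shells_subcritical K I1) (auto simp: b_def)
      then show "(\<Sum>j<J. 2 powr ((p - q) * real j) * shell_sum p d n (n * 2 powr (- q * real j)))
          \<le> ?C * (n powr (- (p / max (2 * p) (real d))) * ln (real n) powr 0)"
        using n by (simp add: a_def)
    qed simp
    ultimately show ?thesis by (intro exI[of _ "4 * ?C"]) auto
  next
    case 2
    then have e: "?e = a" using ab by simp
    have z: "zeta p q d = 1" using zeta_eq_1[OF pq(1) _ d] 2 by (simp add: b_def a_def)
    let ?C = "(K + 2) * (4 + 2 / (1 - 2 powr (- (q - p))))"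
    have "?C \<ge> 0" using K geometric_const_pos[of "q - p"] pq
      by (intro mult_nonneg_nonneg add_nonneg_nonneg) (auto simp: divide_nonneg_nonneg less_imp_le)
    moreover have "rate_bound p q d (4 * ?C)"
    proof (rule rate_boundI[OF \<open>?C \<ge> 0\<close> pq e[unfolded a_def], where z=1])
      fix n J :: nat assume n: "2 \<le> n"
      have "(\<Sum>j<J. 2 powr ((p - q) * real j) * shell_sum p d n (n * 2 powr (- q * real j))) \<le> ?C * ln n * n powr (- a)"
        using n 2 by (intro shells_critical K I1 I2 pq) (auto simp: b_def)
      then show "(\<Sum>j<J. 2 powr ((p - q) * real j) * shell_sum p d n (n * 2 powr (- q * real j)))
          \<le> ?C * (n powr (- (p / max (2 * p) (real d))) * ln (real n) powr 1)"
        using n by (simp add: a_def mult_ac)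
    qed (simp add: z)
    ultimately show ?thesis by (intro exI[of _ "4 * ?C"]) auto
  next
    case 3
    then have "a - (1 - p / q) > 0" using ab pq by simp
    then have e: "?e = 1 - p / q" by simp
    let ?C = "(K + 2) * (1 / (1 - 2 powr (- b)) + 1 / (1 - 2 powr (- (q - p))))"
    have "?C \<ge> 0" using K geometric_const_pos[of "q - p"] geometric_const_pos[of b] pq 3
      by (intro mult_nonneg_nonneg add_nonneg_nonneg) auto
    moreover have "rate_bound p q d (4 * ?C)"
    proof (rule rate_boundI[OF \<open>?C \<ge> 0\<close> pq e[unfolded a_def], where z=0])
      fix n J :: nat assume n: "2 \<le> n"
      have "(\<Sum>j<J. 2 powr ((p - q) * real j) * shell_sum p d n (n * 2 powr (- q * real j))) \<le> ?C * n powr (- (1 - p / q))"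
        using n by (intro shells_supercritical[OF _ K I1[OF n] I2 pq b_def[symmetric] 3]) simp
      then show "(\<Sum>j<J. 2 powr ((p - q) * real j) * shell_sum p d n (n * 2 powr (- q * real j)))
          \<le> ?C * (n powr (- (1 - p / q)) * ln (real n) powr 0)"
        using n by simp
    qed simp
    ultimately show ?thesis by (intro exI[of _ "4 * ?C"]) auto
  qed
qed

text \<open>The levels alone cost a logarithm here. It disappears for q < 2 p, where far shells
  dominate, and meets a second one from the shells for q = 2 p.\<close>

lemma rate_bound_critical_dim:
  assumes pq: "1 \<le> p" "p < q" and d: "real d = 2 * p"
  shows "\<exists>C\<ge>0. rate_bound p q d C"
proof -
  have I2: "shell_sum p d N t \<le> 2" for N t by (rule shell_sum_le_2[OF pq(1)])
  have half: "p / max (2 * p) (real d) = 1 / 2" using d pq by simp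
  define L where "L = 18 powr p * (4 + 2 / (1 - 2 powr (- p)))"
  have L: "L \<ge> 0" using geometric_const_pos[of p] pq unfolding L_def
    by (intro mult_nonneg_nonneg add_nonneg_nonneg) (auto simp: divide_nonneg_nonneg less_imp_le)
  have I1: "shell_sum p d N (n * 2 powr (- q * real j)) \<le> L * ln n * (n * 2 powr (- q * real j)) powr (- (1 / 2))"
    if n: "n \<ge> 2" for N n j :: nat
  proof -
    have "2 powr (- q * real j) \<le> 2 powr 0" using pq by (intro powr_mono) auto
    then have "real n * 2 powr (- q * real j) \<le> real n * 1" by (intro mult_left_mono) auto
    then have "real n * 2 powr (- q * real j) \<le> n" by simp
    then show ?thesis unfolding L_def using n pq d by (intro shell_sum_le_critical) auto
  qed
  have ln0: "0 \<le> ln (real n)" if "n \<ge> 2" for n :: nat using that by simp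
  consider "q < 2 * p" | "q = 2 * p" | "2 * p < q" by linarith
  then show ?thesis
  proof cases
    case 1
    then have e: "min (p / max (2 * p) (real d)) (1 - p / q) = 1 - p / q"
      using pq unfolding half by (simp add: field_simps)
    \<comment> \<open>The midpoint stays below 1/2, so the levels sum without a logarithm, and above
      1 - p / q, so the shells remain supercritical and the rate is unaffected.\<close>
    define a where "a = ((1 - p / q) + 1 / 2) / 2"
    have lt: "1 - p / q < 1 / 2" "0 < 1 - p / q" using 1 pq by (auto simp: field_simps)
    have a: "0 \<le> a" "a \<le> 1 / 2" "a < 1 / 2" "1 - p / q < a" 
    proof -
      have "0 \<le> ((1 - r) + 1 / 2) / 2 \<and> ((1 - r) + 1 / 2) / 2 \<le> 1 / 2 \<and> ((1 - r) + 1 / 2) / 2 < 1 / 2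
          \<and> 1 - r < ((1 - r) + 1 / 2) / 2" if "1 - r < 1 / 2" "0 < 1 - r" for r :: real
        using that by auto
      from this[OF lt] show "0 \<le> a" "a \<le> 1 / 2" "a < 1 / 2" "1 - p / q < a" unfolding a_def by auto
    qed
    have "d * a < p" using a pq d mult_strict_left_mono[of a "1 / 2" "2 * p"] by simp
    note I3 = shell_sum_le_interpolate[OF a(1,2) this]
    let ?K = "18 powr (d * a) / (1 - 2 powr (- (p - d * a)))"
    have K: "?K \<ge> 0" using geometric_const_pos[of "p - d * a"] \<open>d * a < p\<close> 
      by (intro divide_nonneg_nonneg) (auto simp: zero_less_divide_iff less_imp_le)
    define b where "b = p - q + q * a"
    have b: "b > 0" using a(4) pq mult_strict_left_mono[OF a(4), of q] by (simp add: b_def algebra_simps)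
    let ?C = "(?K + 2) * (1 / (1 - 2 powr (- b)) + 1 / (1 - 2 powr (- (q - p))))"
    have "?C \<ge> 0" using K geometric_const_pos[of "q - p"] geometric_const_pos[OF b] pq
      by (intro mult_nonneg_nonneg add_nonneg_nonneg) auto
    moreover have "rate_bound p q d (4 * ?C)"
    proof (rule rate_boundI[OF \<open>?C \<ge> 0\<close> pq e, where z=0])
      fix n J :: nat assume n: "2 \<le> n"
      have "(\<Sum>j<J. 2 powr ((p - q) * real j) * shell_sum p d n (n * 2 powr (- q * real j))) \<le> ?C * n powr (- (1 - p / q))"
        using n by (intro shells_supercritical[OF _ K I3 I2 pq b_def[symmetric] b]) auto
      then show "(\<Sum>j<J. 2 powr ((p - q) * real j) * shell_sum p d n (n * 2 powr (- q * real j)))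
          \<le> ?C * (n powr (- (1 - p / q)) * ln (real n) powr 0)"
        using n by simp
    qed simp
    ultimately show ?thesis by (intro exI[of _ "4 * ?C"]) auto
  next
    case 2
    then have e: "min (p / max (2 * p) (real d)) (1 - p / q) = 1 / 2" using pq unfolding half by simp
    have z: "zeta p q d = 2" using 2 d by (simp add: zeta_def)
    define H where "H = 4 + 2 / (1 - 2 powr (- (q - p)))"
    have H: "H \<ge> 0" using geometric_const_pos[of "q - p"] pq unfolding H_def
      by (intro add_nonneg_nonneg) (auto simp: divide_nonneg_nonneg less_imp_le)
    let ?C = "(L + 4) * H"
    have "?C \<ge> 0" using L H by simp
    moreover have "rate_bound p q d (4 * ?C)"
    proof (rule rate_boundI[OF \<open>?C \<ge> 0\<close> pq e, where z=2])
      fix n J :: nat assume n: "2 \<le> n"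
      \<comment> \<open>The factor \<open>K\<close> of \<open>shells_critical\<close> is taken as
        \<open>L * ln n\<close>, from the levels; the shells contribute the second
        logarithm.\<close>
      have "(\<Sum>j<J. 2 powr ((p - q) * real j) * shell_sum p d n (n * 2 powr (- q * real j)))
          \<le> (L * ln n + 2) * H * ln n * n powr (- (1 / 2))"
        unfolding H_def using n 2 L by (intro shells_critical I1 I2 pq) auto
      also have "\<dots> \<le> ((L + 4) * ln n) * H * ln n * n powr (- (1 / 2))"
      proof -
        have "1 / 2 \<le> ln (2::real)" using ln_le_minus_one[of "1 / 2 :: real"] by (simp add: ln_div)
        also have "ln 2 \<le> ln (real n)" using n by simp
        finally have "L * ln n + 2 \<le> (L + 4) * ln n" by (simp add: distrib_right)
        then show ?thesis using n H by (intro mult_right_mono) auto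
      qed
      also have "\<dots> = ?C * (n powr (- (1 / 2)) * ln (real n) powr 2)"
        using n by (simp add: power2_eq_square)
      finally show "(\<Sum>j<J. 2 powr ((p - q) * real j) * shell_sum p d n (n * 2 powr (- q * real j))) \<le> \<dots>" .
    qed (simp add: z)
    ultimately show ?thesis by (intro exI[of _ "4 * ?C"]) auto
  next
    case 3
    then have e: "min (p / max (2 * p) (real d)) (1 - p / q) = 1 / 2"
      using pq unfolding half by (simp add: field_simps)
    have z: "zeta p q d = 1" using 3 d by (simp add: zeta_def)
    define b where "b = - (p - q + q * (1 / 2))"
    have b: "b > 0" using 3 by (simp add: b_def)
    let ?C = "L * (1 / (1 - 2 powr (- b)))"
    have "?C \<ge> 0" using L geometric_const_pos[OF b] by (intro mult_nonneg_nonneg) auto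
    moreover have "rate_bound p q d (4 * ?C)"
    proof (rule rate_boundI[OF \<open>?C \<ge> 0\<close> pq e, where z=1])
      fix n J :: nat assume n: "2 \<le> n"
      have "(\<Sum>j<J. 2 powr ((p - q) * real j) * shell_sum p d n (n * 2 powr (- q * real j)))
          \<le> (L * ln n) * (1 / (1 - 2 powr (- b))) * n powr (- (1 / 2))"
        using n L b by (intro shells_subcritical I1) (auto simp: b_def)
      then show "(\<Sum>j<J. 2 powr ((p - q) * real j) * shell_sum p d n (n * 2 powr (- q * real j)))
          \<le> ?C * (n powr (- (1 / 2)) * ln (real n) powr 1)"
        using n by (simp add: mult_ac)
    qed (simp add: z)
    ultimately show ?thesis by (intro exI[of _ "4 * ?C"]) auto
  qed
qed

lemma rate_bound_exists:
  assumes pq: "1 \<le> p" "p < q"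
  shows "\<exists>C\<ge>0. rate_bound p q d C"
proof -
  consider "real d < 2 * p" | "real d = 2 * p" | "2 * p < real d" by linarith
  then show ?thesis
  proof cases
    case 1
    then have a: "p / max (2 * p) (real d) = 1 / 2" using pq by simp
    let ?K = "18 powr (d * (1 / 2)) / (1 - 2 powr (- (p - d * (1 / 2))))"
    have "?K \<ge> 0" using geometric_const_pos[of "p - d * (1 / 2)"] 1
      by (intro divide_nonneg_nonneg) (auto simp: zero_less_divide_iff less_imp_le)
    then show ?thesis
    proof (rule rate_bound_generic[OF pq])
      show "shell_sum p d N t \<le> ?K * t powr (- (p / max (2 * p) (real d)))" if "t > 0" for N t
        unfolding a using that 1 by (intro shell_sum_le_interpolate) auto
    qed (use 1 in simp)
  next
    case 2
    then show ?thesis by (rule rate_bound_critical_dim[OF pq])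
  next
    case 3
    then have a: "p / max (2 * p) (real d) = p / d" by simp
    define \<sigma> where "\<sigma> = d / 2 - p"
    have s: "\<sigma> > 0" using 3 by (simp add: \<sigma>_def)
    let ?K = "18 powr p * (1 / (1 - 2 powr (- \<sigma>)) + 1 / (1 - 2 powr (- p)))"
    have "?K \<ge> 0" using geometric_const_pos[OF s] geometric_const_pos[of p] pq
      by (intro mult_nonneg_nonneg add_nonneg_nonneg) auto
    then show ?thesis
    proof (rule rate_bound_generic[OF pq])
      show "shell_sum p d N t \<le> ?K * t powr (- (p / max (2 * p) (real d)))" if "t > 0" for N t
        unfolding a using that s pq by (intro shell_sum_le_high_dim) (auto simp: \<sigma>_def)
    qed (use 3 in simp)
  qed
qed

text \<open>As \<open>d \<rightarrow> \<infinity>\<close> the exponent \<open>p - q + q p / d\<close> tends to \<open>p - q < 0\<close>, so that for large \<open>d\<close> all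
  geometric series involved have ratios bounded away from 1 independently of \<open>d\<close>.\<close>

lemma rate_bound_high_dim:
  assumes pq: "1 \<le> p" "p < q"
  shows "\<exists>C\<ge>0. \<exists>d0. \<forall>d\<ge>d0. rate_bound p q d C"
proof -
  \<comment> \<open>The first bound leaves slack \<sigma> = 1 in
    \<open>shell_sum_le_high_dim\<close>; the second makes q p / d at most (q - p) / 2, so that the
    gap of the shell series is at least \<open>b\<close>.\<close>
  define d0 where "d0 = nat \<lceil>max (2 * p + 2) (2 * q * p / (q - p))\<rceil>"
  define b where "b = (q - p) / 2"
  have b: "b > 0" using pq by (simp add: b_def)
  let ?K = "18 powr p * (1 / (1 - 2 powr (- 1)) + 1 / (1 - 2 powr (- p)))"
  have K: "?K \<ge> 0" using geometric_const_pos[of 1] geometric_const_pos[of p] pq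
    by (intro mult_nonneg_nonneg add_nonneg_nonneg) auto
  let ?C = "?K * (1 / (1 - 2 powr (- b)))"
  have C: "?C \<ge> 0" using geometric_const_pos[OF b] by (intro mult_nonneg_nonneg[OF K]) auto
  have "rate_bound p q d (4 * ?C)" if "d \<ge> d0" for d
  proof -
    have "max (2 * p + 2) (2 * q * p / (q - p)) \<le> d" using that unfolding d0_def by linarith
    then have d: "2 * p + 2 \<le> d" "2 * q * p / (q - p) \<le> d" by auto
    have dpos: "real d > 0" using d pq by linarith
    have "2 * q * p \<le> d * (q - p)" using d(2) pq by (simp add: pos_divide_le_eq)
    then have "q * p / d \<le> (q - p) / 2" using dpos by (simp add: field_simps)
    then have le: "p - q + q * (p / d) \<le> - b" by (simp add: b_def field_simps)
    have "q * (p / d) \<le> q * (1 - p / q)"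
      using le b pq by (simp add: right_diff_distrib)
    then have "p / d \<le> 1 - p / q" by (rule mult_left_le_imp_le) (use pq in simp)
    then have e: "min (p / max (2 * p) (real d)) (1 - p / q) = p / d" using d by simp
    show ?thesis
    proof (rule rate_boundI[OF C pq e, where z=0])
      fix n J :: nat assume n: "2 \<le> n"
      have "(\<Sum>j<J. 2 powr ((p - q) * real j) * shell_sum p d n (n * 2 powr (- q * real j))) \<le> ?C * n powr (- (p / d))"
        using n d pq by (intro shells_subcritical K le b shell_sum_le_high_dim) auto
      then show "(\<Sum>j<J. 2 powr ((p - q) * real j) * shell_sum p d n (n * 2 powr (- q * real j)))
          \<le> ?C * (n powr (- (p / d)) * ln (real n) powr 0)"
        using n by simp
    qed simp
  qed
  then show ?thesis using C by (intro exI[of _ "4 * ?C"]) auto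
qed

lemma rate_bound_mono:
  assumes "rate_bound p q d C" "C \<le> C'"
  shows "rate_bound p q d C'"
  unfolding rate_bound_def
proof (intro allI impI)
  fix n J :: nat assume "2 \<le> n"
  then have "(\<Sum>j<J. 2 powr ((p - q) * real j) * shell_sum p d n (n * 2 powr (- q * real j)))
     \<le> C * (real n powr (- (p * min (1 / max (2 * p) (real d)) (1 / p - 1 / q))) * ln (real n) powr zeta p q d)"
    using assms(1) unfolding rate_bound_def by blast
  also have "\<dots> \<le> C' * (real n powr (- (p * min (1 / max (2 * p) (real d)) (1 / p - 1 / q))) * ln (real n) powr zeta p q d)"
    using assms(2) by (rule mult_right_mono) simp
  finally show "(\<Sum>j<J. 2 powr ((p - q) * real j) * shell_sum p d n (n * 2 powr (- q * real j))) \<le> \<dots>" .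
qed

text \<open>Below \<open>d0\<close> there are finitely many dimensions. Each brings its own
  constant, however close to critical it is, and their sum dominates all of them.\<close>

lemma rate_bound_uniform:
  assumes pq: "1 \<le> p" "p < q"
  shows "\<exists>C\<ge>0. \<forall>d. rate_bound p q d C"
proof -
  obtain C0 d0 where C0: "C0 \<ge> 0" "\<And>d. d \<ge> d0 \<Longrightarrow> rate_bound p q d C0"
    using rate_bound_high_dim[OF pq] by blast
  obtain F where F: "F d \<ge> 0" "rate_bound p q d (F d)" for d
    using rate_bound_exists[OF pq] by metis
  let ?C = "C0 + (\<Sum>d<d0. F d)"
  have "rate_bound p q d ?C" for d
  proof (cases "d \<ge> d0")
    case True
    then show ?thesis using C0 F by (intro rate_bound_mono[OF C0(2)]) (auto intro: sum_nonneg)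
  next
    case False
    then have "F d \<le> (\<Sum>d<d0. F d)" using F by (intro member_le_sum) auto
    then show ?thesis using C0 by (intro rate_bound_mono[OF F(2)]) auto
  qed
  moreover have "?C \<ge> 0" using C0 F by (auto intro: sum_nonneg add_nonneg_nonneg)
  ultimately show ?thesis by blast
qed

section \<open>The final estimate with explicit constant\<close>

lemma suminf_ennreal_le:
  fixes f :: "nat \<Rightarrow> real"
  assumes "\<And>j. 0 \<le> f j" "\<And>J. (\<Sum>j<J. f j) \<le> B"
  shows "(\<Sum>j. ennreal (f j)) \<le> ennreal B"
  unfolding suminf_eq_SUP by (intro SUP_least) (simp add: assms ennreal_leI)

lemma expected_wasserstein_rate:
  assumes pq: "1 \<le> p" "p < q" and C: "C \<ge> 0" "rate_bound p q d C" and d: "d \<ge> 1" and n: "n \<ge> 2" and M: "M > 0"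
    and \<mu>: "prob_space \<mu>" "sets \<mu> = sets (Rd d)"
    and moment: "(\<integral>\<^sup>+x. ennreal (enorm d x powr q) \<partial>\<mu>) \<le> ennreal (M powr q)"
  shows "(\<integral>\<^sup>+X. wasserstein d p (empirical d n X) \<mu> \<partial>(PiM {..<n} (\<lambda>_. \<mu>)))
    \<le> ennreal (2 * (2 powr (p + q + 2) * (4 / (1 - 2 powr (- (q - p))) + C)) powr (1 / p)
        * M * real n powr (- min (1 / max (2 * p) (real d)) (1 / p - 1 / q))
        * ln (real n) powr (zeta p q d / p))"
proof -
  define \<theta> where "\<theta> = min (1 / max (2 * p) (real d)) (1 / p - 1 / q)"
  define R where "R = real n powr (- (p * \<theta>)) * ln (real n) powr zeta p q d"
  define K where "K = 1 / (1 - 2 powr (- (q - p)))"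
  have K: "K > 0" unfolding K_def using pq by (intro geometric_const_pos) simp
  have ln: "ln (real n) > 0" using n by simp
  have R: "R > 0" using n ln by (simp add: R_def)
  define B where "B = (4 * K + C) * R"
  have B: "B > 0" using K C R by (simp add: B_def add_pos_nonneg)
  \<comment> \<open>With \<open>n\<close> levels the transport inside the finest cells costs at most
    a multiple of 1 / n, and the exponent p \<theta> of the rate is at most 1. The factor 4 covers a
    logarithm below 1.\<close>
  have small: "2 powr (- p * n) \<le> 4 * R"
  proof -
    have "p * \<theta> \<le> 1"
      unfolding \<theta>_def rate_exponent[OF pq] using pq by (intro min.coboundedI1) simp
    have "real n \<le> 2 powr n" using of_nat_less_two_power[of n] by (simp add: powr_realpow less_imp_le)
    also have "1 * real n \<le> p * real n" using pq by (intro mult_right_mono) auto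
    then have "2 powr n \<le> 2 powr (p * n)" by (intro powr_mono) auto
    finally have "2 powr (- p * n) \<le> 1 / n"
      using n by (simp add: powr_minus field_simps)
    also have "1 / n = real n powr (- 1)" using n by (simp add: powr_minus field_simps)
    also have "\<dots> \<le> real n powr (- (p * \<theta>))" using n \<open>p * \<theta> \<le> 1\<close> by (intro powr_mono) auto
    also have "\<dots> \<le> real n powr (- (p * \<theta>)) * (4 * ln (real n) powr zeta p q d)"
      using one_le_log_powr[OF n zeta_range, of p q d] by (simp add: mult_le_cancel_left1)
    finally show ?thesis by (simp add: R_def mult_ac)
  qed
  have "(\<Sum>j. ennreal (2 powr (- p * n) * 2 powr ((p - q) * real j) + (\<Sum>k<n. level_term p q d n k j))) \<le> ennreal B"
  proof (rule suminf_ennreal_le)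
    show "0 \<le> 2 powr (- p * n) * 2 powr ((p - q) * real j) + (\<Sum>k<n. level_term p q d n k j)" for j
      by (intro add_nonneg_nonneg sum_nonneg level_term_nonneg) auto
    fix J
    have "(\<Sum>j<J. 2 powr (- p * n) * 2 powr ((p - q) * real j)) = 2 powr (- p * n) * (\<Sum>j<J. 2 powr (- (q - p) * real j))"
      by (simp add: sum_distrib_left)
    also have "\<dots> \<le> (4 * R) * K"
      unfolding K_def using pq R by (intro mult_mono small sum_geometric_le sum_nonneg) auto
    finally have 1: "(\<Sum>j<J. 2 powr (- p * n) * 2 powr ((p - q) * real j)) \<le> 4 * K * R" by (simp add: mult_ac)
    have "(\<Sum>j<J. \<Sum>k<n. level_term p q d n k j)
        = (\<Sum>j<J. 2 powr ((p - q) * real j) * shell_sum p d n (n * 2 powr (- q * real j)))"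
      using n by (intro sum.cong refl sum_level_term) simp
    also have "\<dots> \<le> C * R"
      using C(2) n unfolding rate_bound_def R_def \<theta>_def by blast
    finally show "(\<Sum>j<J. 2 powr (- p * n) * 2 powr ((p - q) * real j) + (\<Sum>k<n. level_term p q d n k j)) \<le> B"
      using 1 by (simp add: sum.distrib B_def distrib_right)
  qed
  then have "(\<integral>\<^sup>+X. wasserstein d p (empirical d n X) \<mu> \<partial>(PiM {..<n} (\<lambda>_. \<mu>)))
    \<le> ennreal (2 * (2 powr (p + q + 2) * M powr p * B) powr (1 / p))"
    using n by (intro expected_wasserstein_le d pq M \<mu> moment B) auto
  also have "2 powr (p + q + 2) * M powr p * B = (2 powr (p + q + 2) * (4 * K + C)) * M powr p * R"
    by (simp add: B_def)
  also have "\<dots> powr (1 / p) = (2 powr (p + q + 2) * (4 * K + C)) powr (1 / p) * (M powr p) powr (1 / p) * R powr (1 / p)"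
    by (simp only: powr_mult)
  also have "(M powr p) powr (1 / p) = M" using M pq by (simp add: powr_powr)
  also have "R powr (1 / p) = real n powr (- \<theta>) * ln (real n) powr (zeta p q d / p)"
    using pq by (simp add: R_def powr_mult powr_powr)
  finally show ?thesis by (simp add: \<theta>_def K_def mult.assoc)
qed

theorem theorem3p1:
  fixes p q :: real
  assumes "1 \<le> p" and "p < q"
  shows "\<exists>c::real. \<forall>(d::nat)\<ge>1. \<forall>(n::nat)\<ge>2. \<forall>(\<mu>::(nat \<Rightarrow> real) measure) (M::real).
    prob_space \<mu> \<longrightarrow> sets \<mu> = sets (Rd d) \<longrightarrow>
    integrable \<mu> (\<lambda>x. enorm d x powr q) \<longrightarrow>
    (\<integral>x. enorm d x powr q \<partial>\<mu>) powr (1 / q) = M \<longrightarrow>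
    (\<integral>\<^sup>+X. wasserstein d p (empirical d n X) \<mu> \<partial>(PiM {..<n} (\<lambda>_. \<mu>)))
      \<le> ennreal (c * M * real n powr (- min (1 / max (2 * p) (real d)) (1 / p - 1 / q))
                   * ln (real n) powr (zeta p q d / p))"
proof -
  obtain C where C: "C \<ge> 0" "\<And>d. rate_bound p q d C"
    using rate_bound_uniform[OF assms] by blast
  define c where "c = 2 * (2 powr (p + q + 2) * (4 / (1 - 2 powr (- (q - p))) + C)) powr (1 / p)"
  show ?thesis
  proof (intro exI[of _ c] allI impI)
    fix d n :: nat and \<mu> :: "(nat \<Rightarrow> real) measure" and M :: real
    assume d: "1 \<le> d" and n: "2 \<le> n" and \<mu>: "prob_space \<mu>" "sets \<mu> = sets (Rd d)"
      and int: "integrable \<mu> (\<lambda>x. enorm d x powr q)"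
      and M: "(\<integral>x. enorm d x powr q \<partial>\<mu>) powr (1 / q) = M"
    let ?W = "\<integral>\<^sup>+X. wasserstein d p (empirical d n X) \<mu> \<partial>(PiM {..<n} (\<lambda>_. \<mu>))"
    define S where "S = real n powr (- min (1 / max (2 * p) (real d)) (1 / p - 1 / q))
                   * ln (real n) powr (zeta p q d / p)"
    have r: "c * S \<ge> 0" by (simp add: c_def S_def)
    have M0: "M \<ge> 0" using M by auto
    have "(\<integral>x. enorm d x powr q \<partial>\<mu>) \<ge> 0" by simp
    then have Mq: "(\<integral>x. enorm d x powr q \<partial>\<mu>) = M powr q"
      using assms by (simp add: M[symmetric] powr_powr)
    have approx: "?W \<le> ennreal (c * S * M) + ennreal e" if e: "e > 0" for e
    proof -
      \<comment> \<open>The shells have radii proportional to the moment bound, which must not vanish.\<close>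
      define M' where "M' = M + e / (c * S + 1)"
      have M': "M' > 0" "M \<le> M'" using e r M0 by (auto simp: M'_def add_nonneg_pos)
      have "(\<integral>\<^sup>+x. ennreal (enorm d x powr q) \<partial>\<mu>) = ennreal (M powr q)"
        using nn_integral_eq_integral[OF int] Mq by simp
      also have "\<dots> \<le> ennreal (M' powr q)"
        using M' M0 assms by (intro ennreal_leI powr_mono2) auto
      finally have "?W \<le> ennreal (c * M' * real n powr (- min (1 / max (2 * p) (real d)) (1 / p - 1 / q))
          * ln (real n) powr (zeta p q d / p))"
        unfolding c_def by (intro expected_wasserstein_rate assms C d n M' \<mu>)
      also have "\<dots> \<le> ennreal (c * S * M + e)"
      proof (rule ennreal_leI)
        have "c * M' * real n powr (- min (1 / max (2 * p) (real d)) (1 / p - 1 / q))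
            * ln (real n) powr (zeta p q d / p) = (c * S) * M'"
          unfolding S_def by (simp only: mult_ac)
        \<comment> \<open>Adding 1 keeps the denominator positive even if \<open>c * S\<close>
          vanishes and limits the surplus to \<open>e\<close>.\<close>
        also have "\<dots> = c * S * M + e * (c * S / (c * S + 1))"
          by (simp add: M'_def distrib_left)
        also have "e * (c * S / (c * S + 1)) \<le> e * 1"
          using e r by (intro mult_left_mono) auto
        finally show "c * M' * real n powr (- min (1 / max (2 * p) (real d)) (1 / p - 1 / q))
            * ln (real n) powr (zeta p q d / p) \<le> c * S * M + e" by simp
      qed
      also have "\<dots> = ennreal (c * S * M) + ennreal e"
        using e r M0 by (intro ennreal_plus) auto
      finally show ?thesis .
    qed
    have "?W \<le> ennreal (c * S * M)" by (rule ennreal_le_epsilon) (rule approx)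
    also have "c * S * M = c * M * real n powr (- min (1 / max (2 * p) (real d)) (1 / p - 1 / q))
                   * ln (real n) powr (zeta p q d / p)"
      unfolding S_def by (simp only: mult_ac)
    finally show "?W \<le> ennreal (c * M * real n powr (- min (1 / max (2 * p) (real d)) (1 / p - 1 / q))
                   * ln (real n) powr (zeta p q d / p))" .
  qed
qed

end
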